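(* Fix $\sigma<\frac12$. Let $\mu$ be the Gaussian measure on $H^{\sigma}(\mathbb{T})$, and for $\kappa>0$, a cut-off $\chi$ associated with $\kappa$, and $N\ge 1$, let $G_N$ be the density $$G_{N}(u)=\chi\big(\|u_{N}\|_{L^2(\mathbb{T})}\big)\,\exp\Big(\tfrac{3}{4}f_{N}(u)-\tfrac12\int_{\mathbb{T}}|u_{N}(x)|^6\,dx\Big)$$ (all objects as defined in the context). Then the sequence $(G_{N})_{N\ge1}$ converges in measure, as $N\to\infty$, with respect to the measure $\mu$. Denote by $G(u)$ the limit, and define the measure $\rho$ on $H^\sigma(\mathbb{T})$ by $d\rho(u)= G(u)\,d\mu(u)$. Moreover, for every $p\in[1,\infty)$ there exists $\kappa_{p}>0$ such that for all $0<\kappa\leq\kappa_{p}$ (and $\chi$ associated with $\kappa$) one has $G\in L^{p}(d\mu)$, and the sequence $G_{N}$ converges to $G$ in $L^{p}(d\mu)$ as $N\to\infty$.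
   Context: $\mathbb{T}=\mathbb{R}/2\pi\mathbb{Z}$, and $\int_{\mathbb{T}}f(x)\,dx:=\frac1{2\pi}\int_0^{2\pi}f(x)\,dx$ (normalised integral; $L^p(\mathbb{T})$ norms are taken with respect to it). $\langle n\rangle=\sqrt{n^2+1}$. Gaussian measure $\mu$: let $(g_n)_{n\in\mathbb{Z}}$ be independent complex normalised Gaussians on a probability space $(\Omega,\mathcal{F},\mathbf{p})$, i.e. $g_n=\frac1{\sqrt2}(h_n+i\,l_n)$ with $(h_n)_{n\in\mathbb{Z}},(l_n)_{n\in\mathbb{Z}}$ independent standard real Gaussians $\mathcal N_{\mathbb R}(0,1)$. For $\sigma<\frac12$ the series $\varphi(\omega,x)=\sum_{n\in\mathbb{Z}}\frac{g_n(\omega)}{\langle n\rangle}e^{inx}$ converges in $L^2(\Omega;H^\sigma(\mathbb{T}))$, and $\mu$ is the law of $\varphi$ on $H^\sigma(\mathbb{T})$. For $u=\sum_{n}c_ne^{inx}$, $u_N=\Pi_N u=\sum_{|n|\le N}c_ne^{inx}$, and $$f_{N}(u)=\mathrm{Im}\int_{\mathbb{T}}\overline{u_{N}^{2}(x)}\,\partial_{x}\big(u_{N}^{2}(x)\big)\,dx.$$ For $\kappa>0$, a cut-off associated with $\kappa$ is a continuous function $\chi:\mathbb{R}\to\mathbb{R}$ with $0\le\chi\le1$, $\mathrm{supp}\,\chi\subset[-\kappa,\kappa]$ and $\chi=1$ on $[-\frac\kappa2,\frac\kappa2]$. *)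

theory Defs
  imports "HOL-Probability.Probability"
begin

text \<open>
  A periodic distribution \<open>u = \<Sum>\<^sub>n c\<^sub>n e\<^bsup>inx\<^esup>\<close> is represented by its family of Fourier coefficients
  \<open>c :: int \<Rightarrow> complex\<close>.  This covers negative \<open>\<sigma>\<close>, where the elements of \<open>H\<^sup>\<sigma>\<close> need not be
  functions.
\<close>

definition jbracket :: "int \<Rightarrow> real" where
  "jbracket n = sqrt ((real_of_int n)\<^sup>2 + 1)"

definition sobolev :: "real \<Rightarrow> (int \<Rightarrow> complex) set" where
  "sobolev \<sigma> = {c. (\<lambda>n. jbracket n powr (2 * \<sigma>) * (cmod (c n))\<^sup>2) summable_on UNIV}"

definition sobolev_norm :: "real \<Rightarrow> (int \<Rightarrow> complex) \<Rightarrow> real" where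
  "sobolev_norm \<sigma> c = sqrt (\<Sum>\<^sub>\<infinity>n. jbracket n powr (2 * \<sigma>) * (cmod (c n))\<^sup>2)"

definition sobolev_dist :: "real \<Rightarrow> (int \<Rightarrow> complex) \<Rightarrow> (int \<Rightarrow> complex) \<Rightarrow> real" where
  "sobolev_dist \<sigma> c d = sobolev_norm \<sigma> (\<lambda>n. c n - d n)"

lemma jbracket_pos: "jbracket n > 0"
  unfolding jbracket_def by (simp add: add_nonneg_pos)

lemma sobolev_weight: "jbracket n powr (2 * \<sigma>) * (cmod z)\<^sup>2 = (jbracket n powr \<sigma> * cmod z)\<^sup>2"
  using jbracket_pos[of n] by (simp add: power_mult_distrib power2_eq_square powr_add[symmetric])

lemma sobolev_norm_nonneg: "0 \<le> sobolev_norm \<sigma> c"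
  unfolding sobolev_norm_def by (intro real_sqrt_ge_zero infsum_nonneg) simp

lemma L2_set_le_sobolev_norm:
  assumes "c \<in> sobolev \<sigma>" "finite F"
  shows "L2_set (\<lambda>n. jbracket n powr \<sigma> * cmod (c n)) F \<le> sobolev_norm \<sigma> c"
  unfolding L2_set_def sobolev_norm_def
  using assms by (auto simp: sobolev_def sobolev_weight intro!: real_sqrt_le_mono finite_sum_le_infsum)

lemma sobolev_add:
  assumes c: "c \<in> sobolev \<sigma>" and d: "d \<in> sobolev \<sigma>"
  shows "(\<lambda>n. c n + d n) \<in> sobolev \<sigma>"
    and "sobolev_norm \<sigma> (\<lambda>n. c n + d n) \<le> sobolev_norm \<sigma> c + sobolev_norm \<sigma> d"
proof -
  let ?B = "sobolev_norm \<sigma> c + sobolev_norm \<sigma> d"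
  let ?f = "\<lambda>n. jbracket n powr (2 * \<sigma>) * (cmod (c n + d n))\<^sup>2"
  have B: "?B \<ge> 0" by (simp add: sobolev_norm_nonneg)
  have fin: "sum ?f F \<le> ?B\<^sup>2" if F: "finite F" for F
  proof -
    have "L2_set (\<lambda>n. jbracket n powr \<sigma> * cmod (c n + d n)) F
        \<le> L2_set (\<lambda>n. jbracket n powr \<sigma> * cmod (c n) + jbracket n powr \<sigma> * cmod (d n)) F"
      by (intro L2_set_mono)
         (simp_all add: distrib_left[symmetric] mult_left_mono norm_triangle_ineq)
    also have "\<dots> \<le> L2_set (\<lambda>n. jbracket n powr \<sigma> * cmod (c n)) F
                   + L2_set (\<lambda>n. jbracket n powr \<sigma> * cmod (d n)) F"
      by (rule L2_set_triangle_ineq)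
    also have "\<dots> \<le> ?B"
      by (intro add_mono L2_set_le_sobolev_norm c d F)
    finally have "sqrt (sum ?f F) \<le> ?B"
      by (simp add: L2_set_def sobolev_weight)
    then show ?thesis
      by (rule sqrt_le_D)
  qed
  have s: "?f summable_on UNIV"
    by (rule nonneg_bdd_above_summable_on) (auto intro!: bdd_aboveI2[where M = "?B\<^sup>2"] fin)
  show "(\<lambda>n. c n + d n) \<in> sobolev \<sigma>"
    using s by (simp add: sobolev_def)
  have "infsum ?f UNIV \<le> ?B\<^sup>2"
    by (rule infsum_le_finite_sums[OF s]) (auto intro: fin)
  then show "sobolev_norm \<sigma> (\<lambda>n. c n + d n) \<le> ?B"
    unfolding sobolev_norm_def[of \<sigma> "\<lambda>n. c n + d n"] by (rule real_le_lsqrt[OF B])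
qed

lemma sobolev_uminus:
  "(\<lambda>n. - c n) \<in> sobolev \<sigma> \<longleftrightarrow> c \<in> sobolev \<sigma>"
  by (simp add: sobolev_def)

lemma sobolev_diff:
  assumes "c \<in> sobolev \<sigma>" "d \<in> sobolev \<sigma>"
  shows "(\<lambda>n. c n - d n) \<in> sobolev \<sigma>"
  using sobolev_add(1)[of c \<sigma> "\<lambda>n. - d n"] assms by (simp add: sobolev_uminus)

lemma sobolev_dist_eq_0:
  assumes "c \<in> sobolev \<sigma>" "d \<in> sobolev \<sigma>"
  shows "sobolev_dist \<sigma> c d = 0 \<longleftrightarrow> c = d"
proof
  assume "sobolev_dist \<sigma> c d = 0"
  then have "sobolev_norm \<sigma> (\<lambda>n. c n - d n) = 0" by (simp add: sobolev_dist_def)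
  then have "cmod (c n - d n) = 0" for n
    using L2_set_le_sobolev_norm[OF sobolev_diff[OF assms], of "{n}"] jbracket_pos[of n]
    by (simp add: mult_le_0_iff)
  then show "c = d" by (auto simp: fun_eq_iff)
qed (simp add: sobolev_dist_def sobolev_norm_def)

lemma Metric_space_sobolev: "Metric_space (sobolev \<sigma>) (sobolev_dist \<sigma>)"
proof
  fix x y z assume xyz: "x \<in> sobolev \<sigma>" "y \<in> sobolev \<sigma>" "z \<in> sobolev \<sigma>"
  show "sobolev_dist \<sigma> x z \<le> sobolev_dist \<sigma> x y + sobolev_dist \<sigma> y z"
    using sobolev_add(2)[OF sobolev_diff[OF xyz(1,2)] sobolev_diff[OF xyz(2,3)]]
    by (simp add: sobolev_dist_def)
qed (simp_all add: sobolev_dist_eq_0,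
     simp_all add: sobolev_dist_def sobolev_norm_def norm_minus_commute infsum_nonneg)

definition sobolev_borel :: "real \<Rightarrow> (int \<Rightarrow> complex) measure" where
  "sobolev_borel \<sigma> =
     sigma (sobolev \<sigma>) {U. openin (Metric_space.mtopology (sobolev \<sigma>) (sobolev_dist \<sigma>)) U}"


text \<open>\<open>case_sum h l\<close> is the joint family \<open>(h\<^sub>n)\<^sub>n, (l\<^sub>n)\<^sub>n\<close>, so that all these variables are mutually
  independent.\<close>

definition std_gaussian_families ::
    "'o measure \<Rightarrow> (int \<Rightarrow> 'o \<Rightarrow> real) \<Rightarrow> (int \<Rightarrow> 'o \<Rightarrow> real) \<Rightarrow> bool" where
  "std_gaussian_families P h l \<longleftrightarrow>
     prob_space P \<and>
     prob_space.indep_vars P (\<lambda>_. borel) (case_sum h l) UNIV \<and>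
     (\<forall>n. distributed P lborel (h n) std_normal_density) \<and>
     (\<forall>n. distributed P lborel (l n) std_normal_density)"

definition cgauss :: "(int \<Rightarrow> 'o \<Rightarrow> real) \<Rightarrow> (int \<Rightarrow> 'o \<Rightarrow> real) \<Rightarrow> int \<Rightarrow> 'o \<Rightarrow> complex" where
  "cgauss h l n \<omega> = (complex_of_real (h n \<omega>) + \<i> * complex_of_real (l n \<omega>)) / complex_of_real (sqrt 2)"

definition trunc :: "nat \<Rightarrow> (int \<Rightarrow> complex) \<Rightarrow> int \<Rightarrow> complex" where
  "trunc N c n = (if \<bar>n\<bar> \<le> int N then c n else 0)"

text \<open>\<open>\<phi>\<close> is the sum of \<open>\<Sum>\<^sub>n g\<^sub>n e\<^bsup>inx\<^esup> / \<langle>n\<rangle>\<close> in \<open>L\<^sup>2(\<Omega>; H\<^sup>\<sigma>)\<close>; the extended nonnegative integral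
  makes convergence to 0 entail finiteness.\<close>

definition gaussian_series ::
    "real \<Rightarrow> 'o measure \<Rightarrow> (int \<Rightarrow> 'o \<Rightarrow> complex) \<Rightarrow> ('o \<Rightarrow> int \<Rightarrow> complex) \<Rightarrow> bool" where
  "gaussian_series \<sigma> P g \<phi> \<longleftrightarrow>
     \<phi> \<in> measurable P (sobolev_borel \<sigma>) \<and>
     (\<lambda>N. \<integral>\<^sup>+\<omega>. ennreal ((sobolev_dist \<sigma>
              (trunc N (\<lambda>n. g n \<omega> / complex_of_real (jbracket n))) (\<phi> \<omega>))\<^sup>2) \<partial>P)
       \<longlonglongrightarrow> 0"


definition torus_integral :: "(real \<Rightarrow> 'b::{banach, second_countable_topology}) \<Rightarrow> 'b" where
  "torus_integral f = (1 / (2 * pi)) *\<^sub>R (LINT x:{0..2 * pi}|lborel. f x)"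

definition proj :: "nat \<Rightarrow> (int \<Rightarrow> complex) \<Rightarrow> real \<Rightarrow> complex" where
  "proj N c x = (\<Sum>n\<in>{- int N..int N}. c n * exp (\<i> * of_int n * complex_of_real x))"

definition L2_norm_torus :: "(real \<Rightarrow> complex) \<Rightarrow> real" where
  "L2_norm_torus v = sqrt (torus_integral (\<lambda>x. (cmod (v x))\<^sup>2))"

definition f_trunc :: "nat \<Rightarrow> (int \<Rightarrow> complex) \<Rightarrow> real" where
  "f_trunc N u = Im (torus_integral (\<lambda>x. cnj ((proj N u x)\<^sup>2) *
                       vector_derivative (\<lambda>y. (proj N u y)\<^sup>2) (at x)))"

definition cutoff :: "real \<Rightarrow> (real \<Rightarrow> real) \<Rightarrow> bool" where
  "cutoff \<kappa> chi \<longleftrightarrow>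
     continuous_on UNIV chi \<and>
     (\<forall>x. 0 \<le> chi x \<and> chi x \<le> 1) \<and>
     closure {x. chi x \<noteq> 0} \<subseteq> {-\<kappa>..\<kappa>} \<and>
     (\<forall>x\<in>{-\<kappa>/2..\<kappa>/2}. chi x = 1)"

definition G_trunc :: "(real \<Rightarrow> real) \<Rightarrow> nat \<Rightarrow> (int \<Rightarrow> complex) \<Rightarrow> real" where
  "G_trunc chi N u = chi (L2_norm_torus (proj N u)) *
     exp (3 / 4 * f_trunc N u - 1 / 2 * torus_integral (\<lambda>x. (cmod (proj N u x)) ^ 6))"


definition converges_in_measure ::
    "'a measure \<Rightarrow> (nat \<Rightarrow> 'a \<Rightarrow> real) \<Rightarrow> ('a \<Rightarrow> real) \<Rightarrow> bool" where
  "converges_in_measure M F f \<longleftrightarrow>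
     (\<forall>N. F N \<in> borel_measurable M) \<and> f \<in> borel_measurable M \<and>
     (\<forall>\<epsilon>>0. (\<lambda>N. emeasure M {x \<in> space M. \<bar>F N x - f x\<bar> > \<epsilon>}) \<longlonglongrightarrow> 0)"

definition in_Lp :: "real \<Rightarrow> 'a measure \<Rightarrow> ('a \<Rightarrow> real) \<Rightarrow> bool" where
  "in_Lp p M f \<longleftrightarrow> f \<in> borel_measurable M \<and> integrable M (\<lambda>x. \<bar>f x\<bar> powr p)"

definition converges_in_Lp ::
    "real \<Rightarrow> 'a measure \<Rightarrow> (nat \<Rightarrow> 'a \<Rightarrow> real) \<Rightarrow> ('a \<Rightarrow> real) \<Rightarrow> bool" where
  "converges_in_Lp p M F f \<longleftrightarrow>
     (\<forall>N. in_Lp p M (F N)) \<and> in_Lp p M f \<and>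
     (\<lambda>N. (LINT x|M. \<bar>F N x - f x\<bar> powr p) powr (1 / p)) \<longlonglongrightarrow> 0"

end

(*
  Write X_n = g_n / <n>. In Fourier variables f_N(u) is the sum over k of k |q_k|^2, where q is the
  convolution square of the truncated coefficients.

  Convergence. Clip the coefficients at |X_n| <= L <n>^(-15/16); with overwhelming probability in L
  this changes nothing. For clipped coefficients the increments of the mass, of f_N and of the sextic
  integral caused by the two new modes +N and -N are of size L^6 N^(-5/8), hence square summable, and
  their means over the new modes are of size L^6 N^(-13/8), hence summable: the terms linear in a new
  coefficient have mean zero, and in f_N the terms N |X_N|^2 and -N |X_(-N)|^2 cancel in the mean.
  Bounding exponential moments as for a martingale with bounded differences gives
  P(|H_N - H_M| > 1/j^2) <= C exp(-K j) for N >= M >= j^72 and any K, and Borel-Cantelli yields almost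
  sure convergence of G_N.

  Integrability. It suffices to show P(f_N > j, ||u_N|| <= kappa) <= C exp(-K j) with K as large as we
  please when kappa is small. By the previous estimate only N <= j^72 matters. There
  f_N <= 4 (sum |n| |X_n|^2) (sum |X_n|)^2, and the frequencies are split at |n| = j: the H^1 norm of
  the low part is O(sqrt j) outside an event of probability exp(-K j), so interpolation with the L^2
  norm bounds its contribution by a small multiple of kappa^2 j, while the high part contributes
  o(sqrt j) to each factor. Uniform bounds on the moments of order 2p and almost sure convergence
  give convergence in L^p.
*)

theory Submission
  imports Defs "HOL-Real_Asymp.Real_Asymp"
begin

section \<open>Functionals with small increments\<close>

text \<open>The obstacle is that f_N is quartic in Gaussians: a quartic of this kind need not have
  exponential moments, and the absolute majorant sum |n| |X_n|^2 diverges logarithmically. Clipping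
  supplies bounded differences. Adding the modes N and -N together keeps a cancellation that
  absolute values would destroy. The clipping exponent 1/16 is a compromise. It must be positive, so
  that the probabilities of |g_n| exceeding L <n>^(1/16) are summable in n. It must be small,
  because it lets sum |X_n| grow like N^(1/16): the sextic increment is then of order N^(-15/16)
  N^(5/16) = N^(-5/8), and its square N^(-5/4) is still summable. In the tail bound, N \<le> j^72
  turns the divergent sum of 1/|n| into O(log j), which a small power of j absorbs. The low
  frequencies scale exactly like j, so only the smallness of \<kappa> can beat an arbitrary rate K
  there. The sextic integral has a favourable sign and is simply dropped from the moment
  estimate.\<close>

lemma jbracket_ge_1: "1 \<le> jbracket n"
  by (simp add: jbracket_def)

lemma jbracket_ge_abs: "\<bar>real_of_int n\<bar> \<le> jbracket n"
  unfolding jbracket_def by (rule real_le_rsqrt) simp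

lemma jbracket_uminus [simp]: "jbracket (- n) = jbracket n"
  by (simp add: jbracket_def)

lemma trunc_trunc: "trunc M (trunc N c) = trunc (min M N) c"
  by (auto simp: trunc_def fun_eq_iff)

text \<open>The size of a clipped coefficient: L <n>^(1/16) from the Gaussian, divided by
  <n>.\<close>

definition radius :: "real \<Rightarrow> int \<Rightarrow> real" where
  "radius L n = L * jbracket n powr (- 15 / 16)"

text \<open>The argument z is the Gaussian before division by <n>. Being odd in z, clipping keeps a
  symmetric law centred; depending on n only through <n>, it gives the modes n and -n the same
  law.\<close>

definition clip :: "real \<Rightarrow> int \<Rightarrow> complex \<Rightarrow> complex" where
  "clip L n z = (if cmod z \<le> L * jbracket n powr (1 / 16) then z else 0) / of_real (jbracket n)"

lemma radius_uminus [simp]: "radius L (- n) = radius L n"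
  by (simp add: radius_def)

lemma radius_nonneg: "0 \<le> L \<Longrightarrow> 0 \<le> radius L n"
  by (simp add: radius_def)

lemma radius_le:
  assumes "0 \<le> L" "0 < x" "x \<le> \<bar>real_of_int n\<bar>"
  shows "radius L n \<le> L * x powr (- 15 / 16)"
  unfolding radius_def using assms jbracket_ge_abs[of n]
  by (intro mult_left_mono powr_mono2') auto

lemma clip_uminus_index [simp]: "clip L (- n) z = clip L n z"
  by (simp add: clip_def)

lemma clip_uminus: "clip L n (- z) = - clip L n z"
  by (simp add: clip_def)

lemma cmod_clip_le:
  assumes "0 \<le> L"
  shows "cmod (clip L n z) \<le> radius L n"
proof -
  have j: "jbracket n > 0" by (rule jbracket_pos)
  have "jbracket n powr (1 / 16) / jbracket n = jbracket n powr (- 15 / 16)"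
    using j powr_diff[of "jbracket n" "1 / 16" 1] by simp
  then have "radius L n = L * jbracket n powr (1 / 16) / jbracket n"
    by (metis radius_def times_divide_eq_right)
  then show ?thesis
    using j assms by (auto simp: clip_def norm_divide divide_right_mono)
qed

lemma measurable_clip [measurable]: "clip L n \<in> borel_measurable borel"
  unfolding clip_def by measurable

text \<open>
  The increment \<open>H N c - H (N - 1) c\<close> depends on the two new coefficients \<open>c\<^sub>N\<close> and \<open>c\<^sub>-\<^sub>N\<close>. The bounds
  on the increment and on its mean are square summable and summable in \<open>N\<close>, respectively, so that
  \<open>H N\<close> behaves like a martingale with bounded differences when the coefficients are independent
  and clipped.
\<close>

locale increment_bounds =
  fixes H :: "nat \<Rightarrow> (int \<Rightarrow> complex) \<Rightarrow> real" and C :: real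
  assumes C_nonneg: "0 \<le> C"
    and measurable_PiM: "H N \<in> borel_measurable (PiM UNIV (\<lambda>_. borel))"
    and trunc_eq: "H N (trunc N c) = H N c"
    and increment_le: "1 \<le> L \<Longrightarrow> 1 \<le> N \<Longrightarrow> (\<And>n. cmod (c n) \<le> radius L n)
          \<Longrightarrow> \<bar>H N c - H (N - 1) c\<bar> \<le> C * L ^ 6 * real N powr (- 5 / 8)"
    and mean_increment_le: "1 \<le> L \<Longrightarrow> 1 \<le> N \<Longrightarrow> (\<And>n. cmod (c n) \<le> radius L n)
          \<Longrightarrow> prob_space \<eta> \<Longrightarrow> sets \<eta> = sets borel
          \<Longrightarrow> (AE z in \<eta>. cmod z \<le> radius L (int N)) \<Longrightarrow> (\<integral>z. z \<partial>\<eta>) = 0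
          \<Longrightarrow> \<bar>\<integral>y. (\<integral>z. H N (c(int N := y, - int N := z)) - H (N - 1) c \<partial>\<eta>) \<partial>\<eta>\<bar>
              \<le> C * L ^ 6 * real N powr (- 13 / 8)"
begin

lemma measurable_comp:
  assumes "\<And>n. \<bar>n\<bar> \<le> int N \<Longrightarrow> (\<lambda>x. g x n) \<in> borel_measurable M"
  shows "(\<lambda>x. H N (g x)) \<in> borel_measurable M"
proof -
  have "(\<lambda>x. trunc N (g x)) \<in> measurable M (PiM UNIV (\<lambda>_. borel))"
  proof (rule measurable_PiM_single')
    show "(\<lambda>x. trunc N (g x) n) \<in> borel_measurable M" for n
      by (cases "\<bar>n\<bar> \<le> int N") (auto simp: trunc_def assms)
  qed auto
  then have "(\<lambda>x. H N (trunc N (g x))) \<in> borel_measurable M"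
    using measurable_PiM by (rule measurable_compose)
  then show ?thesis by (simp add: trunc_eq)
qed

lemma cong:
  assumes "\<And>n. \<bar>n\<bar> \<le> int N \<Longrightarrow> c n = d n"
  shows "H N c = H N d"
proof -
  have "trunc N c = trunc N d" using assms by (auto simp: trunc_def fun_eq_iff)
  then show ?thesis by (metis trunc_eq)
qed

text \<open>Turns the one-sided exponential tail bounds proved below into two-sided ones.\<close>

lemma uminus: "increment_bounds (\<lambda>N c. - H N c) C"
proof
  fix L :: real and N :: nat and c \<eta>
  assume a: "1 \<le> L" "1 \<le> N" "\<And>n. cmod (c n) \<le> radius L n"
  show "\<bar>- H N c - - H (N - 1) c\<bar> \<le> C * L ^ 6 * real N powr (- 5 / 8)"
    using increment_le[OF a] by linarith
  assume b: "prob_space \<eta>" "sets \<eta> = sets borel" "AE z in \<eta>. cmod z \<le> radius L (int N)"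
    "(\<integral>z. z \<partial>\<eta>) = 0"
  have "(\<integral>y. (\<integral>z. - H N (c(int N := y, - int N := z)) - - H (N - 1) c \<partial>\<eta>) \<partial>\<eta>)
      = (\<integral>y. (\<integral>z. - (H N (c(int N := y, - int N := z)) - H (N - 1) c) \<partial>\<eta>) \<partial>\<eta>)"
    by (simp add: algebra_simps)
  then show "\<bar>\<integral>y. (\<integral>z. - H N (c(int N := y, - int N := z)) - - H (N - 1) c \<partial>\<eta>) \<partial>\<eta>\<bar>
        \<le> C * L ^ 6 * real N powr (- 13 / 8)"
    using mean_increment_le[OF a b] by (simp only: Bochner_Integration.integral_minus abs_minus_cancel)
qed (use C_nonneg measurable_PiM trunc_eq in auto)

end

section \<open>Exponential moments of the increments\<close>

lemma exp_le_quadratic: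
  fixes x :: real
  assumes "\<bar>x\<bar> \<le> 1"
  shows "exp x \<le> 1 + x + x\<^sup>2"
proof (cases "0 \<le> x")
  case True
  then show ?thesis using exp_bound assms by auto
next
  case False
  define y where "y = - x"
  have y: "0 \<le> y" using False by (simp add: y_def)
  \<comment> \<open>Multiplied by exp y, the claim for x = -y reads 1 \<le> (1 - y + y^2) exp y; the
    quadratic Taylor minorant of exp y already suffices.\<close>
  have "1 \<le> (1 - y + y\<^sup>2) * (1 + y + y\<^sup>2 / 2)"
  proof -
    have "(1 - y + y\<^sup>2) * (1 + y + y\<^sup>2 / 2) = 1 + (y\<^sup>2 + y ^ 3 + y ^ 4) / 2"
      by (simp add: power2_eq_square power3_eq_cube power4_eq_xxxx field_simps)
    then show ?thesis using y by simp
  qed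
  also have "\<dots> \<le> (1 - y + y\<^sup>2) * exp y"
  proof (rule mult_left_mono)
    show "1 + y + y\<^sup>2 / 2 \<le> exp y" by (rule exp_lower_Taylor_quadratic[OF y])
    have "0 \<le> (1 - y / 2)\<^sup>2 + 3 / 4 * y\<^sup>2" by simp
    then show "0 \<le> 1 - y + y\<^sup>2" by (simp add: power2_eq_square algebra_simps)
  qed
  finally have "exp x * 1 \<le> exp x * ((1 - y + y\<^sup>2) * exp y)"
    by (intro mult_left_mono) auto
  also have "\<dots> = 1 + x + x\<^sup>2"
    by (simp add: y_def exp_minus field_simps)
  finally show ?thesis by simp
qed

context increment_bounds
begin

lemma measurable_clipped [measurable (raw)]:
  assumes "sets \<Gamma> = sets borel" "K \<le> N"
  shows "(\<lambda>x. H K (\<lambda>n. clip L n (x n))) \<in> borel_measurable (PiM {- int N..int N} (\<lambda>_. \<Gamma>))"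
proof (rule measurable_comp)
  fix n assume "\<bar>n\<bar> \<le> int K"
  then have "n \<in> {- int N..int N}" using assms by auto
  then have "(\<lambda>x. x n) \<in> measurable (PiM {- int N..int N} (\<lambda>_. \<Gamma>)) \<Gamma>"
    by (rule measurable_component_singleton)
  then have "(\<lambda>x. x n) \<in> measurable (PiM {- int N..int N} (\<lambda>_. \<Gamma>)) borel"
    using measurable_cong_sets[OF refl assms(1)] by blast
  then show "(\<lambda>x. clip L n (x n)) \<in> borel_measurable (PiM {- int N..int N} (\<lambda>_. \<Gamma>))"
    by (rule measurable_compose) simp
qed

text \<open>The exponent paid for one new pair of modes: \<theta> times the bound on the mean, plus
  the square of \<theta> times the pointwise bound, as in an Azuma-Hoeffding argument.\<close>

definition increment_cost :: "real \<Rightarrow> real \<Rightarrow> nat \<Rightarrow> real" where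
  "increment_cost \<theta> L n = \<theta> * (C * L ^ 6 * real n powr (- 13 / 8)) + (\<theta> * (C * L ^ 6 * real n powr (- 5 / 8)))\<^sup>2"

text \<open>Since \<theta> times the increment has absolute value at most 1, the exponential may be
  replaced by 1 + x + x^2. Only the mean of the linear part survives integration, and 1 + t \<le>
  exp t puts the result back into the exponent.\<close>

lemma exp_moment_step:
  assumes L: "1 \<le> L" and N: "1 \<le> N" and c: "\<And>n. cmod (c n) \<le> radius L n"
    and \<eta>: "prob_space \<eta>" "sets \<eta> = sets borel" "AE z in \<eta>. cmod z \<le> radius L (int N)" "(\<integral>z. z \<partial>\<eta>) = 0"
    and \<theta>: "0 \<le> \<theta>" "\<theta> * (C * L ^ 6 * real N powr (- 5 / 8)) \<le> 1"
  shows "(\<integral>\<^sup>+y. \<integral>\<^sup>+z. ennreal (exp (\<theta> * (H N (c(int N := y, - int N := z)) - H (N - 1) c))) \<partial>\<eta> \<partial>\<eta>)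
    \<le> ennreal (exp (increment_cost \<theta> L N))"
proof -
  interpret prob_space \<eta> by fact
  interpret P: pair_sigma_finite \<eta> \<eta> ..
  note \<eta>(2)[measurable_cong]
  define D where "D y z = H N (c(int N := y, - int N := z)) - H (N - 1) c" for y z
  define b where "b = C * L ^ 6 * real N powr (- 5 / 8)"
  define d where "d = C * L ^ 6 * real N powr (- 13 / 8)"
  have b: "0 \<le> b" using C_nonneg L by (simp add: b_def)
  have [measurable]: "(\<lambda>(y, z). D y z) \<in> borel_measurable (\<eta> \<Otimes>\<^sub>M \<eta>)"
  proof -
    have "(\<lambda>p. H N (c(int N := fst p, - int N := snd p))) \<in> borel_measurable (\<eta> \<Otimes>\<^sub>M \<eta>)"
      by (rule measurable_comp) (auto simp: fun_upd_def)
    then show ?thesis unfolding D_def by (simp add: case_prod_beta)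
  qed
  have [measurable]: "D y \<in> borel_measurable \<eta>" if "y \<in> space \<eta>" for y
    using that by measurable
  have sp: "space \<eta> = UNIV" using \<eta>(2) sets_eq_imp_space_eq by fastforce
  have Db: "\<bar>D y z\<bar> \<le> b" if "cmod y \<le> radius L (int N)" "cmod z \<le> radius L (int N)" for y z
  proof -
    let ?c = "c(int N := y, - int N := z)"
    have "\<bar>H N ?c - H (N - 1) ?c\<bar> \<le> b"
      unfolding b_def using that c by (intro increment_le L N) auto
    moreover have "H (N - 1) ?c = H (N - 1) c"
      using N by (intro cong) auto
    ultimately show ?thesis by (simp add: D_def)
  qed
  have th: "\<theta> * b \<le> 1" using \<theta> by (simp add: b_def)
  \<comment> \<open>The second claim is what allows passing from the nonnegative to the Bochner
    integral: \<open>ennreal\<close> would cut negative values off at 0.\<close>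
  have ebound: "exp (\<theta> * D y z) \<le> 1 + \<theta> * D y z + (\<theta> * b)\<^sup>2" "0 \<le> 1 + \<theta> * D y z"
    if "cmod y \<le> radius L (int N)" "cmod z \<le> radius L (int N)" for y z
  proof -
    have "\<bar>\<theta> * D y z\<bar> \<le> \<theta> * b"
      using Db[OF that] \<theta> by (simp add: abs_mult mult_left_mono)
    then show "exp (\<theta> * D y z) \<le> 1 + \<theta> * D y z + (\<theta> * b)\<^sup>2" "0 \<le> 1 + \<theta> * D y z"
      using exp_le_quadratic[of "\<theta> * D y z"] th abs_le_square_iff[of "\<theta> * D y z" "\<theta> * b"]
      by linarith+
  qed
  have intD: "integrable \<eta> (D y)" if "cmod y \<le> radius L (int N)" for y
    using \<eta>(3) Db that sp by (intro integrable_const_bound[of _ b]) auto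
  have inner: "(\<integral>\<^sup>+z. ennreal (exp (\<theta> * D y z)) \<partial>\<eta>) \<le> ennreal (1 + \<theta> * (\<integral>z. D y z \<partial>\<eta>) + (\<theta> * b)\<^sup>2)"
    if y: "cmod y \<le> radius L (int N)" for y
  proof -
    have "(\<integral>\<^sup>+z. ennreal (exp (\<theta> * D y z)) \<partial>\<eta>) \<le> (\<integral>\<^sup>+z. ennreal (1 + \<theta> * D y z + (\<theta> * b)\<^sup>2) \<partial>\<eta>)"
      using \<eta>(3) by (intro nn_integral_mono_AE) (auto simp: ebound y intro!: ennreal_leI)
    also have "\<dots> = ennreal (\<integral>z. 1 + \<theta> * D y z + (\<theta> * b)\<^sup>2 \<partial>\<eta>)"
    proof (rule nn_integral_eq_integral)
      show "AE z in \<eta>. 0 \<le> 1 + \<theta> * D y z + (\<theta> * b)\<^sup>2"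
        using \<eta>(3) by eventually_elim (auto intro!: add_nonneg_nonneg[OF ebound(2)] y)
    qed (use intD[OF y] in auto)
    also have "(\<integral>z. 1 + \<theta> * D y z + (\<theta> * b)\<^sup>2 \<partial>\<eta>) = 1 + \<theta> * (\<integral>z. D y z \<partial>\<eta>) + (\<theta> * b)\<^sup>2"
      using intD[OF y] by (simp add: prob_space)
    finally show ?thesis .
  qed
  have Eb: "\<bar>\<integral>z. D y z \<partial>\<eta>\<bar> \<le> b" if y: "cmod y \<le> radius L (int N)" for y
  proof -
    have "\<bar>\<integral>z. D y z \<partial>\<eta>\<bar> \<le> (\<integral>z. \<bar>D y z\<bar> \<partial>\<eta>)" by (rule integral_abs_bound)
    also have "\<dots> \<le> (\<integral>z. b \<partial>\<eta>)"
      using \<eta>(3) intD[OF y] Db[OF y] by (intro integral_mono_AE) auto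
    finally show ?thesis by (simp add: prob_space)
  qed
  have intE: "integrable \<eta> (\<lambda>y. \<integral>z. D y z \<partial>\<eta>)"
    using \<eta>(3) Eb by (intro integrable_const_bound[of _ b]) auto
  have "(\<integral>\<^sup>+y. \<integral>\<^sup>+z. ennreal (exp (\<theta> * D y z)) \<partial>\<eta> \<partial>\<eta>)
      \<le> (\<integral>\<^sup>+y. ennreal (1 + \<theta> * (\<integral>z. D y z \<partial>\<eta>) + (\<theta> * b)\<^sup>2) \<partial>\<eta>)"
    using \<eta>(3) by (intro nn_integral_mono_AE) (auto simp: inner)
  also have "\<dots> = ennreal (\<integral>y. 1 + \<theta> * (\<integral>z. D y z \<partial>\<eta>) + (\<theta> * b)\<^sup>2 \<partial>\<eta>)"
  proof (rule nn_integral_eq_integral)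
    show "AE y in \<eta>. 0 \<le> 1 + \<theta> * (\<integral>z. D y z \<partial>\<eta>) + (\<theta> * b)\<^sup>2"
      using \<eta>(3)
    proof eventually_elim
      case (elim y)
      have "\<bar>\<theta> * (\<integral>z. D y z \<partial>\<eta>)\<bar> \<le> \<theta> * b"
        using Eb[OF elim] \<theta> by (simp add: abs_mult mult_left_mono)
      then have "0 \<le> 1 + \<theta> * (\<integral>z. D y z \<partial>\<eta>)" using th by linarith
      then show ?case by (metis add_nonneg_nonneg zero_le_power2)
    qed
  qed (use intE in auto)
  also have "(\<integral>y. 1 + \<theta> * (\<integral>z. D y z \<partial>\<eta>) + (\<theta> * b)\<^sup>2 \<partial>\<eta>)
      = 1 + \<theta> * (\<integral>y. (\<integral>z. D y z \<partial>\<eta>) \<partial>\<eta>) + (\<theta> * b)\<^sup>2"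
    using intE by (simp add: prob_space)
  also have "\<dots> \<le> 1 + (\<theta> * d + (\<theta> * b)\<^sup>2)"
    using mean_increment_le[OF L N c \<eta>] \<theta>(1) unfolding D_def[symmetric] d_def[symmetric]
    by (simp add: mult_left_mono)
  also have "\<dots> \<le> exp (\<theta> * d + (\<theta> * b)\<^sup>2)" by (rule exp_ge_add_one_self)
  finally show ?thesis unfolding D_def b_def d_def increment_cost_def by (simp add: ennreal_leI)
qed

text \<open>Integrating the two newest coordinates first, with the older ones frozen, plays the role
  of conditional expectation, and the factors of \<open>exp_moment_step\<close> accumulate in the
  exponent. Symmetry of \<Gamma> makes the clipped law centred: its mean equals its own
  negative.\<close>

lemma exp_moment_clipped:
  assumes L: "1 \<le> L" and M: "1 \<le> M" "M \<le> N"
    and \<Gamma>: "prob_space \<Gamma>" "sets \<Gamma> = sets borel" "distr \<Gamma> borel uminus = \<Gamma>"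
    and \<theta>: "0 \<le> \<theta>" "\<theta> * (C * L ^ 6 * real M powr (- 5 / 8)) \<le> 1"
  shows "(\<integral>\<^sup>+x. ennreal (exp (\<theta> * (H N (\<lambda>n. clip L n (x n)) - H M (\<lambda>n. clip L n (x n)))))
            \<partial>PiM {- int N..int N} (\<lambda>_. \<Gamma>))
    \<le> ennreal (exp (\<Sum>n\<in>{M<..N}. increment_cost \<theta> L n))"
  using M(2)
proof (induction rule: dec_induct)
  case base
  interpret prob_space "PiM {- int M..int M} (\<lambda>_. \<Gamma>)"
    by (intro prob_space_PiM \<Gamma>)
  show ?case by (simp add: emeasure_space_1)
next
  case (step N)
  note \<Gamma>(2)[measurable_cong]
  interpret \<Gamma>: prob_space \<Gamma> by fact
  interpret P: product_sigma_finite "\<lambda>_::int. \<Gamma>" ..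
  let ?J = "{- int N..int N}" and ?n = "int (Suc N)"
  let ?k = "\<lambda>x n. clip L n (x n)"
  have J: "{- int (Suc N)..int (Suc N)} = insert (- ?n) (insert ?n ?J)" by auto
  define \<Phi> where "\<Phi> x = ennreal (exp (\<theta> * (H (Suc N) (?k x) - H M (?k x))))" for x
  have \<Phi>_meas [measurable]: "\<Phi> \<in> borel_measurable (PiM (insert (- ?n) (insert ?n ?J)) (\<lambda>_. \<Gamma>))"
  proof -
    have [measurable]: "(\<lambda>x. H K (?k x)) \<in> borel_measurable (PiM {- int (Suc N)..int (Suc N)} (\<lambda>_. \<Gamma>))"
      if "K \<le> Suc N" for K
      using \<Gamma>(2) that by (rule measurable_clipped)
    have "M \<le> Suc N" using step by simp
    then show ?thesis unfolding \<Phi>_def J[symmetric] by measurable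
  qed
  define \<eta> where "\<eta> = distr \<Gamma> borel (clip L ?n)"
  have \<eta>: "prob_space \<eta>" "sets \<eta> = sets borel" "AE z in \<eta>. cmod z \<le> radius L (int (Suc N))" "(\<integral>z. z \<partial>\<eta>) = 0"
  proof -
    show "prob_space \<eta>" unfolding \<eta>_def by (intro \<Gamma>.prob_space_distr) simp
    show "sets \<eta> = sets borel" by (simp add: \<eta>_def)
    show "AE z in \<eta>. cmod z \<le> radius L (int (Suc N))"
      unfolding \<eta>_def using L by (subst AE_distr_iff) (auto intro!: cmod_clip_le AE_I2)
    have "(\<integral>z. clip L ?n z \<partial>\<Gamma>) = (\<integral>z. clip L ?n z \<partial>(distr \<Gamma> borel uminus))"
      by (simp add: \<Gamma>(3))
    also have "\<dots> = - (\<integral>z. clip L ?n z \<partial>\<Gamma>)"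
      by (subst integral_distr) (auto simp: clip_uminus)
    finally have "(\<integral>z. clip L ?n z \<partial>\<Gamma>) = 0" by simp
    then show "(\<integral>z. z \<partial>\<eta>) = 0"
      by (simp add: \<eta>_def integral_distr)
  qed
  have th: "\<theta> * (C * L ^ 6 * real (Suc N) powr (- 5 / 8)) \<le> 1"
  proof -
    have "real (Suc N) powr (- 5 / 8) \<le> real M powr (- 5 / 8)"
      using step M by (intro powr_mono2') auto
    then have "\<theta> * (C * L ^ 6 * real (Suc N) powr (- 5 / 8)) \<le> \<theta> * (C * L ^ 6 * real M powr (- 5 / 8))"
      using \<theta> C_nonneg L by (intro mult_left_mono) auto
    then show ?thesis using \<theta> by simp
  qed
  have inner: "(\<integral>\<^sup>+y. \<integral>\<^sup>+z. \<Phi> (x(?n := y, - ?n := z)) \<partial>\<Gamma> \<partial>\<Gamma>)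
      \<le> ennreal (exp (\<theta> * (H N (?k x) - H M (?k x)))) * ennreal (exp (increment_cost \<theta> L (Suc N)))" for x
  proof -
    define c where "c = ?k x"
    have c: "cmod (c n) \<le> radius L n" for n using L by (simp add: c_def cmod_clip_le)
    have k: "?k (x(?n := y, - ?n := z)) = c(?n := clip L ?n y, - ?n := clip L ?n z)" for y z
      using clip_uminus_index[of L ?n] by (auto simp: c_def fun_eq_iff)
    have HM: "H M (c(?n := y, - ?n := z)) = H M c" for y z
      using step by (intro cong) auto
    have \<Phi>: "\<Phi> (x(?n := y, - ?n := z)) = ennreal (exp (\<theta> * (H N c - H M c))) *
       ennreal (exp (\<theta> * (H (Suc N) (c(?n := clip L ?n y, - ?n := clip L ?n z)) - H N c)))" for y z
      unfolding \<Phi>_def k HM by (simp add: ennreal_mult[symmetric] exp_add[symmetric] algebra_simps)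
    define F where "F y z = ennreal (exp (\<theta> * (H (Suc N) (c(?n := y, - ?n := z)) - H N c)))" for y z
    have "(\<lambda>p. H (Suc N) (c(?n := fst p, - ?n := snd p))) \<in> borel_measurable (borel \<Otimes>\<^sub>M borel)"
      by (rule measurable_comp) (auto simp: fun_upd_def)
    then have [measurable]: "(\<lambda>(y, z). F y z) \<in> borel_measurable (borel \<Otimes>\<^sub>M borel)"
      unfolding F_def by (simp add: case_prod_beta)
    have [measurable]: "(\<lambda>y. \<integral>\<^sup>+z. F y z \<partial>\<eta>) \<in> borel_measurable borel"
      by (rule sigma_finite_measure.borel_measurable_nn_integral)
         (use \<eta> in \<open>auto simp: prob_space_imp_sigma_finite measurable_cong_sets[OF sets_pair_measure_cong[OF refl \<eta>(2)] refl]\<close>)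
    have "(\<integral>\<^sup>+y. \<integral>\<^sup>+z. \<Phi> (x(?n := y, - ?n := z)) \<partial>\<Gamma> \<partial>\<Gamma>)
       = (\<integral>\<^sup>+y. \<integral>\<^sup>+z. ennreal (exp (\<theta> * (H N c - H M c))) * F (clip L ?n y) (clip L ?n z) \<partial>\<Gamma> \<partial>\<Gamma>)"
      by (simp only: \<Phi> F_def)
    also have "\<dots> = (\<integral>\<^sup>+y. ennreal (exp (\<theta> * (H N c - H M c))) * (\<integral>\<^sup>+z. F (clip L ?n y) z \<partial>\<eta>) \<partial>\<Gamma>)"
      unfolding \<eta>_def by (intro nn_integral_cong, subst nn_integral_distr) (auto intro!: nn_integral_cmult)
    also have "\<dots> = ennreal (exp (\<theta> * (H N c - H M c))) * (\<integral>\<^sup>+y. (\<integral>\<^sup>+z. F (clip L ?n y) z \<partial>\<eta>) \<partial>\<Gamma>)"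
      by (rule nn_integral_cmult) simp
    finally have eq: "(\<integral>\<^sup>+y. \<integral>\<^sup>+z. \<Phi> (x(?n := y, - ?n := z)) \<partial>\<Gamma> \<partial>\<Gamma>)
       = ennreal (exp (\<theta> * (H N c - H M c))) * (\<integral>\<^sup>+y. (\<integral>\<^sup>+z. F (clip L ?n y) z \<partial>\<eta>) \<partial>\<Gamma>)" .
    have "(\<integral>\<^sup>+y. (\<integral>\<^sup>+z. F (clip L ?n y) z \<partial>\<eta>) \<partial>\<Gamma>) = (\<integral>\<^sup>+y. (\<integral>\<^sup>+z. F y z \<partial>\<eta>) \<partial>\<eta>)"
      by (subst (2) \<eta>_def, subst nn_integral_distr) auto
    also have "\<dots> \<le> ennreal (exp (increment_cost \<theta> L (Suc N)))"
      unfolding F_def using exp_moment_step[OF L _ c \<eta> \<theta>(1) th] by simp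
    finally show ?thesis unfolding eq unfolding c_def by (rule mult_left_mono) simp
  qed
  have "(\<integral>\<^sup>+x. \<Phi> x \<partial>PiM (insert (- ?n) (insert ?n ?J)) (\<lambda>_. \<Gamma>))
      = (\<integral>\<^sup>+x. \<integral>\<^sup>+z. \<Phi> (x(- ?n := z)) \<partial>\<Gamma> \<partial>PiM (insert ?n ?J) (\<lambda>_. \<Gamma>))"
    by (rule P.product_nn_integral_insert[OF _ _ \<Phi>_meas]) auto
  also have "\<dots> = (\<integral>\<^sup>+x. \<integral>\<^sup>+y. \<integral>\<^sup>+z. \<Phi> (x(?n := y, - ?n := z)) \<partial>\<Gamma> \<partial>\<Gamma> \<partial>PiM ?J (\<lambda>_. \<Gamma>))"
  proof (rule P.product_nn_integral_insert)
    have [measurable]: "(\<lambda>p. (fst p)(- ?n := snd p)) \<in> measurable (PiM (insert ?n ?J) (\<lambda>_. \<Gamma>) \<Otimes>\<^sub>M \<Gamma>) (PiM (insert (- ?n) (insert ?n ?J)) (\<lambda>_. \<Gamma>))"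
      using measurable_add_dim[of "- ?n" "insert ?n ?J" "\<lambda>_. \<Gamma>"] by (simp only: split_beta')
    have "(\<lambda>p. \<Phi> ((fst p)(- ?n := snd p))) \<in> borel_measurable (PiM (insert ?n ?J) (\<lambda>_. \<Gamma>) \<Otimes>\<^sub>M \<Gamma>)"
      by measurable
    then show "(\<lambda>x. \<integral>\<^sup>+z. \<Phi> (x(- ?n := z)) \<partial>\<Gamma>) \<in> borel_measurable (PiM (insert ?n ?J) (\<lambda>_. \<Gamma>))"
      by (intro \<Gamma>.borel_measurable_nn_integral) (simp only: split_beta')
  qed auto
  also have "\<dots> \<le> (\<integral>\<^sup>+x. ennreal (exp (\<theta> * (H N (?k x) - H M (?k x)))) * ennreal (exp (increment_cost \<theta> L (Suc N))) \<partial>PiM ?J (\<lambda>_. \<Gamma>))"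
    by (intro nn_integral_mono inner)
  also have "\<dots> = (\<integral>\<^sup>+x. ennreal (exp (\<theta> * (H N (?k x) - H M (?k x)))) \<partial>PiM ?J (\<lambda>_. \<Gamma>)) * ennreal (exp (increment_cost \<theta> L (Suc N)))"
    by (intro nn_integral_multc measurable_compose[OF _ measurable_ennreal] borel_measurable_exp borel_measurable_times
        borel_measurable_diff borel_measurable_const measurable_clipped) (use step \<Gamma>(2) in auto)
  also have "\<dots> \<le> ennreal (exp (\<Sum>n\<in>{M<..N}. increment_cost \<theta> L n)) * ennreal (exp (increment_cost \<theta> L (Suc N)))"
    using step.IH by (intro mult_right_mono) auto
  also have "\<dots> = ennreal (exp (\<Sum>n\<in>{M<..Suc N}. increment_cost \<theta> L n))"
  proof -
    have "{M<..Suc N} = insert (Suc N) {M<..N}" using step by auto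
    then show ?thesis by (simp add: ennreal_mult[symmetric] exp_add[symmetric] add.commute)
  qed
  finally show ?case unfolding J \<Phi>_def .
qed

end

section \<open>Fourier expansion of the functionals\<close>

lemma set_integrable_torus:
  fixes f :: "real \<Rightarrow> 'b::{banach, second_countable_topology}"
  assumes "continuous_on UNIV f"
  shows "set_integrable lborel {0..2 * pi} f"
  using assms by (intro borel_integrable_atLeastAtMost') (auto intro: continuous_on_subset)

lemma torus_integral_sum:
  fixes f :: "'i \<Rightarrow> real \<Rightarrow> 'b::{banach, second_countable_topology}"
  assumes "\<And>i. i \<in> I \<Longrightarrow> continuous_on UNIV (f i)"
  shows "torus_integral (\<lambda>x. \<Sum>i\<in>I. f i x) = (\<Sum>i\<in>I. torus_integral (f i))"
proof -
  have "(LINT x:{0..2 * pi}|lborel. (\<Sum>i\<in>I. f i x)) = (\<Sum>i\<in>I. LINT x:{0..2 * pi}|lborel. f i x)"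
    unfolding set_lebesgue_integral_def scaleR_sum_right
    using set_integrable_torus[OF assms] unfolding set_integrable_def
    by (intro Bochner_Integration.integral_sum) auto
  then show ?thesis by (simp add: torus_integral_def scaleR_sum_right)
qed

lemma torus_integral_add:
  fixes f g :: "real \<Rightarrow> 'b::{banach, second_countable_topology}"
  assumes "continuous_on UNIV f" "continuous_on UNIV g"
  shows "torus_integral (\<lambda>x. f x + g x) = torus_integral f + torus_integral g"
  using set_integrable_torus[OF assms(1)] set_integrable_torus[OF assms(2)]
  by (simp add: torus_integral_def scaleR_add_right)

lemma torus_integral_diff:
  fixes f g :: "real \<Rightarrow> 'b::{banach, second_countable_topology}"
  assumes "continuous_on UNIV f" "continuous_on UNIV g"
  shows "torus_integral (\<lambda>x. f x - g x) = torus_integral f - torus_integral g"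
  using set_integrable_torus[OF assms(1)] set_integrable_torus[OF assms(2)]
  by (simp add: torus_integral_def scaleR_diff_right)

lemma torus_integral_Re:
  assumes "continuous_on UNIV f"
  shows "torus_integral (\<lambda>x. Re (f x)) = Re (torus_integral f)"
proof -
  have "Re (LINT x:{0..2 * pi}|lborel. f x) = (\<integral>x. Re (indicator {0..2 * pi} x *\<^sub>R f x) \<partial>lborel)"
    unfolding set_lebesgue_integral_def
    using set_integrable_torus[OF assms] by (intro integral_Re[symmetric]) (simp add: set_integrable_def)
  then show ?thesis by (simp add: torus_integral_def set_lebesgue_integral_def)
qed

lemma torus_integral_mult_left:
  fixes a :: complex
  shows "torus_integral (\<lambda>x. a * f x) = a * torus_integral f"
  by (simp add: torus_integral_def)

lemma norm_torus_integral_le: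
  fixes f :: "real \<Rightarrow> 'b::{banach, second_countable_topology}"
  assumes "continuous_on UNIV f" "\<And>x. norm (f x) \<le> B"
  shows "norm (torus_integral f) \<le> B"
proof -
  have "norm (LINT x:{0..2 * pi}|lborel. f x) \<le> (LINT x:{0..2 * pi}|lborel. norm (f x))"
    unfolding set_lebesgue_integral_def
    by (rule order.trans[OF integral_norm_bound]) (simp add: abs_mult)
  also have "\<dots> \<le> (LINT x:{0..2 * pi}|lborel. B)"
    by (rule set_integral_mono) (auto intro!: set_integrable_torus continuous_intros assms)
  also have "\<dots> = 2 * pi * B" by (simp add: set_lebesgue_integral_def)
  finally show ?thesis by (simp add: torus_integral_def field_simps)
qed

lemma has_vector_derivative_exp_int:
  "((\<lambda>y. a * exp (\<i> * of_int k * complex_of_real y)) has_vector_derivative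
     (\<i> * of_int k * a) * exp (\<i> * of_int k * complex_of_real x)) (at x within S)"
proof (rule has_vector_derivative_real_field)
  show "((\<lambda>z. a * exp (\<i> * of_int k * z)) has_field_derivative
     (\<i> * of_int k * a) * exp (\<i> * of_int k * complex_of_real x)) (at (complex_of_real x))"
    by (rule derivative_eq_intros refl | simp)+
qed

lemma torus_integral_exp:
  "torus_integral (\<lambda>x. exp (\<i> * of_int k * complex_of_real x)) = (if k = 0 then 1 else 0)"
proof (cases "k = 0")
  case True
  then show ?thesis by (simp add: torus_integral_def set_lebesgue_integral_def)
next
  case False
  define F where "F x = exp (\<i> * of_int k * complex_of_real x) / (\<i> * of_int k)" for x
  have "(\<integral>x. indicator {0..2 * pi} x *\<^sub>R exp (\<i> * of_int k * complex_of_real x) \<partial>lborel) = F (2 * pi) - F 0"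
  proof (rule integral_FTC_Icc)
    fix x :: real
    show "(F has_vector_derivative exp (\<i> * of_int k * complex_of_real x)) (at x within {0..2 * pi})"
      using has_vector_derivative_exp_int[of "1 / (\<i> * of_int k)" k x] False
      by (simp add: F_def[abs_def])
  qed (auto intro!: continuous_intros)
  also have "\<dots> = 0"
  proof -
    have "exp (\<i> * of_int k * complex_of_real (2 * pi)) = exp (2 * of_int k * pi * \<i>)"
      by (simp add: algebra_simps)
    also have "\<dots> = 1" by (rule exp_integer_2pi) simp
    finally show ?thesis by (simp add: F_def)
  qed
  finally show ?thesis using False by (simp add: torus_integral_def set_lebesgue_integral_def)
qed

lemma torus_integral_mult_exp:
  "torus_integral (\<lambda>x. a * exp (\<i> * of_int k * complex_of_real x)) = (if k = 0 then a else 0)"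
  using torus_integral_exp[of k]
  by (auto simp: torus_integral_def set_lebesgue_integral_def scaleR_conv_of_real mult.left_commute[of _ a]
        split: if_splits)

lemma parseval:
  assumes "finite K"
  shows "torus_integral (\<lambda>x. cnj (\<Sum>k\<in>K. a k * exp (\<i> * of_int k * complex_of_real x)) *
           (\<Sum>k\<in>K. b k * exp (\<i> * of_int k * complex_of_real x))) = (\<Sum>k\<in>K. cnj (a k) * b k)"
proof -
  have "cnj (\<Sum>k\<in>K. a k * exp (\<i> * of_int k * complex_of_real x)) *
           (\<Sum>k\<in>K. b k * exp (\<i> * of_int k * complex_of_real x))
      = (\<Sum>(k, l)\<in>K \<times> K. (cnj (a k) * b l) * exp (\<i> * of_int (l - k) * complex_of_real x))" for x
  proof -
    have "exp (\<i> * of_int (l - k) * complex_of_real x)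
       = cnj (exp (\<i> * of_int k * complex_of_real x)) * exp (\<i> * of_int l * complex_of_real x)" for k l
      by (simp add: exp_cnj exp_add[symmetric] algebra_simps)
    then show ?thesis
      unfolding cnj_sum sum_product sum.cartesian_product[symmetric]
      by (intro sum.cong refl) (simp only: complex_cnj_mult mult_ac)
  qed
  then have "torus_integral (\<lambda>x. cnj (\<Sum>k\<in>K. a k * exp (\<i> * of_int k * complex_of_real x)) *
           (\<Sum>k\<in>K. b k * exp (\<i> * of_int k * complex_of_real x)))
     = torus_integral (\<lambda>x. \<Sum>(k, l)\<in>K \<times> K. (cnj (a k) * b l) * exp (\<i> * of_int (l - k) * complex_of_real x))"
    by simp
  also have "\<dots> = (\<Sum>(k, l)\<in>K \<times> K. torus_integral (\<lambda>x. (cnj (a k) * b l) * exp (\<i> * of_int (l - k) * complex_of_real x)))"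
    unfolding split_beta' by (rule torus_integral_sum) (auto intro!: continuous_intros)
  also have "\<dots> = (\<Sum>k\<in>K. \<Sum>l\<in>K. if l = k then cnj (a k) * b l else 0)"
    by (simp only: torus_integral_mult_exp sum.cartesian_product right_minus_eq)
  also have "\<dots> = (\<Sum>k\<in>K. cnj (a k) * b k)"
    using assms by (simp add: sum.delta)
  finally show ?thesis .
qed

section \<open>The three functionals in Fourier variables\<close>

definition mass :: "nat \<Rightarrow> (int \<Rightarrow> complex) \<Rightarrow> real" where
  "mass N c = (\<Sum>n\<in>{- int N..int N}. (cmod (c n))\<^sup>2)"

text \<open>The k-th Fourier coefficient of the square of the truncated function: the range of
  summation cuts off the first factor, \<open>trunc\<close> the second.\<close>

definition conv2 :: "nat \<Rightarrow> (int \<Rightarrow> complex) \<Rightarrow> int \<Rightarrow> complex" where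
  "conv2 N c k = (\<Sum>n\<in>{- int N..int N}. c n * trunc N c (k - n))"

definition f_coeff :: "nat \<Rightarrow> (int \<Rightarrow> complex) \<Rightarrow> real" where
  "f_coeff N c = (\<Sum>k\<in>{- 2 * int N..2 * int N}. of_int k * (cmod (conv2 N c k))\<^sup>2)"

definition sextic :: "nat \<Rightarrow> (int \<Rightarrow> complex) \<Rightarrow> real" where
  "sextic N c = torus_integral (\<lambda>x. (cmod (proj N c x)) ^ 6)"

lemma sum_shift:
  fixes f :: "int \<Rightarrow> 'a::comm_monoid_add"
  assumes "finite K" "finite J" "\<And>m. m \<notin> J \<Longrightarrow> f m = 0" "\<And>m. m \<in> J \<Longrightarrow> m + n \<in> K"
  shows "(\<Sum>k\<in>K. f (k - n)) = (\<Sum>m\<in>J. f m)"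
proof -
  have "(\<Sum>m\<in>J. f m) = (\<Sum>k\<in>(\<lambda>m. m + n) ` J. f (k - n))"
    by (subst sum.reindex) (auto simp: inj_on_def)
  also have "\<dots> = (\<Sum>k\<in>K. f (k - n))"
  proof (rule sum.mono_neutral_left)
    show "\<forall>i\<in>K - (\<lambda>m. m + n) ` J. f (i - n) = 0"
    proof
      fix i assume i: "i \<in> K - (\<lambda>m. m + n) ` J"
      then have "i - n \<notin> J" by (metis Diff_iff diff_add_cancel imageI)
      then show "f (i - n) = 0" by (rule assms(3))
    qed
  qed (use assms in auto)
  finally show ?thesis ..
qed

lemma L2_norm_torus_proj: "L2_norm_torus (proj N c) = sqrt (mass N c)"
proof -
  have sq: "complex_of_real ((cmod z)\<^sup>2) = cnj z * z" for z
    by (metis complex_norm_square mult.commute)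
  have "complex_of_real (torus_integral (\<lambda>x. (cmod (proj N c x))\<^sup>2))
      = torus_integral (\<lambda>x. complex_of_real ((cmod (proj N c x))\<^sup>2))"
    by (simp only: torus_integral_def set_integral_complex_of_real) (simp add: scaleR_conv_of_real)
  also have "\<dots> = torus_integral (\<lambda>x. cnj (proj N c x) * proj N c x)"
    by (simp only: sq)
  also have "\<dots> = (\<Sum>n\<in>{- int N..int N}. cnj (c n) * c n)"
    unfolding proj_def by (rule parseval) simp
  also have "\<dots> = complex_of_real (mass N c)"
    by (simp only: mass_def of_real_sum sq)
  finally show ?thesis by (simp add: L2_norm_torus_def)
qed

lemma proj_square:
  "(proj N c x)\<^sup>2 = (\<Sum>k\<in>{- 2 * int N..2 * int N}. conv2 N c k * exp (\<i> * of_int k * complex_of_real x))"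
proof -
  let ?J = "{- int N..int N}" and ?K = "{- 2 * int N..2 * int N}"
  let ?e = "\<lambda>k. exp (\<i> * of_int k * complex_of_real x)"
  have e: "?e (n + m) = ?e n * ?e m" for n m
    by (simp add: exp_add[symmetric] algebra_simps)
  have "(\<Sum>k\<in>?K. conv2 N c k * ?e k) = (\<Sum>k\<in>?K. \<Sum>n\<in>?J. c n * trunc N c (k - n) * ?e k)"
    by (simp add: conv2_def sum_distrib_right)
  also have "\<dots> = (\<Sum>n\<in>?J. \<Sum>k\<in>?K. c n * trunc N c (k - n) * ?e k)" by (rule sum.swap)
  also have "\<dots> = (\<Sum>n\<in>?J. \<Sum>k\<in>?K. (\<lambda>m. c n * trunc N c m * ?e (m + n)) (k - n))" by simp
  also have "\<dots> = (\<Sum>n\<in>?J. \<Sum>m\<in>?J. c n * trunc N c m * ?e (m + n))"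
    by (intro sum.cong refl sum_shift) (auto simp: trunc_def)
  also have "\<dots> = (\<Sum>n\<in>?J. \<Sum>m\<in>?J. (c n * ?e n) * (c m * ?e m))"
    unfolding e by (intro sum.cong refl) (auto simp: trunc_def)
  also have "\<dots> = (proj N c x)\<^sup>2"
    by (simp add: proj_def power2_eq_square sum_product)
  finally show ?thesis ..
qed

text \<open>Differentiation multiplies the k-th coefficient q of the square by \<i> k, so after
  Parseval each term cnj q (\<i> k q) is purely imaginary, with imaginary part k |q|^2.\<close>

lemma f_trunc_eq: "f_trunc N c = f_coeff N c"
proof -
  let ?K = "{- 2 * int N..2 * int N}"
  have "((\<lambda>y. \<Sum>k\<in>?K. conv2 N c k * exp (\<i> * of_int k * complex_of_real y)) has_vector_derivative
      (\<Sum>k\<in>?K. (\<i> * of_int k * conv2 N c k) * exp (\<i> * of_int k * complex_of_real x))) (at x)" for x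
    by (intro has_vector_derivative_sum has_vector_derivative_exp_int)
  then have d: "vector_derivative (\<lambda>y. (proj N c y)\<^sup>2) (at x)
     = (\<Sum>k\<in>?K. (\<i> * of_int k * conv2 N c k) * exp (\<i> * of_int k * complex_of_real x))" for x
    unfolding proj_square by (rule vector_derivative_at)
  have "f_trunc N c = Im (\<Sum>k\<in>?K. cnj (conv2 N c k) * (\<i> * of_int k * conv2 N c k))"
    unfolding f_trunc_def d unfolding proj_square by (subst parseval) auto
  also have "\<dots> = (\<Sum>k\<in>?K. Im (cnj (conv2 N c k) * (\<i> * of_int k * conv2 N c k)))"
    by (rule Im_sum)
  also have "\<dots> = f_coeff N c"
    unfolding f_coeff_def
    unfolding cmod_power2 by (intro sum.cong refl) (simp add: power2_eq_square algebra_simps)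
  finally show ?thesis .
qed

lemma G_trunc_eq:
  "G_trunc chi N c = chi (sqrt (mass N c)) * exp (3 / 4 * f_coeff N c - 1 / 2 * sextic N c)"
  by (simp add: G_trunc_def L2_norm_torus_proj f_trunc_eq sextic_def)

lemma sextic_nonneg: "0 \<le> sextic N c"
  by (simp add: sextic_def torus_integral_def set_lebesgue_integral_def)

lemma proj_trunc: "proj N (trunc N c) = proj N c"
  by (auto simp: proj_def trunc_def fun_eq_iff intro!: sum.cong)

lemma mass_trunc: "mass N (trunc N c) = mass N c"
  by (auto simp: mass_def trunc_def intro!: sum.cong)

lemma conv2_trunc: "conv2 N (trunc N c) = conv2 N c"
  by (auto simp: conv2_def trunc_trunc fun_eq_iff trunc_def intro!: sum.cong)

lemma f_coeff_trunc: "f_coeff N (trunc N c) = f_coeff N c"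
  by (simp add: f_coeff_def conv2_trunc)

lemma sextic_trunc: "sextic N (trunc N c) = sextic N c"
  by (simp add: sextic_def proj_trunc)

lemma measurable_mass: "mass N \<in> borel_measurable (PiM UNIV (\<lambda>_. borel))"
  unfolding mass_def by measurable

lemma measurable_f_coeff: "f_coeff N \<in> borel_measurable (PiM UNIV (\<lambda>_. borel))"
proof -
  have [measurable]: "(\<lambda>c. trunc N c n) \<in> borel_measurable (PiM UNIV (\<lambda>_. borel))" for n
    by (cases "\<bar>n\<bar> \<le> int N") (simp_all add: trunc_def)
  show ?thesis unfolding f_coeff_def conv2_def by measurable
qed

lemma measurable_sextic: "sextic N \<in> borel_measurable (PiM UNIV (\<lambda>_. borel))"
  unfolding sextic_def torus_integral_def set_lebesgue_integral_def proj_def by measurable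

section \<open>Increments of the mass, the quartic form and the sextic integral\<close>

lemma powr_mean_value:
  fixes a x :: real
  assumes "0 < x"
  obtains \<xi> where "x < \<xi>" "\<xi> < x + 1" "(x + 1) powr a - x powr a = a * \<xi> powr (a - 1)"
proof -
  have "\<exists>\<xi>. x < \<xi> \<and> \<xi> < x + 1 \<and> (x + 1) powr a - x powr a = (x + 1 - x) * (a * \<xi> powr (a - 1))"
    by (rule MVT2) (use assms in \<open>auto intro!: derivative_eq_intros simp: field_simps\<close>)
  then show ?thesis using that by auto
qed

text \<open>Comparison with the primitive 16 x^(1/16): by the mean value theorem each term is at
  most the increment of the primitive over the preceding unit interval.\<close>

lemma sum_powr_le:
  assumes "1 \<le> N"
  shows "(\<Sum>n\<in>{1..N}. real n powr (- 15 / 16)) \<le> 16 * real N powr (1 / 16)"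
  using assms
proof (induction N rule: dec_induct)
  case (step k)
  obtain \<xi> where \<xi>: "real k < \<xi>" "\<xi> < real k + 1"
    "(real k + 1) powr (1 / 16) - real k powr (1 / 16) = 1 / 16 * \<xi> powr (1 / 16 - 1)"
    using powr_mean_value[of "real k" "1 / 16"] step by auto
  have "real (Suc k) powr (- 15 / 16) \<le> \<xi> powr (- 15 / 16)"
    using \<xi> by (intro powr_mono2') auto
  then have "real (Suc k) powr (- 15 / 16) \<le> 16 * real (Suc k) powr (1 / 16) - 16 * real k powr (1 / 16)"
    using \<xi>(3) by (simp add: add.commute)
  then show ?case using step by simp
qed simp

lemma sum_powr_tail_le:
  assumes "1 \<le> M" "M \<le> N"
  shows "(\<Sum>n\<in>{M<..N}. real n powr (- 5 / 4)) \<le> 4 * real M powr (- 1 / 4)"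
proof -
  \<comment> \<open>The negative term makes the induction telescope and is dropped
    afterwards.\<close>
  have "(\<Sum>n\<in>{M<..N}. real n powr (- 5 / 4)) \<le> 4 * real M powr (- 1 / 4) - 4 * real N powr (- 1 / 4)"
    using assms(2)
  proof (induction N rule: dec_induct)
    case (step k)
    obtain \<xi> where \<xi>: "real k < \<xi>" "\<xi> < real k + 1"
      "(real k + 1) powr (- 1 / 4) - real k powr (- 1 / 4) = - 1 / 4 * \<xi> powr (- 1 / 4 - 1)"
      using powr_mean_value[of "real k" "- 1 / 4"] step assms by auto
    have "real (Suc k) powr (- 5 / 4) \<le> \<xi> powr (- 5 / 4)"
      using \<xi> by (intro powr_mono2') auto
    then have "real (Suc k) powr (- 5 / 4) \<le> 4 * real k powr (- 1 / 4) - 4 * real (Suc k) powr (- 1 / 4)"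
      using \<xi>(3) by (simp add: add.commute)
    moreover have "{M<..Suc k} = insert (Suc k) {M<..k}" using step by auto
    ultimately show ?case using step by simp
  qed simp
  then show ?thesis using powr_ge_zero[of "real N" "- 1 / 4"] by linarith
qed

lemma sum_int_interval:
  fixes g :: "int \<Rightarrow> 'a::comm_monoid_add"
  shows "(\<Sum>n\<in>{- int N..int N}. g n) = g 0 + (\<Sum>n\<in>{1..N}. g (int n) + g (- int n))"
proof (induction N)
  case (Suc N)
  have "{- int (Suc N)..int (Suc N)} = insert (int (Suc N)) (insert (- int (Suc N)) {- int N..int N})"
    by auto
  then have "(\<Sum>n\<in>{- int (Suc N)..int (Suc N)}. g n)
     = g (int (Suc N)) + (g (- int (Suc N)) + (\<Sum>n\<in>{- int N..int N}. g n))"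
    by (simp only:) (subst sum.insert, auto)+
  then show ?case using Suc by (simp add: add_ac)
qed simp

text \<open>33 = 1 + 2 \<cdot> 16: the mode 0 contributes L, and each sign of n contributes 16 L
  N^(1/16).\<close>

lemma sum_radius_le:
  assumes "0 \<le> L" "1 \<le> N"
  shows "(\<Sum>n\<in>{- int N..int N}. radius L n) \<le> 33 * L * real N powr (1 / 16)"
proof -
  have "(\<Sum>n\<in>{1..N}. radius L (int n)) \<le> (\<Sum>n\<in>{1..N}. L * real n powr (- 15 / 16))"
    using assms by (intro sum_mono radius_le) auto
  also have "\<dots> = L * (\<Sum>n\<in>{1..N}. real n powr (- 15 / 16))" by (simp add: sum_distrib_left)
  also have "\<dots> \<le> L * (16 * real N powr (1 / 16))"
    using assms by (intro mult_left_mono sum_powr_le) auto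
  finally have 1: "(\<Sum>n\<in>{1..N}. radius L (int n)) \<le> L * (16 * real N powr (1 / 16))" .
  have "radius L 0 = L" by (simp add: radius_def jbracket_def)
  also have "\<dots> \<le> L * real N powr (1 / 16)"
    using assms by (intro mult_left_le_imp_le[of 1 L] mult_right_mono[of 1 _ L, simplified])
      (auto simp: mult_le_cancel_left1 ge_one_powr_ge_zero)
  finally have 2: "radius L 0 \<le> L * real N powr (1 / 16)" .
  have "(\<Sum>n\<in>{- int N..int N}. radius L n) = radius L 0 + 2 * (\<Sum>n\<in>{1..N}. radius L (int n))"
    by (simp add: sum_int_interval sum_distrib_left)
  then show ?thesis using 1 2 by simp
qed

text \<open>Serves to bound translated and reflected sums of a nonnegative family by its total sum,
  since both changes of index are injective.\<close>

lemma sum_inj_le: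
  fixes a :: "int \<Rightarrow> real"
  assumes "finite J" "\<And>m. 0 \<le> a m" "\<And>m. m \<notin> J \<Longrightarrow> a m = 0" "finite K" "inj_on \<phi> K"
  shows "(\<Sum>k\<in>K. a (\<phi> k)) \<le> (\<Sum>m\<in>J. a m)"
proof -
  have "(\<Sum>k\<in>K. a (\<phi> k)) = (\<Sum>m\<in>\<phi> ` K. a m)"
    using assms by (simp add: sum.reindex)
  also have "\<dots> = (\<Sum>m\<in>\<phi> ` K \<inter> J. a m)"
    using assms by (intro sum.mono_neutral_right) auto
  also have "\<dots> \<le> (\<Sum>m\<in>J. a m)"
    using assms by (intro sum_mono2) auto
  finally show ?thesis .
qed

text \<open>
  One of the three frequencies \<open>n\<close>, \<open>k - n\<close>, \<open>k - s\<close> is at least \<open>N / 3\<close> in absolute value,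
  because \<open>n + (k - n) - (k - s) = s\<close>.
\<close>

lemma triple_convolution_le:
  fixes a :: "int \<Rightarrow> real"
  assumes L: "0 \<le> L" and N: "1 \<le> N" and s: "\<bar>s\<bar> = int N"
    and a: "\<And>n. 0 \<le> a n" "\<And>n. a n \<le> radius L n" "\<And>n. n \<notin> {- int N..int N} \<Longrightarrow> a n = 0"
    and K: "finite K" and sum_a: "(\<Sum>n\<in>{- int N..int N}. a n) \<le> S"
  shows "(\<Sum>k\<in>K. (\<Sum>n\<in>{- int N..int N}. a n * a (k - n)) * a (k - s))
     \<le> 9 * (L * real N powr (- 15 / 16)) * S\<^sup>2"
proof -
  let ?J = "{- int N..int N}"
  define \<rho> where "\<rho> = L * real N powr (- 15 / 16)"
  have \<rho>: "0 \<le> \<rho>" using L by (simp add: \<rho>_def)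
  have S: "0 \<le> S" using sum_a sum_nonneg[of ?J a] a(1) by fastforce
  have large: "a m \<le> 3 * \<rho>" if m: "real N / 3 \<le> \<bar>real_of_int m\<bar>" for m
  proof -
    have "a m \<le> L * (real N / 3) powr (- 15 / 16)"
      using a(2)[of m] radius_le[OF L _ m] N by linarith
    also have "\<dots> = \<rho> * 3 powr (15 / 16)"
      using N by (simp add: \<rho>_def powr_divide powr_minus divide_simps)
    also have "\<dots> \<le> \<rho> * 3 powr 1"
      using \<rho> by (intro mult_left_mono powr_mono) auto
    finally show ?thesis by simp
  qed
  \<comment> \<open>Whichever factor carries a frequency of size at least N / 3 is replaced by 3
    \<rho>. Adding the three alternatives avoids splitting the sum, and each of them sums to at most
    S^2, whence the factor 9.\<close>
  have pw: "a n * a (k - n) * a (k - s)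
      \<le> 3 * \<rho> * (a n * a (k - n)) + 3 * \<rho> * (a n * a (k - s)) + 3 * \<rho> * (a (k - n) * a (k - s))" for k n
  proof -
    have nn: "0 \<le> 3 * \<rho> * (a n * a (k - n))" "0 \<le> 3 * \<rho> * (a n * a (k - s))"
      "0 \<le> 3 * \<rho> * (a (k - n) * a (k - s))"
      using a(1) \<rho> by simp_all
    have "real N = \<bar>real_of_int n + real_of_int (k - n) - real_of_int (k - s)\<bar>"
      using s by (simp flip: of_int_abs)
    then consider "real N / 3 \<le> \<bar>real_of_int n\<bar>" | "real N / 3 \<le> \<bar>real_of_int (k - n)\<bar>"
      | "real N / 3 \<le> \<bar>real_of_int (k - s)\<bar>"
      by linarith
    then show ?thesis
    proof cases
      case 1
      have "a n * (a (k - n) * a (k - s)) \<le> 3 * \<rho> * (a (k - n) * a (k - s))"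
        using large[OF 1] a(1) by (intro mult_right_mono) auto
      then show ?thesis using nn by (simp add: mult.assoc)
    next
      case 2
      have "a (k - n) * (a n * a (k - s)) \<le> 3 * \<rho> * (a n * a (k - s))"
        using large[OF 2] a(1) by (intro mult_right_mono) auto
      then show ?thesis using nn by (simp add: mult_ac)
    next
      case 3
      have "a (k - s) * (a n * a (k - n)) \<le> 3 * \<rho> * (a n * a (k - n))"
        using large[OF 3] a(1) by (intro mult_right_mono) auto
      then show ?thesis using nn by (simp add: mult_ac)
    qed
  qed
  have shift: "(\<Sum>k\<in>K'. a (\<phi> k)) \<le> S" if "finite K'" "inj_on \<phi> K'" for \<phi> and K' :: "int set"
    using sum_inj_le[of ?J a K' \<phi>] a that sum_a by force
  have s1: "(\<Sum>k\<in>K. \<Sum>n\<in>?J. a n * a (k - n)) \<le> S\<^sup>2"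
  proof -
    have "(\<Sum>k\<in>K. \<Sum>n\<in>?J. a n * a (k - n)) = (\<Sum>n\<in>?J. a n * (\<Sum>k\<in>K. a (k - n)))"
      by (subst sum.swap) (simp add: sum_distrib_left)
    also have "\<dots> \<le> (\<Sum>n\<in>?J. a n * S)"
      using a(1) K by (intro sum_mono mult_left_mono shift) (auto simp: inj_on_def)
    also have "\<dots> \<le> S\<^sup>2" using sum_a S by (simp add: sum_distrib_right[symmetric] power2_eq_square mult_right_mono)
    finally show ?thesis .
  qed
  have s2: "(\<Sum>k\<in>K. \<Sum>n\<in>?J. a n * a (k - s)) \<le> S\<^sup>2"
  proof -
    have "(\<Sum>k\<in>K. \<Sum>n\<in>?J. a n * a (k - s)) = (\<Sum>n\<in>?J. a n) * (\<Sum>k\<in>K. a (k - s))"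
      by (subst sum.swap) (simp add: sum_product)
    also have "\<dots> \<le> S * S"
      using a(1) K S sum_a by (intro mult_mono shift) (auto simp: inj_on_def intro!: sum_nonneg)
    finally show ?thesis by (simp add: power2_eq_square)
  qed
  have s3: "(\<Sum>k\<in>K. \<Sum>n\<in>?J. a (k - n) * a (k - s)) \<le> S\<^sup>2"
  proof -
    have "(\<Sum>k\<in>K. \<Sum>n\<in>?J. a (k - n) * a (k - s)) = (\<Sum>k\<in>K. (\<Sum>n\<in>?J. a (k - n)) * a (k - s))"
      by (simp add: sum_distrib_right)
    also have "\<dots> \<le> (\<Sum>k\<in>K. S * a (k - s))"
      using a(1) by (intro sum_mono mult_right_mono shift) (auto simp: inj_on_def)
    also have "\<dots> = S * (\<Sum>k\<in>K. a (k - s))" by (simp add: sum_distrib_left)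
    also have "\<dots> \<le> S * S" using S K by (intro mult_left_mono shift) (auto simp: inj_on_def)
    finally show ?thesis by (simp add: power2_eq_square)
  qed
  have "(\<Sum>k\<in>K. (\<Sum>n\<in>?J. a n * a (k - n)) * a (k - s)) = (\<Sum>k\<in>K. \<Sum>n\<in>?J. a n * a (k - n) * a (k - s))"
    by (simp add: sum_distrib_right)
  also have "\<dots> \<le> (\<Sum>k\<in>K. \<Sum>n\<in>?J. 3 * \<rho> * (a n * a (k - n)) + 3 * \<rho> * (a n * a (k - s)) + 3 * \<rho> * (a (k - n) * a (k - s)))"
    by (intro sum_mono pw)
  also have "\<dots> = 3 * \<rho> * ((\<Sum>k\<in>K. \<Sum>n\<in>?J. a n * a (k - n)) + (\<Sum>k\<in>K. \<Sum>n\<in>?J. a n * a (k - s))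
      + (\<Sum>k\<in>K. \<Sum>n\<in>?J. a (k - n) * a (k - s)))"
    by (simp add: sum.distrib sum_distrib_left distrib_left)
  also have "\<dots> \<le> 3 * \<rho> * (S\<^sup>2 + S\<^sup>2 + S\<^sup>2)"
    using \<rho> s1 s2 s3 by (intro mult_left_mono add_mono) auto
  finally show ?thesis by (simp add: \<rho>_def)
qed

section \<open>Adding one pair of modes to the quartic form\<close>

lemma conv2_eq_0: "2 * int N < \<bar>k\<bar> \<Longrightarrow> conv2 N c k = 0"
  unfolding conv2_def by (intro sum.neutral) (auto simp: trunc_def)

lemma cmod_conv2_le:
  "cmod (conv2 N c k) \<le> (\<Sum>n\<in>{- int N..int N}. cmod (trunc N c n) * cmod (trunc N c (k - n)))"
  unfolding conv2_def
  by (rule order.trans[OF norm_sum], rule sum_mono) (auto simp: norm_mult trunc_def)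

text \<open>Expansion of the square of v plus the two new modes: mixed products with v are counted
  twice, and the products of new modes with each other land at the frequencies 2m, -2m and
  0.\<close>

lemma conv2_Suc:
  fixes c N
  defines "v \<equiv> trunc N c" and "m \<equiv> int (Suc N)"
  shows "conv2 (Suc N) c k = conv2 N c k + 2 * c m * v (k - m) + 2 * c (- m) * v (k + m)
      + (if k = 2 * m then (c m)\<^sup>2 else 0) + (if k = - 2 * m then (c (- m))\<^sup>2 else 0)
      + (if k = 0 then 2 * c m * c (- m) else 0)"
proof -
  let ?J = "{- int N..int N}"
  define \<delta> where "\<delta> i j = (if i = j then 1 else 0 :: complex)" for i j :: int
  have m: "m > 0" "m \<notin> ?J" "- m \<notin> ?J" by (auto simp: m_def)
  have w: "trunc (Suc N) c i = v i + c m * \<delta> i m + c (- m) * \<delta> i (- m)" for i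
    by (auto simp: trunc_def v_def \<delta>_def m_def)
  have "{- int (Suc N)..int (Suc N)} = insert m (insert (- m) ?J)" by (auto simp: m_def)
  then have "conv2 (Suc N) c k = c m * trunc (Suc N) c (k - m) + (c (- m) * trunc (Suc N) c (k + m)
      + (\<Sum>n\<in>?J. c n * trunc (Suc N) c (k - n)))"
    unfolding conv2_def using m by (simp only:) (subst sum.insert, auto)+
  also have "(\<Sum>n\<in>?J. c n * trunc (Suc N) c (k - n))
     = conv2 N c k + c m * (\<Sum>n\<in>?J. c n * \<delta> (k - n) m) + c (- m) * (\<Sum>n\<in>?J. c n * \<delta> (k - n) (- m))"
    unfolding w conv2_def v_def[symmetric]
    by (simp add: algebra_simps sum.distrib sum_distrib_left)
  also have "(\<Sum>n\<in>?J. c n * \<delta> (k - n) m) = v (k - m)"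
  proof -
    have "(\<Sum>n\<in>?J. c n * \<delta> (k - n) m) = (\<Sum>n\<in>?J. if n = k - m then c n else 0)"
      by (intro sum.cong refl) (auto simp: \<delta>_def)
    then show ?thesis by (auto simp: sum.delta v_def trunc_def)
  qed
  also have "(\<Sum>n\<in>?J. c n * \<delta> (k - n) (- m)) = v (k + m)"
  proof -
    have "(\<Sum>n\<in>?J. c n * \<delta> (k - n) (- m)) = (\<Sum>n\<in>?J. if n = k + m then c n else 0)"
      by (intro sum.cong refl) (auto simp: \<delta>_def)
    then show ?thesis by (auto simp: sum.delta v_def trunc_def)
  qed
  finally show ?thesis
    using m(1) unfolding w by (auto simp: \<delta>_def power2_eq_square algebra_simps)
qed

text \<open>The product of the two new coefficients sits at frequency 0, where the weight k
  vanishes. At 2m and -2m all terms containing old modes vanish, and the pure fourth powers that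
  remain carry weights of opposite sign.\<close>

lemma f_coeff_Suc:
  fixes c N
  defines "v \<equiv> trunc N c" and "m \<equiv> int (Suc N)" and "q \<equiv> conv2 N c"
  shows "f_coeff (Suc N) c - f_coeff N c =
      (\<Sum>k\<in>{- 2 * m..2 * m}. of_int k * (2 * Re (cnj (q k) * (2 * c m * v (k - m) + 2 * c (- m) * v (k + m)))
          + 4 * (cmod (c m * v (k - m) + c (- m) * v (k + m)))\<^sup>2))
      + 2 * of_int m * ((cmod (c m)) ^ 4 - (cmod (c (- m))) ^ 4)"
proof -
  let ?K = "{- 2 * m..2 * m}"
  have m: "m = int N + 1" by (simp add: m_def)
  have v0: "v i = 0" if "m \<le> \<bar>i\<bar>" for i using that by (auto simp: v_def trunc_def m)
  have q0: "q i = 0" if "2 * m \<le> \<bar>i\<bar>" for i using that by (auto simp: q_def m intro!: conv2_eq_0)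
  have f: "f_coeff N c = (\<Sum>k\<in>?K. of_int k * (cmod (q k))\<^sup>2)"
    unfolding f_coeff_def q_def
    by (intro sum.mono_neutral_left) (auto simp: m conv2_eq_0)
  have sq: "(cmod (x + 2 * y))\<^sup>2 - (cmod x)\<^sup>2 = 2 * Re (cnj x * (2 * y)) + 4 * (cmod y)\<^sup>2" for x y
    unfolding cmod_power2 by (simp add: power2_eq_square algebra_simps)
  have pt: "of_int k * (cmod (conv2 (Suc N) c k))\<^sup>2 - of_int k * (cmod (q k))\<^sup>2 =
      of_int k * (2 * Re (cnj (q k) * (2 * c m * v (k - m) + 2 * c (- m) * v (k + m)))
          + 4 * (cmod (c m * v (k - m) + c (- m) * v (k + m)))\<^sup>2)
      + (if k = 2 * m then 2 * of_int m * (cmod (c m)) ^ 4 else 0)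
      - (if k = - 2 * m then 2 * of_int m * (cmod (c (- m))) ^ 4 else 0)" for k
  proof -
    consider "k = 0" | "k = 2 * m" | "k = - 2 * m" | "k \<noteq> 0" "k \<noteq> 2 * m" "k \<noteq> - 2 * m" by blast
    then show ?thesis
    proof cases
      case 1 then show ?thesis using m by simp
    next
      case 2
      have "v m = 0" "v (3 * m) = 0" "q (2 * m) = 0" using m by (auto intro!: v0 q0)
      then show ?thesis
        using 2 m conv2_Suc[of N c k, folded m_def v_def q_def]
        by (simp del: of_nat_Suc add: norm_power flip: power_mult)
    next
      case 3
      have "v (- m) = 0" "v (- (3 * m)) = 0" "q (- (2 * m)) = 0" using m by (auto intro!: v0 q0)
      then show ?thesis
        using 3 m conv2_Suc[of N c k, folded m_def v_def q_def]
        by (simp del: of_nat_Suc add: norm_power flip: power_mult) (simp add: algebra_simps)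
    next
      case 4
      then have "conv2 (Suc N) c k = q k + 2 * (c m * v (k - m) + c (- m) * v (k + m))"
        using conv2_Suc[of N c k, folded m_def v_def q_def]
        by (simp del: of_nat_Suc add: algebra_simps)
      then have "of_int k * (cmod (conv2 (Suc N) c k))\<^sup>2 - of_int k * (cmod (q k))\<^sup>2
         = of_int k * (2 * Re (cnj (q k) * (2 * (c m * v (k - m) + c (- m) * v (k + m))))
             + 4 * (cmod (c m * v (k - m) + c (- m) * v (k + m)))\<^sup>2)"
        by (simp only: sq[symmetric] right_diff_distrib)
      moreover have "2 * (c m * v (k - m) + c (- m) * v (k + m)) = 2 * c m * v (k - m) + 2 * c (- m) * v (k + m)"
        by (simp only: distrib_left mult.assoc)
      ultimately show ?thesis
        using 4(2,3) by (simp only: if_False add_0_right diff_0_right)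
    qed
  qed
  have "f_coeff (Suc N) c - f_coeff N c
      = (\<Sum>k\<in>?K. of_int k * (cmod (conv2 (Suc N) c k))\<^sup>2 - of_int k * (cmod (q k))\<^sup>2)"
    unfolding f by (simp add: f_coeff_def sum_subtractf m_def)
  also have "\<dots> = (\<Sum>k\<in>?K. of_int k * (2 * Re (cnj (q k) * (2 * c m * v (k - m) + 2 * c (- m) * v (k + m)))
          + 4 * (cmod (c m * v (k - m) + c (- m) * v (k + m)))\<^sup>2))
      + (\<Sum>k\<in>?K. if k = 2 * m then 2 * of_int m * (cmod (c m)) ^ 4 else 0)
      - (\<Sum>k\<in>?K. if k = - 2 * m then 2 * of_int m * (cmod (c (- m))) ^ 4 else 0)"
    unfolding pt by (simp only: sum_subtractf sum.distrib)
  also have "\<dots> = (\<Sum>k\<in>?K. of_int k * (2 * Re (cnj (q k) * (2 * c m * v (k - m) + 2 * c (- m) * v (k + m)))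
          + 4 * (cmod (c m * v (k - m) + c (- m) * v (k + m)))\<^sup>2))
      + 2 * of_int m * ((cmod (c m)) ^ 4 - (cmod (c (- m))) ^ 4)"
  proof -
    have "(\<Sum>k\<in>?K. if k = 2 * m then 2 * of_int m * (cmod (c m)) ^ 4 else 0) = 2 * of_int m * (cmod (c m)) ^ 4"
      "(\<Sum>k\<in>?K. if k = - 2 * m then 2 * of_int m * (cmod (c (- m))) ^ 4 else 0) = 2 * of_int m * (cmod (c (- m))) ^ 4"
      using m by (subst sum.delta; auto)+
    then show ?thesis by (simp only: right_diff_distrib add_diff_eq)
  qed
  finally show ?thesis .
qed

text \<open>The increment as a polynomial in the new pair (y, z), with coefficients built from old
  modes only. The decisive estimate is the last one: U and V separately may be of order N S^2, but
  shifting the index turns their weights into n + m and n - m. In the sum m cancels, and what is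
  left is controlled by |n| a_n \<le> L N^(1/16).\<close>

lemma f_coeff_increment:
  assumes L: "1 \<le> L" and N: "1 \<le> N" and c: "\<And>n. cmod (c n) \<le> radius L n"
  defines "\<rho> \<equiv> L * real N powr (- 15 / 16)" and "S \<equiv> 33 * L * real N powr (1 / 16)"
  obtains P1 P2 P3 U V where
    "\<And>y z. f_coeff N (c(int N := y, - int N := z)) - f_coeff (N - 1) c
       = Re (y * P1) + Re (z * P2) + Re (y * cnj z * P3) + 4 * (cmod y)\<^sup>2 * U + 4 * (cmod z)\<^sup>2 * V
         + 2 * real N * ((cmod y) ^ 4 - (cmod z) ^ 4)"
    "cmod P1 \<le> 72 * real N * \<rho> * S\<^sup>2" "cmod P2 \<le> 72 * real N * \<rho> * S\<^sup>2" "cmod P3 \<le> 16 * real N * S\<^sup>2"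
    "\<bar>U\<bar> \<le> 2 * real N * S\<^sup>2" "\<bar>V\<bar> \<le> 2 * real N * S\<^sup>2" "\<bar>U + V\<bar> \<le> 2 * (L * real N powr (1 / 16)) * S"
proof -
  obtain M where M: "N = Suc M" using N by (cases N) auto
  define m where "m = int N"
  define v where "v = trunc M c"
  define q where "q = conv2 M c"
  let ?J = "{- int M..int M}" and ?K = "{- 2 * m..2 * m}"
  define P1 where "P1 = (\<Sum>k\<in>?K. of_int k * (4 * cnj (q k) * v (k - m)))"
  define P2 where "P2 = (\<Sum>k\<in>?K. of_int k * (4 * cnj (q k) * v (k + m)))"
  define P3 where "P3 = (\<Sum>k\<in>?K. of_int k * (8 * v (k - m) * cnj (v (k + m))))"
  define U where "U = (\<Sum>k\<in>?K. of_int k * (cmod (v (k - m)))\<^sup>2)"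
  define V where "V = (\<Sum>k\<in>?K. of_int k * (cmod (v (k + m)))\<^sup>2)"
  have m: "m = int M + 1" "real_of_int m = real N" by (simp_all add: m_def M)
  define a where "a n = cmod (v n)" for n
  have a: "0 \<le> a n" "a n \<le> radius L n" "n \<notin> ?J \<Longrightarrow> a n = 0" "n \<notin> {- int N..int N} \<Longrightarrow> a n = 0" for n
    using c[of n] L by (auto simp: a_def v_def trunc_def M radius_nonneg)
  have "(\<Sum>n\<in>?J. a n) \<le> (\<Sum>n\<in>{- int N..int N}. radius L n)"
    using a L by (intro order.trans[OF sum_mono sum_mono2]) (auto simp: M radius_nonneg)
  also have "\<dots> \<le> S" unfolding S_def using L N by (intro sum_radius_le) auto
  finally have sumJ: "(\<Sum>n\<in>?J. a n) \<le> S" .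
  have "(\<Sum>n\<in>{- int N..int N}. a n) = (\<Sum>n\<in>?J. a n)"
    using a by (intro sum.mono_neutral_right) (auto simp: M)
  then have sumN: "(\<Sum>n\<in>{- int N..int N}. a n) \<le> S" using sumJ by simp
  have S: "0 \<le> S" using L by (simp add: S_def)
  have "cmod (q k) \<le> (\<Sum>n\<in>?J. a n * a (k - n))" for k
    using cmod_conv2_le[of M c k] by (simp add: q_def a_def v_def)
  moreover have "(\<Sum>n\<in>?J. a n * a (k - n)) = (\<Sum>n\<in>{- int N..int N}. a n * a (k - n))" for k
    using a by (intro sum.mono_neutral_left) (auto simp: M)
  ultimately have qa: "cmod (q k) \<le> (\<Sum>n\<in>{- int N..int N}. a n * a (k - n))" for k by metis
  have kle: "\<bar>real_of_int k\<bar> \<le> 2 * real N" if "k \<in> ?K" for k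
  proof -
    have "\<bar>k\<bar> \<le> 2 * m" using that by auto
    then have "real_of_int \<bar>k\<bar> \<le> real_of_int (2 * m)" by (simp only: of_int_le_iff)
    then show ?thesis using m by simp
  qed
  \<comment> \<open>72 N = 2 N \<cdot> 4 \<cdot> 9: the weight |k| \<le> 2 N, the factor 4, and the
    constant of \<open>triple_convolution_le\<close>. The shifts s = m and s = -m give P1 and
    P2.\<close>
  have P_le: "cmod (\<Sum>k\<in>?K. of_int k * (4 * cnj (q k) * v (k - s))) \<le> 72 * real N * \<rho> * S\<^sup>2"
    if s: "\<bar>s\<bar> = int N" for s
  proof -
    have "cmod (\<Sum>k\<in>?K. of_int k * (4 * cnj (q k) * v (k - s)))
        \<le> (\<Sum>k\<in>?K. \<bar>real_of_int k\<bar> * (4 * (cmod (q k) * a (k - s))))"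
      by (rule order.trans[OF norm_sum], rule sum_mono) (simp add: norm_mult a_def)
    also have "\<dots> \<le> (\<Sum>k\<in>?K. (2 * real N) * (4 * ((\<Sum>n\<in>{- int N..int N}. a n * a (k - n)) * a (k - s))))"
      by (intro sum_mono mult_mono mult_left_mono mult_right_mono kle qa a) (auto simp: a_def)
    also have "\<dots> = 8 * real N * (\<Sum>k\<in>?K. (\<Sum>n\<in>{- int N..int N}. a n * a (k - n)) * a (k - s))"
      by (simp add: sum_distrib_left mult_ac)
    also have "\<dots> \<le> 8 * real N * (9 * \<rho> * S\<^sup>2)"
      unfolding \<rho>_def using L N s a sumN by (intro mult_left_mono triple_convolution_le) auto
    finally show ?thesis by simp
  qed
  have sq: "(\<Sum>n\<in>?J. a n * a n) \<le> S\<^sup>2"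
  proof -
    have "(\<Sum>n\<in>?J. a n * a n) \<le> (\<Sum>n\<in>?J. a n * (\<Sum>n\<in>?J. a n))"
      using a by (intro sum_mono mult_left_mono member_le_sum) auto
    also have "\<dots> = (\<Sum>n\<in>?J. a n) * (\<Sum>n\<in>?J. a n)" by (simp add: sum_distrib_right)
    also have "\<dots> \<le> S * S" using sumJ S a(1) by (intro mult_mono) (auto intro: sum_nonneg)
    finally show ?thesis by (simp add: power2_eq_square)
  qed
  have shift: "(\<Sum>k\<in>?K. g k * (a (k - s))\<^sup>2) = (\<Sum>n\<in>?J. g (n + s) * (a n)\<^sup>2)"
    if "\<bar>s\<bar> = int N" for s and g :: "int \<Rightarrow> real"
  proof -
    have "(\<Sum>k\<in>?K. (\<lambda>n. g (n + s) * (a n)\<^sup>2) (k - s)) = (\<Sum>n\<in>?J. g (n + s) * (a n)\<^sup>2)"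
      using a that by (intro sum_shift) (auto simp: m M)
    then show ?thesis by simp
  qed
  have s2: "(\<Sum>k\<in>?K. (a (k - s))\<^sup>2) \<le> S\<^sup>2" if "\<bar>s\<bar> = int N" for s
    using shift[OF that, of "\<lambda>_. 1"] sq by (simp add: power2_eq_square)
  have UV: "\<bar>\<Sum>k\<in>?K. of_int k * (cmod (v (k - s)))\<^sup>2\<bar> \<le> 2 * real N * S\<^sup>2" if s: "\<bar>s\<bar> = int N" for s
  proof -
    have "\<bar>\<Sum>k\<in>?K. of_int k * (cmod (v (k - s)))\<^sup>2\<bar> \<le> (\<Sum>k\<in>?K. \<bar>real_of_int k\<bar> * (a (k - s))\<^sup>2)"
      by (rule order.trans[OF sum_abs], rule sum_mono) (simp add: abs_mult a_def)
    also have "\<dots> \<le> (\<Sum>k\<in>?K. (2 * real N) * (a (k - s))\<^sup>2)"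
      by (intro sum_mono mult_right_mono kle) auto
    also have "\<dots> = 2 * real N * (\<Sum>k\<in>?K. (a (k - s))\<^sup>2)" by (simp add: sum_distrib_left)
    also have "\<dots> \<le> 2 * real N * S\<^sup>2" by (intro mult_left_mono s2 s) auto
    finally show ?thesis .
  qed
  show ?thesis
  proof (rule that)
    show "cmod P1 \<le> 72 * real N * \<rho> * S\<^sup>2" using P_le[of m] by (simp add: P1_def m_def)
    show "cmod P2 \<le> 72 * real N * \<rho> * S\<^sup>2" using P_le[of "- m"] by (simp add: P2_def m_def)
    show "\<bar>U\<bar> \<le> 2 * real N * S\<^sup>2" using UV[of m] by (simp add: U_def m_def)
    show "\<bar>V\<bar> \<le> 2 * real N * S\<^sup>2" using UV[of "- m"] by (simp add: V_def m_def)
    have "cmod P3 \<le> (\<Sum>k\<in>?K. \<bar>real_of_int k\<bar> * (8 * (a (k - m) * a (k + m))))"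
      unfolding P3_def by (rule order.trans[OF norm_sum], rule sum_mono) (simp add: norm_mult a_def)
    also have "\<dots> \<le> (\<Sum>k\<in>?K. (2 * real N) * (8 * (((a (k - m))\<^sup>2 + (a (k + m))\<^sup>2) / 2)))"
    proof (intro sum_mono mult_mono mult_left_mono kle)
      fix k
      have "0 \<le> (a (k - m) - a (k + m))\<^sup>2" by simp
      then show "a (k - m) * a (k + m) \<le> ((a (k - m))\<^sup>2 + (a (k + m))\<^sup>2) / 2"
        by (simp add: power2_eq_square algebra_simps)
    qed (auto simp: a_def)
    also have "\<dots> = 8 * real N * ((\<Sum>k\<in>?K. (a (k - m))\<^sup>2) + (\<Sum>k\<in>?K. (a (k - (- m)))\<^sup>2))"
      unfolding sum_distrib_left sum.distrib[symmetric] by (intro sum.cong refl) (simp add: field_simps)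
    also have "\<dots> \<le> 8 * real N * (S\<^sup>2 + S\<^sup>2)"
      by (intro mult_left_mono add_mono s2) (auto simp: m_def)
    finally show "cmod P3 \<le> 16 * real N * S\<^sup>2" by simp
    have "U + V = (\<Sum>n\<in>?J. of_int (n + m) * (a n)\<^sup>2) + (\<Sum>n\<in>?J. of_int (n + - m) * (a n)\<^sup>2)"
      using shift[of m real_of_int] shift[of "- m" real_of_int] by (simp add: U_def V_def a_def m_def)
    also have "\<dots> = 2 * (\<Sum>n\<in>?J. of_int n * a n * a n)"
      by (simp add: sum.distrib[symmetric] sum_distrib_left power2_eq_square algebra_simps)
    finally have "\<bar>U + V\<bar> \<le> 2 * (\<Sum>n\<in>?J. \<bar>real_of_int n\<bar> * a n * a n)"
      using sum_abs[of "\<lambda>n. of_int n * a n * a n" ?J] a(1) by (simp add: abs_mult)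
    also have "(\<Sum>n\<in>?J. \<bar>real_of_int n\<bar> * a n * a n) \<le> (\<Sum>n\<in>?J. (L * real N powr (1 / 16)) * a n)"
    proof (intro sum_mono mult_right_mono a)
      fix n assume n: "n \<in> ?J"
      show "\<bar>real_of_int n\<bar> * a n \<le> L * real N powr (1 / 16)"
      proof (cases "n = 0")
        case False
        define x where "x = \<bar>real_of_int n\<bar>"
        have x: "1 \<le> x" using False by (simp add: x_def)
        have "real_of_int \<bar>n\<bar> \<le> real_of_int (int N)" using n M by (subst of_int_le_iff) auto
        then have xN: "x \<le> real N" by (simp add: x_def)
        have "x * a n \<le> x * (L * x powr (- 15 / 16))"
          using a(2)[of n] radius_le[of L x n] x L False by (intro mult_left_mono) (auto simp: x_def)
        also have "\<dots> = L * x powr (1 / 16)"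
          using powr_add[of x 1 "- 15 / 16"] x by simp
        also have "\<dots> \<le> L * real N powr (1 / 16)"
          using L x xN by (intro mult_left_mono powr_mono2) auto
        finally show ?thesis by (simp add: x_def)
      qed (use L in auto)
    qed
    also have "\<dots> = L * real N powr (1 / 16) * (\<Sum>n\<in>?J. a n)" by (simp add: sum_distrib_left)
    also have "\<dots> \<le> L * real N powr (1 / 16) * S" using L by (intro mult_left_mono sumJ) auto
    finally show "\<bar>U + V\<bar> \<le> 2 * (L * real N powr (1 / 16)) * S" by simp
  next
    fix y z
    let ?c = "c(int N := y, - int N := z)"
    have v': "trunc M ?c = v" "conv2 M ?c = q" "f_coeff M ?c = f_coeff M c"
    proof -
      show "trunc M ?c = v" by (auto simp: v_def trunc_def M fun_eq_iff)
      then show "conv2 M ?c = q" "f_coeff M ?c = f_coeff M c"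
        unfolding q_def v_def by (metis conv2_trunc, metis f_coeff_trunc)
    qed
    have N1: "N - 1 = M" by (simp add: M)
    have cm: "?c (int N) = y" "?c (- int N) = z" using N by auto
    have exp_sq: "(cmod (y * s + z * t))\<^sup>2 = (cmod y)\<^sup>2 * (cmod s)\<^sup>2 + (cmod z)\<^sup>2 * (cmod t)\<^sup>2
        + 2 * Re (y * cnj z * (s * cnj t))" for s t
      unfolding cmod_power2 by (simp add: power2_eq_square algebra_simps)
    have "f_coeff N ?c - f_coeff M c =
      (\<Sum>k\<in>?K. of_int k * (2 * Re (cnj (q k) * (2 * y * v (k - m) + 2 * z * v (k + m)))
          + 4 * (cmod (y * v (k - m) + z * v (k + m)))\<^sup>2))
      + 2 * real N * ((cmod y) ^ 4 - (cmod z) ^ 4)"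
      using f_coeff_Suc[of M ?c, unfolded M[symmetric] v' cm] by (simp only: m_def of_int_of_nat_eq)
    also have "(\<Sum>k\<in>?K. of_int k * (2 * Re (cnj (q k) * (2 * y * v (k - m) + 2 * z * v (k + m)))
          + 4 * (cmod (y * v (k - m) + z * v (k + m)))\<^sup>2))
       = (\<Sum>k\<in>?K. Re (y * (of_int k * (4 * cnj (q k) * v (k - m)))) + Re (z * (of_int k * (4 * cnj (q k) * v (k + m))))
           + Re (y * cnj z * (of_int k * (8 * v (k - m) * cnj (v (k + m)))))
           + 4 * (cmod y)\<^sup>2 * (of_int k * (cmod (v (k - m)))\<^sup>2) + 4 * (cmod z)\<^sup>2 * (of_int k * (cmod (v (k + m)))\<^sup>2))"
      unfolding exp_sq by (intro sum.cong refl) (simp add: algebra_simps)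
    also have "\<dots> = Re (y * P1) + Re (z * P2) + Re (y * cnj z * P3) + 4 * (cmod y)\<^sup>2 * U + 4 * (cmod z)\<^sup>2 * V"
      unfolding P1_def P2_def P3_def U_def V_def sum.distrib sum_distrib_left Re_sum ..
    finally show "f_coeff N ?c - f_coeff (N - 1) c
       = Re (y * P1) + Re (z * P2) + Re (y * cnj z * P3) + 4 * (cmod y)\<^sup>2 * U + 4 * (cmod z)\<^sup>2 * V
         + 2 * real N * ((cmod y) ^ 4 - (cmod z) ^ 4)"
      unfolding N1 .
  qed
qed

section \<open>Sizes of the increments and of their means over the new modes\<close>

lemma radius_int_le:
  assumes "0 \<le> L" "1 \<le> N"
  shows "radius L (int N) \<le> L * real N powr (- 15 / 16)"
  using assms by (intro radius_le) auto

lemma new_radius_le_sum_bound: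
  assumes "0 \<le> L" "1 \<le> N"
  shows "L * real N powr (- 15 / 16) \<le> 33 * L * real N powr (1 / 16)"
proof -
  have "real N powr (- 15 / 16) \<le> real N powr (1 / 16)"
    using assms by (intro powr_mono) auto
  then have "real N powr (- 15 / 16) \<le> 33 * real N powr (1 / 16)"
    using powr_ge_zero[of "real N" "1 / 16"] by linarith
  then have "L * real N powr (- 15 / 16) \<le> L * (33 * real N powr (1 / 16))"
    using assms by (intro mult_left_mono)
  then show ?thesis by (simp add: mult_ac)
qed

text \<open>In sixteenths the exponents are 16 - 30 + 2 = -12 and -30 + 2 = -28 for the quartic
  form, -30 for the mass, -15 + 5 = -10 and -30 + 4 = -26 for the sextic integral. The last two
  attain the targets -10 and -26, which is where the exponents -5/8 and -13/8 come from.\<close>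

lemma increment_powr_bounds:
  assumes "1 \<le> N"
  shows "real N * (real N powr (- 15 / 16))\<^sup>2 * (real N powr (1 / 16))\<^sup>2 \<le> real N powr (- 5 / 8)"
    and "(real N powr (- 15 / 16))\<^sup>2 * (real N powr (1 / 16))\<^sup>2 \<le> real N powr (- 13 / 8)"
    and "(real N powr (- 15 / 16))\<^sup>2 \<le> real N powr (- 13 / 8)"
    and "(real N powr (- 15 / 16))\<^sup>2 \<le> real N powr (- 5 / 8)"
    and "real N powr (- 15 / 16) * (real N powr (1 / 16)) ^ 5 \<le> real N powr (- 5 / 8)"
    and "(real N powr (- 15 / 16))\<^sup>2 * (real N powr (1 / 16)) ^ 4 \<le> real N powr (- 13 / 8)"
proof -
  have N: "0 < real N" "1 \<le> real N" using assms by auto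
  have 1: "real N = real N powr 1" using N by simp
  show "real N * (real N powr (- 15 / 16))\<^sup>2 * (real N powr (1 / 16))\<^sup>2 \<le> real N powr (- 5 / 8)"
    by (subst 1) (use N in \<open>auto simp: powr_power powr_add[symmetric] intro!: powr_mono simp del: powr_one powr_one'\<close>)
qed (use assms in \<open>auto simp: powr_power powr_add[symmetric] intro!: powr_mono\<close>)


lemma (in prob_space) abs_integral_le:
  fixes f :: "'a \<Rightarrow> real"
  assumes "AE x in M. \<bar>f x\<bar> \<le> B" "0 \<le> B"
  shows "\<bar>\<integral>x. f x \<partial>M\<bar> \<le> B"
proof (cases "integrable M f")
  case True
  have "\<bar>\<integral>x. f x \<partial>M\<bar> \<le> (\<integral>x. \<bar>f x\<bar> \<partial>M)" by (rule integral_abs_bound)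
  also have "\<dots> \<le> (\<integral>x. B \<partial>M)" using True assms by (intro integral_mono_AE) auto
  finally show ?thesis by (simp add: prob_space)
next
  \<comment> \<open>A non-integrable function has integral 0 by convention, and 0 \<le> B covers
    this case.\<close>
  case False
  then show ?thesis using assms by (simp add: not_integrable_integral_eq)
qed

lemma (in prob_space) abs_integral2_le:
  fixes D :: "'a \<Rightarrow> 'a \<Rightarrow> real"
  assumes ae: "AE x in M. Q x" and D: "\<And>y z. Q y \<Longrightarrow> Q z \<Longrightarrow> \<bar>D y z\<bar> \<le> B" and B: "0 \<le> B"
  shows "\<bar>\<integral>y. (\<integral>z. D y z \<partial>M) \<partial>M\<bar> \<le> B"
proof (rule abs_integral_le[OF _ B], use ae in eventually_elim)
  case (elim y)
  show ?case by (rule abs_integral_le[OF _ B], use ae in eventually_elim) (rule D[OF elim])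
qed

text \<open>The features of the law of a clipped coefficient that enter the averaged increments:
  boundedness makes every polynomial integrable, and centring removes every term linear in a new
  coefficient.\<close>

locale bounded_centred_law = prob_space \<eta> for \<eta> :: "complex measure" +
  fixes r :: real
  assumes sets_eq [measurable_cong]: "sets \<eta> = sets borel"
    and bounded: "AE z in \<eta>. cmod z \<le> r"
    and centred: "(\<integral>z. z \<partial>\<eta>) = 0"
begin

lemma integrable_bounded:
  fixes f :: "complex \<Rightarrow> 'a::{banach, second_countable_topology}"
  assumes "f \<in> borel_measurable borel" "\<And>z. cmod z \<le> r \<Longrightarrow> norm (f z) \<le> B"
  shows "integrable \<eta> f"
  using bounded assms by (intro integrable_const_bound[of _ B]) auto

lemma integrable_id: "integrable \<eta> (\<lambda>z. z)"
  by (rule integrable_bounded[of _ r]) auto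

lemma integrable_power: "integrable \<eta> (\<lambda>z. (cmod z) ^ k)"
  by (rule integrable_bounded[of _ "r ^ k"]) (auto intro: power_mono)

lemma integrable_Re_mult: "integrable \<eta> (\<lambda>z. Re (a * z))" "integrable \<eta> (\<lambda>z. Re (a * cnj z))"
  using integrable_id by auto

lemma integral_Re_mult: "(\<integral>z. Re (a * z) \<partial>\<eta>) = 0" "(\<integral>z. Re (a * cnj z) \<partial>\<eta>) = 0"
proof -
  have *: "(\<integral>z. Re (a * z) \<partial>\<eta>) = 0" for a
  proof -
    have "(\<integral>z. Re (a * z) \<partial>\<eta>) = Re (\<integral>z. a * z \<partial>\<eta>)"
      using integrable_id by (intro integral_Re) auto
    then show ?thesis by (simp add: centred)
  qed
  show "(\<integral>z. Re (a * z) \<partial>\<eta>) = 0" by (rule *)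
  have "(\<lambda>z. Re (a * cnj z)) = (\<lambda>z. Re (cnj a * z))" by auto
  then show "(\<integral>z. Re (a * cnj z) \<partial>\<eta>) = 0" using *[of "cnj a"] by (simp only:)
qed

end

text \<open>The new modes add |y|^2 + |z|^2, of order N^(-15/8); this is small enough for both
  bounds without any cancellation.\<close>

lemma increment_bounds_mass: "increment_bounds mass 2"
proof
  fix L :: real and N :: nat and c \<eta>
  assume a: "1 \<le> L" "1 \<le> N" "\<And>n. cmod (c n) \<le> radius L n"
  define \<rho> where "\<rho> = L * real N powr (- 15 / 16)"
  have inc: "mass N c - mass (N - 1) c = (cmod (c (int N)))\<^sup>2 + (cmod (c (- int N)))\<^sup>2" for c
    unfolding mass_def sum_int_interval using a(2) by (cases N) auto
  have L: "L\<^sup>2 \<le> L ^ 6" using a by (intro power_increasing) auto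
  have \<rho>: "\<rho>\<^sup>2 \<le> L ^ 6 * real N powr (- 5 / 8)" "\<rho>\<^sup>2 \<le> L ^ 6 * real N powr (- 13 / 8)"
    unfolding \<rho>_def power_mult_distrib using a increment_powr_bounds[OF a(2)] by (intro mult_mono L; simp)+
  have r: "radius L (int N) \<le> \<rho>" "radius L (- int N) \<le> \<rho>"
    unfolding \<rho>_def using a radius_int_le[of L N] by auto
  have "(cmod (c (int N)))\<^sup>2 \<le> \<rho>\<^sup>2" "(cmod (c (- int N)))\<^sup>2 \<le> \<rho>\<^sup>2"
    using a(3)[of "int N"] a(3)[of "- int N"] r by (intro power_mono; simp)+
  then show "\<bar>mass N c - mass (N - 1) c\<bar> \<le> 2 * L ^ 6 * real N powr (- 5 / 8)"
    unfolding inc using \<rho>(1) by simp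
  assume b: "prob_space \<eta>" "sets \<eta> = sets borel" "AE z in \<eta>. cmod z \<le> radius L (int N)"
    "(\<integral>z. z \<partial>\<eta>) = 0"
  interpret prob_space \<eta> by fact
  have "mass N (c(int N := y, - int N := z)) - mass (N - 1) c = (cmod y)\<^sup>2 + (cmod z)\<^sup>2" for y z
  proof -
    have "mass (N - 1) c = mass (N - 1) (c(int N := y, - int N := z))"
      using a(2) by (auto simp: mass_def intro!: sum.cong)
    then show ?thesis using inc[of "c(int N := y, - int N := z)"] a(2) by simp
  qed
  moreover have "\<bar>\<integral>y. (\<integral>z. (cmod y)\<^sup>2 + (cmod z)\<^sup>2 \<partial>\<eta>) \<partial>\<eta>\<bar> \<le> 2 * \<rho>\<^sup>2"
  proof (rule abs_integral2_le[OF b(3)])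
    fix y z :: complex
    assume "cmod y \<le> radius L (int N)" "cmod z \<le> radius L (int N)"
    then have "(cmod y)\<^sup>2 \<le> \<rho>\<^sup>2" "(cmod z)\<^sup>2 \<le> \<rho>\<^sup>2" using r by (intro power_mono; simp)+
    then show "\<bar>(cmod y)\<^sup>2 + (cmod z)\<^sup>2\<bar> \<le> 2 * \<rho>\<^sup>2" by simp
  qed simp
  ultimately show "\<bar>\<integral>y. (\<integral>z. mass N (c(int N := y, - int N := z)) - mass (N - 1) c \<partial>\<eta>) \<partial>\<eta>\<bar>
      \<le> 2 * L ^ 6 * real N powr (- 13 / 8)"
    using \<rho>(2) by simp
qed (auto simp: measurable_mass mass_trunc)

text \<open>Averaging removes the terms with P1, P2 and P3 because the law is centred, and the
  fourth powers cancel because y and z have the same law. What remains is 4 m2 (U + V), so the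
  cancellation in U + V decides the size of the mean.\<close>

lemma increment_bounds_f_coeff: "increment_bounds f_coeff 200000"
proof
  fix L :: real and N :: nat and c \<eta>
  assume a: "1 \<le> L" "1 \<le> N" "\<And>n. cmod (c n) \<le> radius L n"
  define \<rho> where "\<rho> = L * real N powr (- 15 / 16)"
  define S where "S = 33 * L * real N powr (1 / 16)"
  obtain P1 P2 P3 U V where D: "\<And>y z. f_coeff N (c(int N := y, - int N := z)) - f_coeff (N - 1) c
       = Re (y * P1) + Re (z * P2) + Re (y * cnj z * P3) + 4 * (cmod y)\<^sup>2 * U + 4 * (cmod z)\<^sup>2 * V
         + 2 * real N * ((cmod y) ^ 4 - (cmod z) ^ 4)"
    and P: "cmod P1 \<le> 72 * real N * \<rho> * S\<^sup>2" "cmod P2 \<le> 72 * real N * \<rho> * S\<^sup>2" "cmod P3 \<le> 16 * real N * S\<^sup>2"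
    and UV: "\<bar>U\<bar> \<le> 2 * real N * S\<^sup>2" "\<bar>V\<bar> \<le> 2 * real N * S\<^sup>2" "\<bar>U + V\<bar> \<le> 2 * (L * real N powr (1 / 16)) * S"
    using f_coeff_increment[OF a] unfolding \<rho>_def S_def by metis
  have \<rho>0: "0 \<le> \<rho>" using a by (simp add: \<rho>_def)
  have r: "radius L (int N) \<le> \<rho>" "radius L (- int N) \<le> \<rho>"
    unfolding \<rho>_def using a radius_int_le[of L N] by auto
  have L4: "L ^ 4 \<le> L ^ 6" using a by (intro power_increasing) auto
  have \<rho>S: "\<rho> \<le> S"
    unfolding \<rho>_def S_def using a by (intro new_radius_le_sum_bound) auto
  let ?B = "real N * \<rho>\<^sup>2 * S\<^sup>2"
  \<comment> \<open>180 = 72 + 72 + 16 + 8 + 8 + 4, one summand for each term of the increment. S^2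
    brings in 33^2 = 1089, and 180 \<cdot> 1089 = 196020.\<close>
  have B: "180 * ?B \<le> 200000 * L ^ 6 * real N powr (- 5 / 8)"
  proof -
    have "?B = 1089 * (L ^ 4 * (real N * (real N powr (- 15 / 16))\<^sup>2 * (real N powr (1 / 16))\<^sup>2))"
      by (simp add: \<rho>_def S_def power2_eq_square power4_eq_xxxx)
    also have "\<dots> \<le> 1089 * (L ^ 6 * real N powr (- 5 / 8))"
      using increment_powr_bounds(1)[OF a(2)] a L4 by (intro mult_left_mono mult_mono) auto
    finally have "180 * ?B \<le> 196020 * (L ^ 6 * real N powr (- 5 / 8))" by linarith
    also have "\<dots> \<le> 200000 * (L ^ 6 * real N powr (- 5 / 8))" using a by (intro mult_right_mono) auto
    finally show ?thesis by simp
  qed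
  have Dle: "\<bar>Re (y * P1) + Re (z * P2) + Re (y * cnj z * P3) + 4 * (cmod y)\<^sup>2 * U + 4 * (cmod z)\<^sup>2 * V
         + 2 * real N * ((cmod y) ^ 4 - (cmod z) ^ 4)\<bar> \<le> 180 * ?B"
    if yz: "cmod y \<le> \<rho>" "cmod z \<le> \<rho>" for y z
  proof -
    have lin: "\<bar>Re (w * P)\<bar> \<le> 72 * ?B" if "cmod w \<le> \<rho>" "cmod P \<le> 72 * real N * \<rho> * S\<^sup>2" for w P
    proof -
      have "\<bar>Re (w * P)\<bar> \<le> cmod w * cmod P" using abs_Re_le_cmod[of "w * P"] by (simp add: norm_mult)
      also have "\<dots> \<le> \<rho> * (72 * real N * \<rho> * S\<^sup>2)" using that \<rho>0 by (intro mult_mono) auto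
      finally show ?thesis by (simp add: power2_eq_square mult_ac)
    qed
    have q3: "\<bar>Re (y * cnj z * P3)\<bar> \<le> 16 * ?B"
    proof -
      have "\<bar>Re (y * cnj z * P3)\<bar> \<le> cmod y * cmod z * cmod P3"
        using abs_Re_le_cmod[of "y * cnj z * P3"] by (simp add: norm_mult)
      also have "\<dots> \<le> \<rho> * \<rho> * (16 * real N * S\<^sup>2)" using yz P \<rho>0 by (intro mult_mono) auto
      finally show ?thesis by (simp add: power2_eq_square mult_ac)
    qed
    have qu: "\<bar>4 * (cmod w)\<^sup>2 * X\<bar> \<le> 8 * ?B" if "cmod w \<le> \<rho>" "\<bar>X\<bar> \<le> 2 * real N * S\<^sup>2" for w X
    proof -
      have "\<bar>4 * (cmod w)\<^sup>2 * X\<bar> = 4 * (cmod w)\<^sup>2 * \<bar>X\<bar>" by (simp add: abs_mult)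
      also have "\<dots> \<le> 4 * \<rho>\<^sup>2 * (2 * real N * S\<^sup>2)"
        using that \<rho>0 by (intro mult_mono power_mono) auto
      finally show ?thesis by (simp add: mult_ac)
    qed
    have "\<bar>(cmod y) ^ 4 - (cmod z) ^ 4\<bar> \<le> \<rho> ^ 4"
      using power_mono[OF yz(1), of 4] power_mono[OF yz(2), of 4] by (simp add: abs_le_iff)
        (smt (verit) zero_le_power norm_ge_zero)
    also have "\<dots> = \<rho>\<^sup>2 * \<rho>\<^sup>2" by (simp flip: power_add)
    also have "\<dots> \<le> \<rho>\<^sup>2 * S\<^sup>2"
      using \<rho>S \<rho>0 by (intro mult_left_mono power_mono) auto
    finally have "2 * real N * \<bar>(cmod y) ^ 4 - (cmod z) ^ 4\<bar> \<le> 2 * real N * (\<rho>\<^sup>2 * S\<^sup>2)"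
      by (intro mult_left_mono) auto
    moreover have "\<bar>2 * real N * ((cmod y) ^ 4 - (cmod z) ^ 4)\<bar> = 2 * real N * \<bar>(cmod y) ^ 4 - (cmod z) ^ 4\<bar>"
      by (subst abs_mult) simp
    moreover have B0: "0 \<le> ?B" by simp
    ultimately have q4: "\<bar>2 * real N * ((cmod y) ^ 4 - (cmod z) ^ 4)\<bar> \<le> 4 * ?B"
      by linarith
    then show ?thesis
      using lin[OF yz(1) P(1)] lin[OF yz(2) P(2)] q3 qu[OF yz(1) UV(1)] qu[OF yz(2) UV(2)] q4 B0 by linarith
  qed
  have "\<bar>f_coeff N (c(int N := c (int N), - int N := c (- int N))) - f_coeff (N - 1) c\<bar> \<le> 180 * ?B"
    unfolding D by (rule Dle) (use a(3)[of "int N"] a(3)[of "- int N"] r in auto)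
  from this[unfolded fun_upd_triv] B
  show "\<bar>f_coeff N c - f_coeff (N - 1) c\<bar> \<le> 200000 * L ^ 6 * real N powr (- 5 / 8)"
    by linarith
  assume b: "prob_space \<eta>" "sets \<eta> = sets borel" "AE z in \<eta>. cmod z \<le> radius L (int N)"
    "(\<integral>z. z \<partial>\<eta>) = 0"
  interpret prob_space \<eta> by fact
  interpret bounded_centred_law \<eta> \<rho>
    by unfold_locales (use b r in auto)
  define m2 where "m2 = (\<integral>z. (cmod z)\<^sup>2 \<partial>\<eta>)"
  define m4 where "m4 = (\<integral>z. (cmod z) ^ 4 \<partial>\<eta>)"
  note int = integrable_power integrable_Re_mult
  have "(\<integral>z. f_coeff N (c(int N := y, - int N := z)) - f_coeff (N - 1) c \<partial>\<eta>)
     = Re (P1 * y) + 4 * U * (cmod y)\<^sup>2 + 4 * m2 * V + 2 * real N * ((cmod y) ^ 4 - m4)" for y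
  proof -
    have "(\<integral>z. f_coeff N (c(int N := y, - int N := z)) - f_coeff (N - 1) c \<partial>\<eta>)
       = (\<integral>z. (Re (P1 * y) + 4 * U * (cmod y)\<^sup>2 + 2 * real N * (cmod y) ^ 4) + Re (P2 * z)
           + Re ((y * P3) * cnj z) + 4 * V * (cmod z)\<^sup>2 - 2 * real N * (cmod z) ^ 4 \<partial>\<eta>)"
      unfolding D by (intro Bochner_Integration.integral_cong refl) (simp only: mult_ac right_diff_distrib; simp)
    also have "\<dots> = (Re (P1 * y) + 4 * U * (cmod y)\<^sup>2 + 2 * real N * (cmod y) ^ 4) + 4 * V * m2 - 2 * real N * m4"
      using int integral_Re_mult by (simp add: prob_space m2_def m4_def del: times_complex.sel)
    finally show ?thesis by (simp add: right_diff_distrib)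
  qed
  then have "(\<integral>y. (\<integral>z. f_coeff N (c(int N := y, - int N := z)) - f_coeff (N - 1) c \<partial>\<eta>) \<partial>\<eta>)
     = (\<integral>y. Re (P1 * y) + 4 * U * (cmod y)\<^sup>2 + 2 * real N * (cmod y) ^ 4 + (4 * m2 * V - 2 * real N * m4) \<partial>\<eta>)"
    by (simp add: right_diff_distrib add_ac diff_add_eq add_diff_eq)
  also have "\<dots> = 4 * U * m2 + 2 * real N * m4 + (4 * m2 * V - 2 * real N * m4)"
    using int integral_Re_mult by (simp add: prob_space m2_def m4_def del: times_complex.sel)
  also have "\<dots> = 4 * m2 * (U + V)" by (simp add: algebra_simps)
  finally have mean: "\<bar>\<integral>y. (\<integral>z. f_coeff N (c(int N := y, - int N := z)) - f_coeff (N - 1) c \<partial>\<eta>) \<partial>\<eta>\<bar>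
     = 4 * \<bar>m2\<bar> * \<bar>U + V\<bar>" by (simp add: abs_mult)
  have "\<bar>m2\<bar> \<le> \<rho>\<^sup>2"
    unfolding m2_def by (rule abs_integral_le, use bounded in eventually_elim) (auto intro: power_mono)
  then have "4 * \<bar>m2\<bar> * \<bar>U + V\<bar> \<le> 4 * \<rho>\<^sup>2 * (2 * (L * real N powr (1 / 16)) * S)"
    using UV by (intro mult_mono) auto
  also have "\<dots> = 264 * (L ^ 4 * ((real N powr (- 15 / 16))\<^sup>2 * (real N powr (1 / 16))\<^sup>2))"
    by (simp add: \<rho>_def S_def power2_eq_square power4_eq_xxxx)
  also have "\<dots> \<le> 200000 * (L ^ 6 * real N powr (- 13 / 8))"
    using increment_powr_bounds(2)[OF a(2)] a L4 by (intro mult_mono) auto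
  finally show "\<bar>\<integral>y. (\<integral>z. f_coeff N (c(int N := y, - int N := z)) - f_coeff (N - 1) c \<partial>\<eta>) \<partial>\<eta>\<bar>
      \<le> 200000 * L ^ 6 * real N powr (- 13 / 8)"
    unfolding mean by simp
qed (auto simp: measurable_f_coeff f_coeff_trunc)

text \<open>Cube s + t with s = |v|^2 and t = |v + w|^2 - |v|^2. The part of t that is linear in w
  yields the linear term; 23 = 3 + 12 + 8 collects the bounds of 3 s^2 |w|^2, 3 s t^2 and
  t^3.\<close>

lemma sixth_power_expansion:
  fixes v w :: complex
  shows "\<bar>(cmod (v + w)) ^ 6 - (cmod v) ^ 6 - 6 * (cmod v) ^ 4 * Re (cnj v * w)\<bar>
    \<le> 23 * (cmod w)\<^sup>2 * (cmod v + cmod w) ^ 4"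
proof -
  define m where "m = cmod v + cmod w"
  define s where "s = (cmod v)\<^sup>2"
  define t where "t = 2 * Re (cnj v * w) + (cmod w)\<^sup>2"
  have st: "(cmod (v + w))\<^sup>2 = s + t"
    unfolding s_def t_def cmod_power2 by (simp add: power2_eq_square algebra_simps)
  have 6: "x ^ 6 = (x\<^sup>2) ^ 3" and 4: "x ^ 4 = (x\<^sup>2)\<^sup>2" for x :: real by (simp_all flip: power_mult)
  have m: "0 \<le> cmod w" "cmod w \<le> m" "cmod v \<le> m" "0 \<le> m" by (simp_all add: m_def)
  have t: "\<bar>t\<bar> \<le> 2 * cmod w * m"
  proof -
    have "\<bar>Re (cnj v * w)\<bar> \<le> cmod v * cmod w"
      using abs_Re_le_cmod[of "cnj v * w"] by (simp add: norm_mult)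
    then have "\<bar>t\<bar> \<le> 2 * (cmod v * cmod w) + (cmod w)\<^sup>2" using zero_le_power2[of "cmod w"] unfolding t_def by linarith
    also have "\<dots> \<le> 2 * cmod w * m"
      by (simp add: m_def power2_eq_square algebra_simps)
    finally show ?thesis .
  qed
  have t2: "t\<^sup>2 \<le> 4 * (cmod w)\<^sup>2 * m\<^sup>2"
    using power_mono[OF t, of 2] by (simp add: power_mult_distrib)
  have t3: "\<bar>t\<bar> \<le> 2 * m\<^sup>2"
    using t mult_right_mono[OF m(2,4)] by (simp add: power2_eq_square)
  have s: "0 \<le> s" "s \<le> m\<^sup>2" using m by (auto simp: s_def intro: power_mono)
  have "(cmod (v + w)) ^ 6 - (cmod v) ^ 6 - 6 * (cmod v) ^ 4 * Re (cnj v * w)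
      = 3 * s\<^sup>2 * (cmod w)\<^sup>2 + 3 * (s * t\<^sup>2) + t\<^sup>2 * t"
    unfolding 6 4 st s_def[symmetric] using t_def
    by (simp add: power2_eq_square power3_eq_cube algebra_simps)
  also have "\<bar>\<dots>\<bar> \<le> 3 * (s\<^sup>2 * (cmod w)\<^sup>2) + 3 * (s * t\<^sup>2) + t\<^sup>2 * \<bar>t\<bar>"
    using s by (intro order.trans[OF abs_triangle_ineq] add_mono) (auto simp: abs_mult)
  also have "\<dots> \<le> 3 * ((m\<^sup>2)\<^sup>2 * (cmod w)\<^sup>2) + 3 * (m\<^sup>2 * (4 * (cmod w)\<^sup>2 * m\<^sup>2)) + (4 * (cmod w)\<^sup>2 * m\<^sup>2) * (2 * m\<^sup>2)"
    using s t2 t3 by (intro add_mono mult_left_mono mult_mono power_mono) auto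
  also have "\<dots> = 23 * (cmod w)\<^sup>2 * m ^ 4"
    by (simp add: power2_eq_square power4_eq_xxxx algebra_simps)
  finally show ?thesis by (simp add: m_def)
qed

lemma continuous_proj [continuous_intros]: "continuous_on A (proj N c)"
  unfolding proj_def by (intro continuous_intros)

lemma cmod_proj_le: "cmod (proj N c x) \<le> (\<Sum>n\<in>{- int N..int N}. cmod (c n))"
  unfolding proj_def by (rule order.trans[OF norm_sum]) (simp add: norm_mult)

text \<open>Taylor expansion to first order under the integral, with w the sum of the two new modes.
  P1 and P2 are Fourier coefficients of 6 |v|^4 cnj v. The constant is 7452 = 23 \<cdot> 2^2 \<cdot>
  3^4, from |w| \<le> 2 \<rho> and |v| + |w| \<le> 3 S.\<close>

lemma sextic_increment:
  assumes L: "1 \<le> L" and N: "1 \<le> N" and c: "\<And>n. cmod (c n) \<le> radius L n"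
  defines "\<rho> \<equiv> L * real N powr (- 15 / 16)" and "S \<equiv> 33 * L * real N powr (1 / 16)"
  obtains P1 P2 where
    "cmod P1 \<le> 6 * S ^ 5" "cmod P2 \<le> 6 * S ^ 5"
    "\<And>y z. cmod y \<le> \<rho> \<Longrightarrow> cmod z \<le> \<rho> \<Longrightarrow>
       \<bar>sextic N (c(int N := y, - int N := z)) - sextic (N - 1) c - Re (P1 * y) - Re (P2 * z)\<bar>
         \<le> 7452 * \<rho>\<^sup>2 * S ^ 4"
proof -
  let ?e = "\<lambda>n x. exp (\<i> * of_int n * complex_of_real x)"
  define v where "v = proj (N - 1) c"
  define P where "P s = torus_integral (\<lambda>x. 6 * of_real ((cmod (v x)) ^ 4) * cnj (v x) * ?e s x)" for s
  have cont [continuous_intros]: "continuous_on A v" for A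
    unfolding v_def by (rule continuous_proj)
  have S: "0 \<le> S" "\<rho> \<le> S"
    using L N new_radius_le_sum_bound[of L N] by (simp_all add: S_def \<rho>_def)
  have vS: "cmod (v x) \<le> S" for x
  proof -
    have "cmod (v x) \<le> (\<Sum>n\<in>{- int (N - 1)..int (N - 1)}. cmod (c n))"
      unfolding v_def by (rule cmod_proj_le)
    also have "\<dots> \<le> (\<Sum>n\<in>{- int N..int N}. radius L n)"
      using c L by (intro order.trans[OF sum_mono sum_mono2]) (auto simp: radius_nonneg)
    also have "\<dots> \<le> S" unfolding S_def using L N by (intro sum_radius_le) auto
    finally show ?thesis .
  qed
  have PS: "cmod (P s) \<le> 6 * S ^ 5" for s
    unfolding P_def
  proof (rule norm_torus_integral_le)
    fix x
    have "norm (6 * of_real ((cmod (v x)) ^ 4) * cnj (v x) * ?e s x) = 6 * (cmod (v x)) ^ 5"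
      by (simp add: norm_mult norm_power power_Suc2[symmetric] eval_nat_numeral)
    also have "\<dots> \<le> 6 * S ^ 5" using vS[of x] by (intro mult_left_mono power_mono) auto
    finally show "norm (6 * of_real ((cmod (v x)) ^ 4) * cnj (v x) * ?e s x) \<le> 6 * S ^ 5" .
  qed (intro continuous_intros)
  show ?thesis
  proof (rule that)
    show "cmod (P (int N)) \<le> 6 * S ^ 5" "cmod (P (- int N)) \<le> 6 * S ^ 5" by (rule PS)+
    fix y z assume yz: "cmod y \<le> \<rho>" "cmod z \<le> \<rho>"
    let ?c = "c(int N := y, - int N := z)"
    define w where "w x = y * ?e (int N) x + z * ?e (- int N) x" for x
    have cw [continuous_intros]: "continuous_on A w" for A
      unfolding w_def by (intro continuous_intros)
    have vw: "proj N ?c x = v x + w x" for x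
    proof -
      obtain M where M: "N = Suc M" using N by (cases N) auto
      have "(\<Sum>n\<in>{1..M}. ?c (int n) * ?e (int n) x + ?c (- int n) * ?e (- int n) x)
         = (\<Sum>n\<in>{1..M}. c (int n) * ?e (int n) x + c (- int n) * ?e (- int n) x)"
        using M by (intro sum.cong) auto
      then show ?thesis
        unfolding proj_def v_def w_def sum_int_interval using M by (auto simp: algebra_simps)
    qed
    have w: "cmod (w x) \<le> 2 * \<rho>" for x
    proof -
      have "cmod (w x) \<le> cmod y + cmod z"
        unfolding w_def by (rule order.trans[OF norm_triangle_ineq]) (simp add: norm_mult)
      then show ?thesis using yz by simp
    qed
    have "sextic N ?c - sextic (N - 1) c - Re (P (int N) * y) - Re (P (- int N) * z)
       = torus_integral (\<lambda>x. (cmod (v x + w x)) ^ 6 - (cmod (v x)) ^ 6 - 6 * (cmod (v x)) ^ 4 * Re (cnj (v x) * w x))"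
    proof -
      have "Re (P (int N) * y) + Re (P (- int N) * z) = Re (y * P (int N) + z * P (- int N))"
        by (simp add: algebra_simps)
      also have "y * P (int N) + z * P (- int N)
         = torus_integral (\<lambda>x. y * (6 * of_real ((cmod (v x)) ^ 4) * cnj (v x) * ?e (int N) x)
              + z * (6 * of_real ((cmod (v x)) ^ 4) * cnj (v x) * ?e (- int N) x))"
        unfolding P_def torus_integral_mult_left[symmetric]
        by (intro torus_integral_add[symmetric] continuous_intros)
      also have "Re \<dots> = torus_integral (\<lambda>x. Re (y * (6 * of_real ((cmod (v x)) ^ 4) * cnj (v x) * ?e (int N) x)
              + z * (6 * of_real ((cmod (v x)) ^ 4) * cnj (v x) * ?e (- int N) x)))"
        by (intro torus_integral_Re[symmetric] continuous_intros)
      also have "\<dots> = torus_integral (\<lambda>x. 6 * (cmod (v x)) ^ 4 * Re (cnj (v x) * w x))"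
      proof -
        have "y * (6 * of_real ((cmod (v x)) ^ 4) * cnj (v x) * ?e (int N) x)
              + z * (6 * of_real ((cmod (v x)) ^ 4) * cnj (v x) * ?e (- int N) x)
           = of_real (6 * (cmod (v x)) ^ 4) * (cnj (v x) * w x)" for x
          by (simp add: w_def algebra_simps)
        moreover have "Re (of_real r * t) = r * Re t" for r t by simp
        ultimately show ?thesis by (simp only:)
      qed
      finally have lin: "Re (P (int N) * y) + Re (P (- int N) * z)
         = torus_integral (\<lambda>x. 6 * (cmod (v x)) ^ 4 * Re (cnj (v x) * w x))" .
      have "torus_integral (\<lambda>x. ((cmod (v x + w x)) ^ 6 - (cmod (v x)) ^ 6) - 6 * (cmod (v x)) ^ 4 * Re (cnj (v x) * w x))
         = torus_integral (\<lambda>x. (cmod (v x + w x)) ^ 6) - torus_integral (\<lambda>x. (cmod (v x)) ^ 6)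
           - torus_integral (\<lambda>x. 6 * (cmod (v x)) ^ 4 * Re (cnj (v x) * w x))"
        by (subst torus_integral_diff torus_integral_diff, (intro continuous_intros)+)+ simp
      then show ?thesis using lin by (simp add: sextic_def vw v_def)
    qed
    also have "\<bar>\<dots>\<bar> \<le> 7452 * \<rho>\<^sup>2 * S ^ 4"
    proof (rule norm_torus_integral_le[where 'b = real, simplified real_norm_def])
      fix x
      have "\<bar>(cmod (v x + w x)) ^ 6 - (cmod (v x)) ^ 6 - 6 * (cmod (v x)) ^ 4 * Re (cnj (v x) * w x)\<bar>
          \<le> 23 * (cmod (w x))\<^sup>2 * (cmod (v x) + cmod (w x)) ^ 4"
        by (rule sixth_power_expansion)
      also have "\<dots> \<le> 23 * (2 * \<rho>)\<^sup>2 * (3 * S) ^ 4"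
        using w[of x] vS[of x] S by (intro mult_mono power_mono) auto
      finally show "\<bar>(cmod (v x + w x)) ^ 6 - (cmod (v x)) ^ 6 - 6 * (cmod (v x)) ^ 4 * Re (cnj (v x) * w x)\<bar>
          \<le> 7452 * \<rho>\<^sup>2 * S ^ 4" by (simp add: power_mult_distrib)
    qed (intro continuous_intros)
    finally show "\<bar>sextic N ?c - sextic (N - 1) c - Re (P (int N) * y) - Re (P (- int N) * z)\<bar>
         \<le> 7452 * \<rho>\<^sup>2 * S ^ 4" .
  qed
qed

text \<open>The linear terms determine the size N^(-5/8) of the increment but have mean zero, so the
  mean is governed by the quadratic remainder, of size N^(-13/8).\<close>

lemma increment_bounds_sextic: "increment_bounds sextic (10 ^ 12)"
proof
  fix L :: real and N :: nat and c \<eta>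
  assume a: "1 \<le> L" "1 \<le> N" "\<And>n. cmod (c n) \<le> radius L n"
  define \<rho> where "\<rho> = L * real N powr (- 15 / 16)"
  define S where "S = 33 * L * real N powr (1 / 16)"
  obtain P1 P2 where P: "cmod P1 \<le> 6 * S ^ 5" "cmod P2 \<le> 6 * S ^ 5"
    and E: "\<And>y z. cmod y \<le> \<rho> \<Longrightarrow> cmod z \<le> \<rho> \<Longrightarrow>
       \<bar>sextic N (c(int N := y, - int N := z)) - sextic (N - 1) c - Re (P1 * y) - Re (P2 * z)\<bar>
         \<le> 7452 * \<rho>\<^sup>2 * S ^ 4"
    using sextic_increment[OF a] unfolding \<rho>_def S_def by metis
  have \<rho>0: "0 \<le> \<rho>" using a by (simp add: \<rho>_def)
  have S0: "0 \<le> S" using a by (simp add: S_def)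
  have r: "radius L (int N) \<le> \<rho>" "radius L (- int N) \<le> \<rho>"
    unfolding \<rho>_def using a radius_int_le[of L N] by auto
  have \<rho>S: "\<rho> \<le> S"
    unfolding \<rho>_def S_def using a by (intro new_radius_le_sum_bound) auto
  \<comment> \<open>7464 = 7452 + 6 + 6: the remainder and the two linear terms, all compared with
    \<rho> S^5. S^5 contributes 33^5, and 7464 \<cdot> 33^5 is below 3 \<cdot> 10^11.\<close>
  have B5: "7464 * (\<rho> * S ^ 5) \<le> 10 ^ 12 * L ^ 6 * real N powr (- 5 / 8)"
  proof -
    have "\<rho> * S ^ 5 = 33 ^ 5 * (L ^ 6 * (real N powr (- 15 / 16) * (real N powr (1 / 16)) ^ 5))"
      by (simp add: \<rho>_def S_def power_mult_distrib eval_nat_numeral)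
    also have "\<dots> \<le> 33 ^ 5 * (L ^ 6 * real N powr (- 5 / 8))"
      using increment_powr_bounds(5)[OF a(2)] a by (intro mult_left_mono) auto
    finally have "7464 * (\<rho> * S ^ 5) \<le> 7464 * 33 ^ 5 * (L ^ 6 * real N powr (- 5 / 8))" by simp
    also have "\<dots> \<le> 10 ^ 12 * (L ^ 6 * real N powr (- 5 / 8))" using a by (intro mult_right_mono) auto
    finally show ?thesis by simp
  qed
  have B4: "7452 * \<rho>\<^sup>2 * S ^ 4 \<le> 10 ^ 12 * L ^ 6 * real N powr (- 13 / 8)"
  proof -
    have "\<rho>\<^sup>2 * S ^ 4 = 33 ^ 4 * (L ^ 6 * ((real N powr (- 15 / 16))\<^sup>2 * (real N powr (1 / 16)) ^ 4))"
      by (simp add: \<rho>_def S_def power_mult_distrib eval_nat_numeral)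
    also have "\<dots> \<le> 33 ^ 4 * (L ^ 6 * real N powr (- 13 / 8))"
      using increment_powr_bounds(6)[OF a(2)] a by (intro mult_left_mono) auto
    finally have "7452 * (\<rho>\<^sup>2 * S ^ 4) \<le> 7452 * 33 ^ 4 * (L ^ 6 * real N powr (- 13 / 8))" by simp
    also have "\<dots> \<le> 10 ^ 12 * (L ^ 6 * real N powr (- 13 / 8))" using a by (intro mult_right_mono) auto
    finally show ?thesis by simp
  qed
  have lin: "\<bar>Re (Q * y)\<bar> \<le> 6 * (\<rho> * S ^ 5)" if "cmod y \<le> \<rho>" "cmod Q \<le> 6 * S ^ 5" for Q y
  proof -
    have "\<bar>Re (Q * y)\<bar> \<le> cmod Q * cmod y" using abs_Re_le_cmod[of "Q * y"] by (simp add: norm_mult)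
    also have "\<dots> \<le> (6 * S ^ 5) * \<rho>" using that \<rho>0 S0 by (intro mult_mono) auto
    finally show ?thesis by (simp add: mult_ac)
  qed
  have \<rho>S5: "\<rho>\<^sup>2 * S ^ 4 \<le> \<rho> * S ^ 5"
  proof -
    have "\<rho> * (\<rho> * S ^ 4) \<le> \<rho> * (S * S ^ 4)" using \<rho>0 S0 \<rho>S by (intro mult_left_mono mult_right_mono) auto
    then show ?thesis by (simp add: power2_eq_square mult.assoc flip: power_Suc)
  qed
  show "\<bar>sextic N c - sextic (N - 1) c\<bar> \<le> 10 ^ 12 * L ^ 6 * real N powr (- 5 / 8)"
  proof -
    have yz: "cmod (c (int N)) \<le> \<rho>" "cmod (c (- int N)) \<le> \<rho>"
      using a(3)[of "int N"] a(3)[of "- int N"] r by auto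
    have "\<bar>sextic N c - sextic (N - 1) c - Re (P1 * c (int N)) - Re (P2 * c (- int N))\<bar> \<le> 7452 * \<rho>\<^sup>2 * S ^ 4"
      using E[OF yz] by simp
    then show ?thesis using lin[OF yz(1) P(1)] lin[OF yz(2) P(2)] \<rho>S5 B5 by linarith
  qed
  assume b: "prob_space \<eta>" "sets \<eta> = sets borel" "AE z in \<eta>. cmod z \<le> radius L (int N)"
    "(\<integral>z. z \<partial>\<eta>) = 0"
  interpret prob_space \<eta> by fact
  interpret bounded_centred_law \<eta> \<rho>
    by unfold_locales (use b r in auto)
  define R where "R y z = sextic N (c(int N := y, - int N := z)) - sextic (N - 1) c - Re (P1 * y) - Re (P2 * z)" for y z
  have [measurable]: "(\<lambda>(y, z). R y z) \<in> borel_measurable (borel \<Otimes>\<^sub>M borel)"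
  proof -
    have "(\<lambda>p. c(int N := fst p, - int N := snd p)) \<in> measurable (borel \<Otimes>\<^sub>M borel) (PiM UNIV (\<lambda>_. borel))"
      by (rule measurable_PiM_single') (auto simp: fun_upd_def)
    then have [measurable]: "(\<lambda>p. sextic N (c(int N := fst p, - int N := snd p))) \<in> borel_measurable (borel \<Otimes>\<^sub>M borel)"
      by (rule measurable_compose[OF _ measurable_sextic])
    show ?thesis unfolding R_def split_beta' by measurable
  qed
  have [measurable]: "R y \<in> borel_measurable borel" for y by measurable
  have meas: "(\<lambda>y. \<integral>z. R y z \<partial>\<eta>) \<in> borel_measurable borel"
    by measurable
  have bd: "AE z in \<eta>. \<bar>R y z\<bar> \<le> 7452 * \<rho>\<^sup>2 * S ^ 4" if "cmod y \<le> \<rho>" for y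
    using bounded by eventually_elim (unfold R_def, rule E[OF that])
  have intR: "integrable \<eta> (R y)" if "cmod y \<le> \<rho>" for y
    using bd[OF that] by (intro integrable_const_bound[of _ "7452 * \<rho>\<^sup>2 * S ^ 4"]) auto
  have R_le: "\<bar>\<integral>z. R y z \<partial>\<eta>\<bar> \<le> 7452 * \<rho>\<^sup>2 * S ^ 4" if "cmod y \<le> \<rho>" for y
    using bd[OF that] S0 by (intro abs_integral_le) auto
  have intR2: "integrable \<eta> (\<lambda>y. \<integral>z. R y z \<partial>\<eta>)"
    using bounded meas R_le by (intro integrable_const_bound[of _ "7452 * \<rho>\<^sup>2 * S ^ 4"]) auto
  have "(\<integral>y. (\<integral>z. sextic N (c(int N := y, - int N := z)) - sextic (N - 1) c \<partial>\<eta>) \<partial>\<eta>)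
      = (\<integral>y. Re (P1 * y) + (\<integral>z. R y z \<partial>\<eta>) \<partial>\<eta>)"
  proof (rule integral_cong_AE)
    show "AE y in \<eta>. (\<integral>z. sextic N (c(int N := y, - int N := z)) - sextic (N - 1) c \<partial>\<eta>)
        = Re (P1 * y) + (\<integral>z. R y z \<partial>\<eta>)"
      using bounded
    proof eventually_elim
      case (elim y)
      have "(\<integral>z. sextic N (c(int N := y, - int N := z)) - sextic (N - 1) c \<partial>\<eta>)
         = (\<integral>z. Re (P1 * y) + Re (P2 * z) + R y z \<partial>\<eta>)"
        by (simp add: R_def)
      also have "\<dots> = Re (P1 * y) + (\<integral>z. R y z \<partial>\<eta>)"
        using intR[OF elim] integrable_Re_mult integral_Re_mult by (simp add: prob_space del: times_complex.sel)
      finally show ?case .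
    qed
    have "(\<lambda>y. \<integral>z. sextic N (c(int N := y, - int N := z)) - sextic (N - 1) c \<partial>\<eta>)
       = (\<lambda>y. \<integral>z. R y z + Re (P1 * y) + Re (P2 * z) \<partial>\<eta>)" by (simp add: R_def)
    also have "\<dots> \<in> borel_measurable \<eta>" by measurable
    finally show "(\<lambda>y. \<integral>z. sextic N (c(int N := y, - int N := z)) - sextic (N - 1) c \<partial>\<eta>) \<in> borel_measurable \<eta>" .
  qed (use meas in measurable)
  also have "\<dots> = (\<integral>y. (\<integral>z. R y z \<partial>\<eta>) \<partial>\<eta>)"
    using intR2 integrable_Re_mult integral_Re_mult by (simp del: times_complex.sel)
  also have "\<bar>\<dots>\<bar> \<le> 7452 * \<rho>\<^sup>2 * S ^ 4"
    using bounded R_le S0 by (intro abs_integral_le) auto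
  finally show "\<bar>\<integral>y. (\<integral>z. sextic N (c(int N := y, - int N := z)) - sextic (N - 1) c \<partial>\<eta>) \<partial>\<eta>\<bar>
      \<le> 10 ^ 12 * L ^ 6 * real N powr (- 13 / 8)"
    using B4 by simp
qed (auto simp: measurable_sextic sextic_trunc)

section \<open>Gaussian coefficients\<close>

lemma (in prob_space) chernoff_bound:
  assumes [measurable]: "Y \<in> borel_measurable M"
    and B0: "0 \<le> B" and B: "(\<integral>\<^sup>+\<omega>. ennreal (exp (Y \<omega>)) \<partial>M) \<le> ennreal B"
  shows "prob {\<omega> \<in> space M. Y \<omega> > t} \<le> B * exp (- t)"
proof -
  let ?A = "{\<omega> \<in> space M. Y \<omega> > t}"
  have "ennreal (exp t * prob ?A) = (\<integral>\<^sup>+\<omega>. ennreal (exp t) * indicator ?A \<omega> \<partial>M)"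
    by (subst nn_integral_cmult_indicator) (auto simp: emeasure_eq_measure ennreal_mult)
  also have "\<dots> \<le> (\<integral>\<^sup>+\<omega>. ennreal (exp (Y \<omega>)) \<partial>M)"
    by (intro nn_integral_mono) (auto simp: indicator_def intro!: ennreal_leI)
  also note B
  finally have le: "ennreal (exp t * prob ?A) \<le> ennreal B" .
  have "exp t * prob ?A \<le> B"
    using le B0 by (simp add: ennreal_le_iff)
  then have "exp (- t) * (exp t * prob ?A) \<le> exp (- t) * B"
    by (intro mult_left_mono) auto
  then show ?thesis by (simp add: mult.assoc[symmetric] exp_add[symmetric] mult.commute[of B])
qed

text \<open>
  The exponent 72 comes from \<open>increment_tail_clipped\<close>: with \<open>L = j\<close> and \<open>\<theta> = K j\<^sup>3\<close> the exponential moment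
  is governed by \<open>\<theta>\<^sup>2 L\<^bsup>12\<^esup> M\<^bsup>-1/4\<^esup>\<close>, which stays bounded once \<open>M \<ge> j\<^bsup>72\<^esup>\<close>.
\<close>

lemma convergent_blocks:
  fixes h :: "nat \<Rightarrow> real"
  assumes "eventually (\<lambda>j. \<forall>N\<in>{j ^ 72..Suc j ^ 72}. \<bar>h N - h (j ^ 72)\<bar> \<le> 1 / (real j)\<^sup>2) sequentially"
  shows "convergent h"
proof -
  obtain j1 where j1: "\<And>j N. j1 \<le> j \<Longrightarrow> N \<in> {j ^ 72..Suc j ^ 72} \<Longrightarrow> \<bar>h N - h (j ^ 72)\<bar> \<le> 1 / (real j)\<^sup>2"
    using assms unfolding eventually_sequentially by blast
  define a where "a j = h (j ^ 72)" for j
  \<comment> \<open>The blocks are closed and share their endpoints, so the hypothesis at N = (j +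
    1)^72 compares consecutive endpoint values.\<close>
  have "summable (\<lambda>j. a (Suc j) - a j)"
  proof (rule summable_comparison_test_ev)
    show "eventually (\<lambda>j. norm (a (Suc j) - a j) \<le> 1 / (real j)\<^sup>2) sequentially"
      using eventually_ge_at_top[of j1]
    proof eventually_elim
      case (elim j)
      have "j ^ 72 \<le> Suc j ^ 72" by (intro power_mono) auto
      then show ?case using j1[OF elim, of "Suc j ^ 72"] by (simp add: a_def)
    qed
    show "summable (\<lambda>j. 1 / (real j)\<^sup>2)"
      using inverse_power_summable[of 2, where 'a = real] by (simp add: inverse_eq_divide)
  qed
  then have "convergent (\<lambda>n. a n - a 0)"
    unfolding summable_iff_convergent sum_lessThan_telescope .
  then have "convergent (\<lambda>n. (a n - a 0) + a 0)"
    by (intro convergent_add convergent_const)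
  then obtain l where l: "a \<longlonglongrightarrow> l" by (auto simp: convergent_def)
  have "h \<longlonglongrightarrow> l"
  proof (rule LIMSEQ_I)
    fix \<epsilon> :: real assume \<epsilon>: "0 < \<epsilon>"
    have "(\<lambda>j. 1 / (real j)\<^sup>2) \<longlonglongrightarrow> 0" by real_asymp
    then have "eventually (\<lambda>j. 1 / (real j)\<^sup>2 < \<epsilon> / 2) sequentially"
      using \<epsilon> by (intro order_tendstoD) auto
    moreover have "eventually (\<lambda>j. dist (a j) l < \<epsilon> / 2) sequentially"
      using l \<epsilon> by (intro tendstoD) auto
    ultimately have "eventually (\<lambda>j. 1 / (real j)\<^sup>2 < \<epsilon> / 2 \<and> dist (a j) l < \<epsilon> / 2 \<and> j1 \<le> j) sequentially"
      using eventually_ge_at_top[of j1] by eventually_elim auto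
    then obtain J where J: "\<And>j. J \<le> j \<Longrightarrow> 1 / (real j)\<^sup>2 < \<epsilon> / 2 \<and> dist (a j) l < \<epsilon> / 2 \<and> j1 \<le> j"
      by (auto simp: eventually_sequentially)
    show "\<exists>no. \<forall>N\<ge>no. norm (h N - l) < \<epsilon>"
    proof (intro exI allI impI)
      fix N assume N: "J ^ 72 \<le> N"
      \<comment> \<open>k is the first index with N < k^72; N \<ge> J^72 forces k > J, so N lies in
        the block of j = k - 1 \<ge> J.\<close>
      define k where "k = (LEAST k. N < k ^ 72)"
      have "N < (Suc N) ^ 72" using self_le_power[of "Suc N" 72] by simp
      then have k: "N < k ^ 72" unfolding k_def by (rule LeastI)
      have "\<not> k \<le> J"
      proof
        assume "k \<le> J"
        then have "k ^ 72 \<le> J ^ 72" by (intro power_mono) auto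
        then show False using N k by linarith
      qed
      then obtain j where j: "k = Suc j" "J \<le> j" by (cases k) auto
      have "\<not> N < j ^ 72" using not_less_Least[of j "\<lambda>k. N < k ^ 72"] j by (simp add: k_def)
      then have "N \<in> {j ^ 72..Suc j ^ 72}" using k j by auto
      then have "\<bar>h N - a j\<bar> < \<epsilon> / 2" using j1[of j N] J[OF j(2)] by (simp add: a_def)
      moreover have "\<bar>a j - l\<bar> < \<epsilon> / 2" using J[OF j(2)] by (simp add: dist_real_def)
      ultimately show "norm (h N - l) < \<epsilon>" unfolding real_norm_def by linarith
    qed
  qed
  then show ?thesis by (rule convergentI)
qed

text \<open>What is used of complex Gaussians besides independence: symmetry centres the clipped
  laws, and the exponential moment yields every tail bound. For a normalised complex Gaussian |z|^2
  is exponential with mean 1, so the moment equals 1 / (1 - 1/2) = 2.\<close>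

locale gauss_coeffs = prob_space P for P :: "'o measure" +
  fixes g :: "int \<Rightarrow> 'o \<Rightarrow> complex" and \<Gamma> :: "complex measure"
  assumes indep: "indep_vars (\<lambda>_. borel) g UNIV"
    and law: "distr P borel (g n) = \<Gamma>"
    and symmetric: "distr \<Gamma> borel uminus = \<Gamma>"
    and exp_moment: "(\<integral>\<^sup>+z. ennreal (exp ((cmod z)\<^sup>2 / 2)) \<partial>\<Gamma>) \<le> 2"
begin

definition X :: "'o \<Rightarrow> int \<Rightarrow> complex" where
  "X \<omega> n = g n \<omega> / of_real (jbracket n)"

lemma measurable_g [measurable]: "g n \<in> borel_measurable P"
  using indep by (auto simp: indep_vars_def)

lemma measurable_X [measurable]: "(\<lambda>\<omega>. X \<omega> n) \<in> borel_measurable P"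
  unfolding X_def by measurable

lemma prob_space_law: "prob_space \<Gamma>"
  unfolding law[of 0, symmetric] by (rule prob_space_distr) simp

lemma sets_law: "sets \<Gamma> = sets borel"
  unfolding law[of 0, symmetric] by simp

lemma joint_law:
  assumes "J \<noteq> {}"
  shows "distr P (PiM J (\<lambda>_. borel)) (\<lambda>\<omega>. \<lambda>i\<in>J. g i \<omega>) = PiM J (\<lambda>_. \<Gamma>)"
proof -
  have "indep_vars (\<lambda>_. borel) g J" using indep by (rule indep_vars_subset) auto
  moreover have "indep_vars (\<lambda>_. borel) g J \<longleftrightarrow>
      distr P (PiM J (\<lambda>_. borel)) (\<lambda>\<omega>. \<lambda>i\<in>J. g i \<omega>) = PiM J (\<lambda>i. distr P borel (g i))"
    by (rule indep_vars_iff_distr_eq_PiM) (use assms in auto)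
  ultimately show ?thesis by (simp add: law)
qed

text \<open>Convexity of exp interpolates between the exponents 0 and |z|^2 / 2: the moment is at
  most (1 - w) + 2 w = 1 + w \<le> exp w.\<close>

lemma weighted_exp_moment:
  assumes "0 \<le> w" "w \<le> 1"
  shows "(\<integral>\<^sup>+\<omega>. ennreal (exp (w * ((cmod (g n \<omega>))\<^sup>2 / 2))) \<partial>P) \<le> ennreal (exp w)"
proof -
  interpret \<Gamma>: prob_space \<Gamma> by (rule prob_space_law)
  note sets_law[measurable_cong]
  have pt: "exp (w * y) \<le> (1 - w) + w * exp y" for y :: real
    using convex_onD[OF exp_convex, of w 0 y] assms by simp
  have "(\<integral>\<^sup>+\<omega>. ennreal (exp (w * ((cmod (g n \<omega>))\<^sup>2 / 2))) \<partial>P)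
     = (\<integral>\<^sup>+z. ennreal (exp (w * ((cmod z)\<^sup>2 / 2))) \<partial>\<Gamma>)"
    unfolding law[of n, symmetric] by (subst nn_integral_distr) auto
  also have "\<dots> \<le> (\<integral>\<^sup>+z. ennreal (1 - w) + ennreal w * ennreal (exp ((cmod z)\<^sup>2 / 2)) \<partial>\<Gamma>)"
  proof (rule nn_integral_mono)
    fix z :: complex
    have "ennreal (1 - w) + ennreal w * ennreal (exp ((cmod z)\<^sup>2 / 2)) = ennreal ((1 - w) + w * exp ((cmod z)\<^sup>2 / 2))"
      using assms by (simp add: ennreal_mult)
    then show "ennreal (exp (w * ((cmod z)\<^sup>2 / 2))) \<le> ennreal (1 - w) + ennreal w * ennreal (exp ((cmod z)\<^sup>2 / 2))"
      using pt[of "(cmod z)\<^sup>2 / 2"] by (simp only: ennreal_leI)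
  qed
  also have "\<dots> = ennreal (1 - w) + ennreal w * (\<integral>\<^sup>+z. ennreal (exp ((cmod z)\<^sup>2 / 2)) \<partial>\<Gamma>)"
    by (subst nn_integral_add) (auto simp: nn_integral_cmult \<Gamma>.emeasure_space_1)
  also have "\<dots> \<le> ennreal (1 - w) + ennreal w * 2"
    using exp_moment by (intro add_left_mono mult_left_mono) auto
  also have "\<dots> = ennreal (1 + w)"
  proof -
    have "(2 :: ennreal) = ennreal 2" by simp
    then have "ennreal w * 2 = ennreal (w * 2)" using assms by (simp only: ennreal_mult)
    then show ?thesis using assms by (simp add: ennreal_plus[symmetric] del: ennreal_plus)
  qed
  also have "\<dots> \<le> ennreal (exp w)" using exp_ge_add_one_self[of w] by (intro ennreal_leI) simp
  finally show ?thesis .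
qed

text \<open>Independence and the Chernoff bound. Weights allow one statement to serve a single
  coefficient, the low frequencies (weight 1) and the high ones (weight j / <n>).\<close>

lemma weighted_sum_tail:
  assumes J: "finite J" and w: "\<And>n. n \<in> J \<Longrightarrow> 0 \<le> w n \<and> w n \<le> 1"
  shows "prob {\<omega> \<in> space P. (\<Sum>n\<in>J. w n * (cmod (g n \<omega>))\<^sup>2) > t} \<le> exp ((\<Sum>n\<in>J. w n) - t / 2)"
proof -
  have iv: "indep_vars (\<lambda>_. borel) (\<lambda>n \<omega>. ennreal (exp (w n * ((cmod (g n \<omega>))\<^sup>2 / 2)))) J"
    using indep_vars_subset[OF indep, of J] by (rule indep_vars_compose2) auto
  have "(\<integral>\<^sup>+\<omega>. ennreal (exp ((\<Sum>n\<in>J. w n * (cmod (g n \<omega>))\<^sup>2) / 2)) \<partial>P)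
     = (\<integral>\<^sup>+\<omega>. (\<Prod>n\<in>J. ennreal (exp (w n * ((cmod (g n \<omega>))\<^sup>2 / 2)))) \<partial>P)"
    using J by (simp add: prod_ennreal exp_sum[symmetric] sum_divide_distrib)
  also have "\<dots> = (\<Prod>n\<in>J. \<integral>\<^sup>+\<omega>. ennreal (exp (w n * ((cmod (g n \<omega>))\<^sup>2 / 2))) \<partial>P)"
    by (rule indep_vars_nn_integral[OF J iv]) auto
  also have "\<dots> \<le> (\<Prod>n\<in>J. ennreal (exp (w n)))"
    by (intro prod_mono_ennreal weighted_exp_moment) (use w in auto)
  also have "\<dots> = ennreal (exp (\<Sum>n\<in>J. w n))"
    using J by (simp add: prod_ennreal exp_sum)
  finally have "prob {\<omega> \<in> space P. (\<Sum>n\<in>J. w n * (cmod (g n \<omega>))\<^sup>2) / 2 > t / 2}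
     \<le> exp (\<Sum>n\<in>J. w n) * exp (- (t / 2))"
    by (intro chernoff_bound) auto
  moreover have "exp (\<Sum>n\<in>J. w n) * exp (- (t / 2)) = exp ((\<Sum>n\<in>J. w n) - t / 2)"
    by (simp only: exp_add[symmetric] diff_conv_add_uminus)
  moreover have "t / 2 < x / 2 \<longleftrightarrow> t < x" for x :: real by linarith
  ultimately show ?thesis by (simp only:)
qed

section \<open>The event on which clipping changes a coefficient\<close>

definition exit_set :: "real \<Rightarrow> nat \<Rightarrow> 'o set" where
  "exit_set L N = {\<omega> \<in> space P. \<exists>n\<in>{- int N..int N}. L * jbracket n powr (1 / 16) < cmod (g n \<omega>)}"

lemma exit_set_sets [measurable]: "exit_set L N \<in> sets P"
  unfolding exit_set_def by measurable

lemma clip_eq_X: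
  assumes "\<omega> \<in> space P - exit_set L N" "\<bar>n\<bar> \<le> int N"
  shows "clip L n (g n \<omega>) = X \<omega> n"
proof -
  have "n \<in> {- int N..int N}" using assms by auto
  then have "cmod (g n \<omega>) \<le> L * jbracket n powr (1 / 16)"
    using assms by (auto simp: exit_set_def not_less)
  then show ?thesis by (simp add: clip_def X_def)
qed

lemma single_tail:
  assumes "0 \<le> R"
  shows "prob {\<omega> \<in> space P. R < cmod (g n \<omega>)} \<le> exp (1 - R\<^sup>2 / 2)"
proof -
  have "prob {\<omega> \<in> space P. R < cmod (g n \<omega>)} \<le> prob {\<omega> \<in> space P. (\<Sum>n\<in>{n}. 1 * (cmod (g n \<omega>))\<^sup>2) > R\<^sup>2}"
    using assms by (intro finite_measure_mono) (auto intro: power_strict_mono)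
  also have "\<dots> \<le> exp ((\<Sum>n\<in>{n}. 1) - R\<^sup>2 / 2)" by (rule weighted_sum_tail) auto
  finally show ?thesis by simp
qed

text \<open>For L \<ge> 1 the Gaussian exponent L^2 <n>^(1/8) / 2 is at least L^2 / 4 + |n|^(1/8) /
  4. The first summand is the gain in L; the second makes the union bound over n converge uniformly
  in N.\<close>

lemma exit_set_prob:
  obtains K where "0 \<le> K" "\<And>L N. 1 \<le> L \<Longrightarrow> prob (exit_set L N) \<le> K * exp (- (L\<^sup>2 / 4))"
proof -
  define a where "a n = exp (1 - real n powr (1 / 8) / 4)" for n
  have "summable a"
  proof (rule summable_comparison_test_bigo)
    show "summable (\<lambda>n. norm (1 / (real n)\<^sup>2))"
      using inverse_power_summable[of 2, where 'a = real] by (simp add: inverse_eq_divide)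
    show "a \<in> O(\<lambda>n. 1 / (real n)\<^sup>2)" unfolding a_def by real_asymp
  qed
  define K where "K = exp 1 + 2 * suminf a"
  have suma: "(\<Sum>n\<in>{1..N}. a n) \<le> suminf a" for N
    by (rule sum_le_suminf[OF \<open>summable a\<close>]) (auto simp: a_def)
  have "0 \<le> suminf a" by (rule suminf_nonneg[OF \<open>summable a\<close>]) (simp add: a_def)
  show ?thesis
  proof (rule that)
    show "0 \<le> K" using \<open>0 \<le> suminf a\<close> by (simp add: K_def)
    fix L :: real and N :: nat assume L: "1 \<le> L"
    let ?J = "{- int N..int N}"
    let ?e = "exp (- (L\<^sup>2 / 4))"
    define b where "b n = exp (1 - \<bar>real_of_int n\<bar> powr (1 / 8) / 4)" for n :: int
    have "prob (exit_set L N) = prob (\<Union>n\<in>?J. {\<omega> \<in> space P. L * jbracket n powr (1 / 16) < cmod (g n \<omega>)})"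
      by (rule arg_cong[of _ _ prob]) (auto simp: exit_set_def)
    also have "\<dots> \<le> (\<Sum>n\<in>?J. prob {\<omega> \<in> space P. L * jbracket n powr (1 / 16) < cmod (g n \<omega>)})"
      by (rule finite_measure_subadditive_finite) auto
    also have "\<dots> \<le> (\<Sum>n\<in>?J. ?e * b n)"
    proof (rule sum_mono)
      fix n :: int
      define y where "y = jbracket n powr (1 / 8)"
      have j: "0 < jbracket n" "1 \<le> jbracket n" by (auto simp: jbracket_pos jbracket_ge_1)
      have y: "1 \<le> y" using j by (simp add: y_def ge_one_powr_ge_zero)
      have sq: "(L * jbracket n powr (1 / 16))\<^sup>2 = L\<^sup>2 * y"
        using j by (simp add: power_mult_distrib y_def power2_eq_square powr_add[symmetric])
      have "1 \<le> L\<^sup>2" using L by (simp add: one_le_power)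
      then have "L\<^sup>2 \<le> L\<^sup>2 * y" "y \<le> L\<^sup>2 * y" using y by (auto simp: mult_le_cancel_left1 mult_le_cancel_right1)
      moreover have "\<bar>real_of_int n\<bar> powr (1 / 8) \<le> y"
        unfolding y_def using jbracket_ge_abs[of n] by (intro powr_mono2) auto
      ultimately have "1 - (L\<^sup>2 * y) / 2 \<le> - (L\<^sup>2 / 4) + (1 - \<bar>real_of_int n\<bar> powr (1 / 8) / 4)" by linarith
      then have "exp (1 - (L\<^sup>2 * y) / 2) \<le> ?e * b n"
        unfolding b_def exp_add[symmetric] by simp
      moreover have "prob {\<omega> \<in> space P. L * jbracket n powr (1 / 16) < cmod (g n \<omega>)} \<le> exp (1 - (L\<^sup>2 * y) / 2)"
        using single_tail[of "L * jbracket n powr (1 / 16)" n] L unfolding sq by simp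
      ultimately show "prob {\<omega> \<in> space P. L * jbracket n powr (1 / 16) < cmod (g n \<omega>)} \<le> ?e * b n" by simp
    qed
    also have "\<dots> = ?e * (b 0 + 2 * (\<Sum>n\<in>{1..N}. a n))"
      by (simp add: sum_distrib_left[symmetric] sum_int_interval a_def b_def)
    also have "\<dots> \<le> ?e * K"
      using suma[of N] unfolding K_def by (intro mult_left_mono) (auto simp: b_def)
    finally show "prob (exit_set L N) \<le> K * ?e" by (simp add: mult.commute)
  qed
qed

text \<open>Both parts of the cost are put on the same footing: the pointwise bound squared decays
  like n^(-5/4), and the mean bound n^(-13/8) is weakened to this rate. The total is then a single
  tail sum, at most 4 M^(-1/4).\<close>

lemma exp_moment_increment:
  assumes H: "increment_bounds H C" and L: "1 \<le> L" and M: "1 \<le> M" "M \<le> N"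
    and \<theta>: "0 \<le> \<theta>" "\<theta> * (C * L ^ 6 * real M powr (- 5 / 8)) \<le> 1"
  shows "(\<integral>\<^sup>+\<omega>. ennreal (exp (\<theta> * (H N (\<lambda>n. clip L n (g n \<omega>)) - H M (\<lambda>n. clip L n (g n \<omega>))))) \<partial>P)
    \<le> ennreal (exp (4 * (\<theta> * (C * L ^ 6) + (\<theta> * (C * L ^ 6))\<^sup>2) * real M powr (- 1 / 4)))"
proof -
  interpret H: increment_bounds H C by (rule H)
  let ?J = "{- int N..int N}"
  define F where "F x = ennreal (exp (\<theta> * (H N (\<lambda>n. clip L n (x n)) - H M (\<lambda>n. clip L n (x n)))))" for x
  have [measurable]: "(\<lambda>x. H K (\<lambda>n. clip L n (x n))) \<in> borel_measurable (PiM ?J (\<lambda>_. borel))" if "K \<le> N" for K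
    by (rule H.measurable_clipped) (use that in auto)
  have [measurable]: "F \<in> borel_measurable (PiM ?J (\<lambda>_. borel))"
    unfolding F_def using M by measurable
  have F: "F (\<lambda>i\<in>?J. g i \<omega>) = F (\<lambda>i. g i \<omega>)" for \<omega>
  proof -
    have "H K (\<lambda>n. clip L n ((\<lambda>i\<in>?J. g i \<omega>) n)) = H K (\<lambda>n. clip L n (g n \<omega>))" if "K \<le> N" for K
      using that by (intro H.cong) auto
    then show ?thesis using M by (simp add: F_def)
  qed
  define s where "s = \<theta> * (C * L ^ 6)"
  have s: "0 \<le> s" using \<theta> H.C_nonneg L by (simp add: s_def)
  have "(\<integral>\<^sup>+\<omega>. F (\<lambda>i. g i \<omega>) \<partial>P) = (\<integral>\<^sup>+x. F x \<partial>distr P (PiM ?J (\<lambda>_. borel)) (\<lambda>\<omega>. \<lambda>i\<in>?J. g i \<omega>))"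
    by (subst nn_integral_distr) (auto simp: F)
  also have "\<dots> = (\<integral>\<^sup>+x. F x \<partial>PiM ?J (\<lambda>_. \<Gamma>))"
    by (subst joint_law) auto
  also have "\<dots> \<le> ennreal (exp (\<Sum>n\<in>{M<..N}. H.increment_cost \<theta> L n))"
    unfolding F_def by (rule H.exp_moment_clipped[OF L M prob_space_law sets_law symmetric \<theta>])
  also have "\<dots> \<le> ennreal (exp ((s + s\<^sup>2) * (4 * real M powr (- 1 / 4))))"
  proof (intro ennreal_leI, simp only: exp_le_cancel_iff)
    have "(\<Sum>n\<in>{M<..N}. H.increment_cost \<theta> L n)
        \<le> (\<Sum>n\<in>{M<..N}. (s + s\<^sup>2) * real n powr (- 5 / 4))"
    proof (rule sum_mono)
      fix n assume n: "n \<in> {M<..N}"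
      have "s * real n powr (- 13 / 8) \<le> s * real n powr (- 5 / 4)"
        using n s M by (intro mult_left_mono powr_mono) auto
      moreover have "(real n powr (- 5 / 8))\<^sup>2 = real n powr (- 5 / 4)"
        using n by (simp add: power2_eq_square powr_add[symmetric])
      ultimately show "H.increment_cost \<theta> L n \<le> (s + s\<^sup>2) * real n powr (- 5 / 4)"
        unfolding s_def H.increment_cost_def by (simp add: power_mult_distrib distrib_right mult.assoc)
    qed
    also have "\<dots> = (s + s\<^sup>2) * (\<Sum>n\<in>{M<..N}. real n powr (- 5 / 4))"
      by (simp add: sum_distrib_left)
    also have "\<dots> \<le> (s + s\<^sup>2) * (4 * real M powr (- 1 / 4))"
      using s by (intro mult_left_mono sum_powr_tail_le M) auto
    finally show "(\<Sum>n\<in>{M<..N}. H.increment_cost \<theta> L n)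
        \<le> (s + s\<^sup>2) * (4 * real M powr (- 1 / 4))" .
  qed
  also have "(s + s\<^sup>2) * (4 * real M powr (- 1 / 4)) = 4 * (s + s\<^sup>2) * real M powr (- 1 / 4)"
    by (simp only: mult_ac)
  finally show ?thesis unfolding F_def s_def .
qed

lemma increment_tail_clipped:
  assumes H: "increment_bounds H C" and K: "0 < K"
    and j: "1 \<le> j" "K * C \<le> real j" and M: "j ^ 72 \<le> M" "M \<le> N"
  shows "prob {\<omega> \<in> space P. H N (\<lambda>n. clip (real j) n (g n \<omega>)) - H M (\<lambda>n. clip (real j) n (g n \<omega>)) > 1 / (real j)\<^sup>2}
    \<le> exp (4 * (K * C + (K * C)\<^sup>2)) * exp (- (K * real j))"
proof -
  interpret H: increment_bounds H C by (rule H)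
  \<comment> \<open>Chosen so that \<theta> times the threshold 1 / j^2 is K j, the wanted exponent.
    With L = j, (\<theta> L^6)^2 = K^2 j^18, while M^(-1/4) \<le> j^(-18): the powers of j cancel
    exactly.\<close>
  define \<theta> where "\<theta> = K * real j ^ 3"
  define D where "D \<omega> = H N (\<lambda>n. clip (real j) n (g n \<omega>)) - H M (\<lambda>n. clip (real j) n (g n \<omega>))" for \<omega>
  have [measurable]: "(\<lambda>\<omega>. H N' (\<lambda>n. clip (real j) n (g n \<omega>))) \<in> borel_measurable P" for N'
    by (rule H.measurable_comp) simp
  have jr: "1 \<le> real j" using j by simp
  have j72: "1 \<le> j ^ 72" using j by simp
  then have M1: "1 \<le> M" using M by linarith
  have Mj: "real j ^ 72 \<le> real M" using M by (metis of_nat_le_iff of_nat_power)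
  have s: "\<theta> * (C * real j ^ 6) = K * C * real j ^ 9"
    by (simp add: \<theta>_def mult_ac flip: power_add)
  have KC: "0 \<le> K * C" using K H.C_nonneg by simp
  have p1: "real M powr (- 5 / 8) \<le> 1 / real j ^ 45"
  proof -
    have "real M powr (- 5 / 8) \<le> (real j ^ 72) powr (- 5 / 8)"
      using Mj jr by (intro powr_mono2') auto
    also have "\<dots> = real j powr (- 45)"
      using jr powr_powr[of "real j" 72 "- 5 / 8"] by (simp add: powr_numeral)
    also have "\<dots> = 1 / real j ^ 45" using jr by (simp add: powr_minus powr_numeral divide_inverse)
    finally show ?thesis .
  qed
  have p2: "real M powr (- 1 / 4) \<le> 1 / real j ^ 18"
  proof -
    have "real M powr (- 1 / 4) \<le> (real j ^ 72) powr (- 1 / 4)"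
      using Mj jr by (intro powr_mono2') auto
    also have "\<dots> = real j powr (- 18)"
      using jr powr_powr[of "real j" 72 "- 1 / 4"] by (simp add: powr_numeral)
    also have "\<dots> = 1 / real j ^ 18" using jr by (simp add: powr_minus powr_numeral divide_inverse)
    finally show ?thesis .
  qed
  have th: "\<theta> * (C * real j ^ 6 * real M powr (- 5 / 8)) \<le> 1"
  proof -
    have "\<theta> * (C * real j ^ 6 * real M powr (- 5 / 8)) = K * C * real j ^ 9 * real M powr (- 5 / 8)"
      unfolding s[symmetric] by (simp only: mult.assoc)
    also have "\<dots> \<le> real j * real j ^ 9 * (1 / real j ^ 45)"
      using j KC p1 by (intro mult_mono) auto
    also have "\<dots> = 1 / real j ^ 35" using jr by (simp add: field_simps flip: power_Suc power_add)
    also have "\<dots> \<le> 1" using jr by (simp add: one_le_power)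
    finally show ?thesis .
  qed
  have E: "4 * (\<theta> * (C * real j ^ 6) + (\<theta> * (C * real j ^ 6))\<^sup>2) * real M powr (- 1 / 4) \<le> 4 * (K * C + (K * C)\<^sup>2)"
  proof -
    have "K * C * real j ^ 9 \<le> K * C * real j ^ 18"
      using KC jr by (intro mult_left_mono power_increasing) auto
    then have "4 * (\<theta> * (C * real j ^ 6) + (\<theta> * (C * real j ^ 6))\<^sup>2) \<le> 4 * (K * C + (K * C)\<^sup>2) * real j ^ 18"
      unfolding s by (simp add: power_mult_distrib distrib_right flip: power_mult)
    then have "4 * (\<theta> * (C * real j ^ 6) + (\<theta> * (C * real j ^ 6))\<^sup>2) * real M powr (- 1 / 4)
        \<le> 4 * (K * C + (K * C)\<^sup>2) * real j ^ 18 * (1 / real j ^ 18)"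
      using p2 by (rule mult_mono) (use KC jr in auto)
    then show ?thesis using jr by simp
  qed
  have "(\<integral>\<^sup>+\<omega>. ennreal (exp (\<theta> * D \<omega>)) \<partial>P) \<le> ennreal (exp (4 * (K * C + (K * C)\<^sup>2)))"
    unfolding D_def
    by (rule order.trans[OF exp_moment_increment[OF H _ M1 M(2)]]) (use jr K th E in \<open>auto simp: \<theta>_def intro!: ennreal_leI\<close>)
  then have "prob {\<omega> \<in> space P. \<theta> * D \<omega> > K * real j} \<le> exp (4 * (K * C + (K * C)\<^sup>2)) * exp (- (K * real j))"
    by (intro chernoff_bound) (auto simp: D_def)
  moreover have "{\<omega> \<in> space P. D \<omega> > 1 / (real j)\<^sup>2} = {\<omega> \<in> space P. \<theta> * D \<omega> > K * real j}"
  proof -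
    have "D \<omega> > 1 / (real j)\<^sup>2 \<longleftrightarrow> \<theta> * D \<omega> > \<theta> * (1 / (real j)\<^sup>2)" for \<omega>
    proof (rule mult_less_cancel_left_pos[symmetric])
      show "0 < \<theta>" using K jr by (simp add: \<theta>_def)
    qed
    moreover have "\<theta> * (1 / (real j)\<^sup>2) = K * real j"
      using jr by (simp add: \<theta>_def field_simps power2_eq_square power3_eq_cube)
    ultimately show ?thesis by simp
  qed
  ultimately show ?thesis by (simp add: D_def)
qed

lemma increment_tail:
  assumes H: "increment_bounds H C" and K: "0 < K"
  obtains c j0 where "0 \<le> c" "1 \<le> j0" "\<And>j M N. j0 \<le> j \<Longrightarrow> j ^ 72 \<le> M \<Longrightarrow> M \<le> N
     \<Longrightarrow> prob {\<omega> \<in> space P. \<bar>H N (X \<omega>) - H M (X \<omega>)\<bar> > 1 / (real j)\<^sup>2} \<le> c * exp (- (K * real j))"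
proof -
  interpret H: increment_bounds H C by (rule H)
  have H': "increment_bounds (\<lambda>N c. - H N c) C" by (rule H.uminus)
  obtain E where E: "0 \<le> E" "\<And>L N. 1 \<le> L \<Longrightarrow> prob (exit_set L N) \<le> E * exp (- (L\<^sup>2 / 4))"
    using exit_set_prob by metis
  \<comment> \<open>4 K \<le> j makes the exit probability, of order exp (- j^2 / 4), at most of
    order exp (- K j); K C \<le> j is the smallness condition of
    \<open>increment_tail_clipped\<close>.\<close>
  obtain j0 where j0: "1 \<le> j0" "K * C \<le> real j0" "4 * K \<le> real j0"
  proof -
    obtain n :: nat where "max 1 (max (K * C) (4 * K)) \<le> real n" using real_arch_simple by blast
    then show ?thesis using that[of n] by auto
  qed
  define c where "c = 2 * exp (4 * (K * C + (K * C)\<^sup>2)) + E"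
  show ?thesis
  proof (rule that)
    show "0 \<le> c" using E by (simp add: c_def)
    show "1 \<le> j0" by (rule j0)
    fix j M N assume j: "j0 \<le> j" and M: "j ^ 72 \<le> M" "M \<le> N"
    have j': "1 \<le> j" "K * C \<le> real j" "4 * K \<le> real j" using j j0 by auto
    let ?cl = "\<lambda>N \<omega>. H N (\<lambda>n. clip (real j) n (g n \<omega>))"
    have [measurable]: "?cl N' \<in> borel_measurable P" for N'
      by (rule H.measurable_comp) simp
    let ?A = "{\<omega> \<in> space P. ?cl N \<omega> - ?cl M \<omega> > 1 / (real j)\<^sup>2}"
    let ?B = "{\<omega> \<in> space P. - ?cl N \<omega> - - ?cl M \<omega> > 1 / (real j)\<^sup>2}"
    let ?C = "exit_set (real j) N"
    have "{\<omega> \<in> space P. \<bar>H N (X \<omega>) - H M (X \<omega>)\<bar> > 1 / (real j)\<^sup>2} \<subseteq> ?A \<union> ?B \<union> ?C"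
    proof
      fix \<omega> assume \<omega>: "\<omega> \<in> {\<omega> \<in> space P. \<bar>H N (X \<omega>) - H M (X \<omega>)\<bar> > 1 / (real j)\<^sup>2}"
      show "\<omega> \<in> ?A \<union> ?B \<union> ?C"
      proof (cases "\<omega> \<in> ?C")
        case False
        then have "?cl N' \<omega> = H N' (X \<omega>)" if "N' \<le> N" for N'
          using \<omega> that False by (intro H.cong clip_eq_X[of _ _ N]) auto
        then show ?thesis using \<omega> M by auto
      qed simp
    qed
    then have "prob {\<omega> \<in> space P. \<bar>H N (X \<omega>) - H M (X \<omega>)\<bar> > 1 / (real j)\<^sup>2} \<le> prob (?A \<union> ?B \<union> ?C)"
      by (intro finite_measure_mono) auto
    also have "\<dots> \<le> prob ?A + prob ?B + prob ?C"
      by (intro order.trans[OF measure_Un_le] add_right_mono measure_Un_le) auto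
    also have "\<dots> \<le> exp (4 * (K * C + (K * C)\<^sup>2)) * exp (- (K * real j))
         + exp (4 * (K * C + (K * C)\<^sup>2)) * exp (- (K * real j)) + E * exp (- (K * real j))"
    proof (intro add_mono)
      show "prob ?A \<le> exp (4 * (K * C + (K * C)\<^sup>2)) * exp (- (K * real j))"
        by (rule increment_tail_clipped[OF H K j'(1,2) M])
      show "prob ?B \<le> exp (4 * (K * C + (K * C)\<^sup>2)) * exp (- (K * real j))"
        by (rule increment_tail_clipped[OF H' K j'(1,2) M])
      have "K * real j \<le> (real j)\<^sup>2 / 4"
        using j' mult_right_mono[of "4 * K" "real j" "real j"] by (simp add: power2_eq_square)
      then have "E * exp (- ((real j)\<^sup>2 / 4)) \<le> E * exp (- (K * real j))"
        using E by (intro mult_left_mono) auto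
      then show "prob ?C \<le> E * exp (- (K * real j))" using E(2)[of "real j" N] j' by simp
    qed
    also have "\<dots> = c * exp (- (K * real j))" by (simp add: c_def algebra_simps)
    finally show "prob {\<omega> \<in> space P. \<bar>H N (X \<omega>) - H M (X \<omega>)\<bar> > 1 / (real j)\<^sup>2} \<le> c * exp (- (K * real j))" .
  qed
qed

text \<open>The union bound over a block costs only a polynomial factor in j, which the decay exp (-
  j) outweighs. The rate K = 1 is enough for Borel-Cantelli.\<close>

lemma AE_convergent:
  assumes H: "increment_bounds H C"
  shows "AE \<omega> in P. convergent (\<lambda>N. H N (X \<omega>))"
proof -
  interpret H: increment_bounds H C by (rule H)
  have [measurable]: "(\<lambda>\<omega>. H N (X \<omega>)) \<in> borel_measurable P" for N
    by (rule H.measurable_comp) simp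
  obtain c j0 where c: "0 \<le> c" "1 \<le> j0" "\<And>j M N. j0 \<le> j \<Longrightarrow> j ^ 72 \<le> M \<Longrightarrow> M \<le> N
     \<Longrightarrow> prob {\<omega> \<in> space P. \<bar>H N (X \<omega>) - H M (X \<omega>)\<bar> > 1 / (real j)\<^sup>2} \<le> c * exp (- (1 * real j))"
    by (rule increment_tail[OF H zero_less_one]) (rule that)
  define B where "B j = (\<Union>N\<in>{j ^ 72..Suc j ^ 72}. {\<omega> \<in> space P. \<bar>H N (X \<omega>) - H (j ^ 72) (X \<omega>)\<bar> > 1 / (real j)\<^sup>2})" for j
  have [measurable]: "B j \<in> sets P" for j unfolding B_def by measurable
  have "summable (\<lambda>j. prob (B j))"
  proof (rule summable_comparison_test_ev)
    show "eventually (\<lambda>j. norm (prob (B j)) \<le> (real (Suc j) ^ 72 + 1) * (c * exp (- real j))) sequentially"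
      using eventually_ge_at_top[of j0]
    proof eventually_elim
      case (elim j)
      have "prob (B j) \<le> (\<Sum>N\<in>{j ^ 72..Suc j ^ 72}. prob {\<omega> \<in> space P. \<bar>H N (X \<omega>) - H (j ^ 72) (X \<omega>)\<bar> > 1 / (real j)\<^sup>2})"
        unfolding B_def by (rule finite_measure_subadditive_finite) auto
      also have "\<dots> \<le> (\<Sum>N\<in>{j ^ 72..Suc j ^ 72}. c * exp (- real j))"
        using c(3)[OF elim order.refl] by (intro sum_mono) auto
      also have "\<dots> = real (card {j ^ 72..Suc j ^ 72}) * (c * exp (- real j))" by simp
      also have "\<dots> \<le> (real (Suc j) ^ 72 + 1) * (c * exp (- real j))"
      proof (intro mult_right_mono)
        have "card {j ^ 72..Suc j ^ 72} \<le> Suc j ^ 72 + 1" by simp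
        then have "real (card {j ^ 72..Suc j ^ 72}) \<le> real (Suc j ^ 72 + 1)" by (rule of_nat_mono)
        then show "real (card {j ^ 72..Suc j ^ 72}) \<le> real (Suc j) ^ 72 + 1" by simp
      qed (use c in auto)
      finally show ?case by simp
    qed
    show "summable (\<lambda>j. (real (Suc j) ^ 72 + 1) * (c * exp (- real j)))"
    proof (rule summable_comparison_test_bigo)
      show "summable (\<lambda>n. norm (1 / (real n)\<^sup>2))"
        using inverse_power_summable[of 2, where 'a = real] by (simp add: inverse_eq_divide)
      have "(\<lambda>j. (real (Suc j) ^ 72 + 1) * exp (- real j)) \<in> O(\<lambda>n. 1 / (real n)\<^sup>2)" by real_asymp
      then have "(\<lambda>j. c * ((real (Suc j) ^ 72 + 1) * exp (- real j))) \<in> O(\<lambda>n. 1 / (real n)\<^sup>2)"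
        by (cases "c = 0") auto
      then show "(\<lambda>j. (real (Suc j) ^ 72 + 1) * (c * exp (- real j))) \<in> O(\<lambda>n. 1 / (real n)\<^sup>2)"
        by (simp add: mult_ac)
    qed
  qed
  then have "AE \<omega> in P. eventually (\<lambda>j. \<omega> \<in> space P - B j) sequentially"
    by (intro borel_cantelli_AE1) (auto simp: emeasure_eq_measure)
  then show ?thesis
  proof eventually_elim
    case (elim \<omega>)
    show ?case
    proof (rule convergent_blocks)
      show "\<forall>\<^sub>F j in sequentially. \<forall>N\<in>{j ^ 72..Suc j ^ 72}. \<bar>H N (X \<omega>) - H (j ^ 72) (X \<omega>)\<bar> \<le> 1 / (real j)\<^sup>2"
        using elim by eventually_elim (auto simp: B_def not_less)
    qed
  qed
qed

end

section \<open>Exponential tails under a small mass\<close>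

lemma sum_reflect:
  fixes G :: "int \<Rightarrow> 'a::comm_monoid_add"
  assumes "finite J" "\<And>n. n \<in> J \<Longrightarrow> k - n \<notin> J \<Longrightarrow> G n = 0"
  shows "(\<Sum>n\<in>J. G n) = (\<Sum>n\<in>{n\<in>J. k - n \<in> J}. G (k - n))"
proof -
  have "(\<Sum>n\<in>J. G n) = (\<Sum>n\<in>{n\<in>J. k - n \<in> J}. G n)"
    using assms by (intro sum.mono_neutral_right) auto
  also have "\<dots> = (\<Sum>n\<in>{n\<in>J. k - n \<in> J}. G (k - n))"
    by (rule sum.reindex_bij_witness[of _ "\<lambda>n. k - n" "\<lambda>n. k - n"]) auto
  finally show ?thesis .
qed

text \<open>Half a derivative is distributed over the product: sqrt |k| \<le> sqrt |n| + sqrt |k -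
  n|, and reflection shows that both halves give the same sum. Cauchy-Schwarz with weight a (k - n)
  then acts as Young's convolution inequality from l^2 and l^1 to l^2.\<close>

lemma f_coeff_le:
  "f_coeff N c \<le> 4 * (\<Sum>n\<in>{- int N..int N}. \<bar>real_of_int n\<bar> * (cmod (c n))\<^sup>2) * (\<Sum>n\<in>{- int N..int N}. cmod (c n))\<^sup>2"
proof -
  let ?J = "{- int N..int N}" and ?K = "{- 2 * int N..2 * int N}"
  define a where "a n = cmod (trunc N c n)" for n
  define b where "b n = sqrt \<bar>real_of_int n\<bar> * a n" for n
  have a: "0 \<le> a n" "n \<notin> ?J \<Longrightarrow> a n = 0" "n \<in> ?J \<Longrightarrow> a n = cmod (c n)" for n
    by (auto simp: a_def trunc_def)
  have b: "0 \<le> b n" "n \<notin> ?J \<Longrightarrow> b n = 0" for n using a by (auto simp: b_def)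
  define A where "A = (\<Sum>n\<in>?J. a n)"
  have A: "0 \<le> A" using a by (auto simp: A_def intro: sum_nonneg)
  have shift: "(\<Sum>k\<in>K'. a (\<phi> k)) \<le> A" if "finite K'" "inj_on \<phi> K'" for \<phi> and K' :: "int set"
    unfolding A_def using sum_inj_le[of ?J a K' \<phi>] a that by force
  have pt: "of_int k * (cmod (conv2 N c k))\<^sup>2 \<le> 4 * A * (\<Sum>n\<in>?J. (b n)\<^sup>2 * a (k - n))" for k
  proof -
    let ?s = "\<Sum>n\<in>?J. b n * a (k - n)"
    have reflect: "(\<Sum>n\<in>?J. a n * b (k - n)) = ?s"
    proof -
      have "(\<Sum>n\<in>?J. a n * b (k - n)) = (\<Sum>n\<in>{n\<in>?J. k - n \<in> ?J}. a (k - n) * b (k - (k - n)))"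
        using b by (intro sum_reflect) auto
      also have "\<dots> = (\<Sum>n\<in>{n\<in>?J. k - n \<in> ?J}. b n * a (k - n))" by (simp add: mult.commute)
      also have "\<dots> = ?s" using a by (intro sum.mono_neutral_left) auto
      finally show ?thesis .
    qed
    have "sqrt \<bar>real_of_int k\<bar> * cmod (conv2 N c k) \<le> sqrt \<bar>real_of_int k\<bar> * (\<Sum>n\<in>?J. a n * a (k - n))"
      using cmod_conv2_le[of N c k] by (intro mult_left_mono) (auto simp: a_def)
    also have "\<dots> = (\<Sum>n\<in>?J. sqrt \<bar>real_of_int k\<bar> * (a n * a (k - n)))" by (simp add: sum_distrib_left)
    also have "\<dots> \<le> (\<Sum>n\<in>?J. (sqrt \<bar>real_of_int n\<bar> + sqrt \<bar>real_of_int (k - n)\<bar>) * (a n * a (k - n)))"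
    proof (intro sum_mono mult_right_mono)
      fix n
      have "sqrt \<bar>real_of_int k\<bar> \<le> sqrt (\<bar>real_of_int n\<bar> + \<bar>real_of_int (k - n)\<bar>)"
        by (intro real_sqrt_le_mono) simp
      also have "\<dots> \<le> sqrt \<bar>real_of_int n\<bar> + sqrt \<bar>real_of_int (k - n)\<bar>"
        by (rule sqrt_add_le_add_sqrt) auto
      finally show "sqrt \<bar>real_of_int k\<bar> \<le> sqrt \<bar>real_of_int n\<bar> + sqrt \<bar>real_of_int (k - n)\<bar>" .
    qed (use a in auto)
    also have "\<dots> = (\<Sum>n\<in>?J. b n * a (k - n) + a n * b (k - n))"
      unfolding b_def by (rule sum.cong[OF refl]) (simp only: distrib_left distrib_right mult_ac)
    also have "\<dots> = ?s + (\<Sum>n\<in>?J. a n * b (k - n))" by (rule sum.distrib)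
    also have "\<dots> = 2 * ?s" by (simp add: reflect)
    finally have le: "sqrt \<bar>real_of_int k\<bar> * cmod (conv2 N c k) \<le> 2 * ?s" .
    have "of_int k * (cmod (conv2 N c k))\<^sup>2 \<le> \<bar>real_of_int k\<bar> * (cmod (conv2 N c k))\<^sup>2"
      by (intro mult_right_mono) auto
    also have "\<dots> = (sqrt \<bar>real_of_int k\<bar> * cmod (conv2 N c k))\<^sup>2"
      by (simp add: power_mult_distrib)
    also have "\<dots> \<le> (2 * ?s)\<^sup>2" using le by (intro power_mono) auto
    also have "\<dots> = 4 * ?s\<^sup>2" by (simp add: power_mult_distrib)
    also have "?s\<^sup>2 = (\<Sum>n\<in>?J. (b n * sqrt (a (k - n))) * sqrt (a (k - n)))\<^sup>2"
      using a by (simp add: mult.assoc)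
    also have "\<dots> \<le> (\<Sum>n\<in>?J. (b n * sqrt (a (k - n)))\<^sup>2) * (\<Sum>n\<in>?J. (sqrt (a (k - n)))\<^sup>2)"
      by (rule Cauchy_Schwarz_ineq_sum)
    also have "\<dots> = (\<Sum>n\<in>?J. (b n)\<^sup>2 * a (k - n)) * (\<Sum>n\<in>?J. a (k - n))"
      using a by (simp add: power_mult_distrib)
    also have "\<dots> \<le> (\<Sum>n\<in>?J. (b n)\<^sup>2 * a (k - n)) * A"
      using a by (intro mult_left_mono shift) (auto simp: inj_on_def intro!: sum_nonneg)
    finally show ?thesis by (simp add: mult_ac)
  qed
  have "f_coeff N c \<le> (\<Sum>k\<in>?K. 4 * A * (\<Sum>n\<in>?J. (b n)\<^sup>2 * a (k - n)))"
    unfolding f_coeff_def by (intro sum_mono pt)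
  also have "\<dots> = 4 * A * (\<Sum>k\<in>?K. \<Sum>n\<in>?J. (b n)\<^sup>2 * a (k - n))"
    by (simp add: sum_distrib_left)
  also have "(\<Sum>k\<in>?K. \<Sum>n\<in>?J. (b n)\<^sup>2 * a (k - n)) = (\<Sum>n\<in>?J. (b n)\<^sup>2 * (\<Sum>k\<in>?K. a (k - n)))"
    by (subst sum.swap) (simp add: sum_distrib_left)
  also have "4 * A * \<dots> \<le> 4 * A * (\<Sum>n\<in>?J. (b n)\<^sup>2 * A)"
    using A by (intro mult_left_mono sum_mono shift) (auto simp: inj_on_def)
  also have "\<dots> = 4 * (\<Sum>n\<in>?J. (b n)\<^sup>2) * A\<^sup>2"
    by (simp add: sum_distrib_right[symmetric] power2_eq_square)
  also have "(\<Sum>n\<in>?J. (b n)\<^sup>2) = (\<Sum>n\<in>?J. \<bar>real_of_int n\<bar> * (cmod (c n))\<^sup>2)"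
    using a by (intro sum.cong refl) (simp add: b_def power_mult_distrib)
  also have "A = (\<Sum>n\<in>?J. cmod (c n))"
    unfolding A_def using a by (intro sum.cong) auto
  finally show ?thesis .
qed

text \<open>A discrete form of the fact that s / (s^2 + x^2) has integral \<pi> for every s. By (s +
  n)^2 \<le> 2 (s^2 + n^2) the one-sided sum is dominated by a telescoping one, at most 2; hence 5 =
  1 + 2 \<cdot> 2, the 1 coming from n = 0.\<close>

lemma sum_lorentzian_le:
  fixes s :: real
  assumes "1 \<le> s"
  shows "(\<Sum>n\<in>{- int m..int m}. s / (s\<^sup>2 + (real_of_int n)\<^sup>2)) \<le> 5"
proof -
  have "(\<Sum>n\<in>{1..m}. s / (s\<^sup>2 + (real n)\<^sup>2)) \<le> 2 - 2 * s / (s + real m)"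
  proof (induction m)
    case (Suc m)
    define x where "x = s + real m"
    have x: "0 < x" using assms by (simp add: x_def)
    have "(x + 1)\<^sup>2 \<le> 2 * (s\<^sup>2 + (real (Suc m))\<^sup>2)"
    proof -
      have "0 \<le> (s - real (Suc m))\<^sup>2" by simp
      then show ?thesis by (simp add: x_def power2_eq_square algebra_simps)
    qed
    then have "s / (s\<^sup>2 + (real (Suc m))\<^sup>2) \<le> s / ((x + 1)\<^sup>2 / 2)"
      using assms x by (intro divide_left_mono mult_pos_pos add_pos_nonneg) auto
    also have "\<dots> \<le> s * (2 / (x * (x + 1)))"
    proof -
      have "2 / (x + 1)\<^sup>2 \<le> 2 / (x * (x + 1))"
        using x by (intro divide_left_mono) (auto simp: power2_eq_square)
      then have "s * (2 / (x + 1)\<^sup>2) \<le> s * (2 / (x * (x + 1)))" using assms by (intro mult_left_mono) auto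
      then show ?thesis by simp
    qed
    also have "\<dots> = 2 * s / x - 2 * s / (x + 1)" using x by (simp add: field_simps)
    finally show ?case using Suc.IH by (simp add: x_def add_ac)
  qed (use assms in auto)
  also have "\<dots> \<le> 2" using assms by simp
  finally have "(\<Sum>n\<in>{1..m}. s / (s\<^sup>2 + (real n)\<^sup>2)) \<le> 2" .
  moreover have "s / s\<^sup>2 \<le> 1" using assms by (simp add: power2_eq_square)
  moreover have "(\<Sum>n\<in>{- int m..int m}. s / (s\<^sup>2 + (real_of_int n)\<^sup>2))
      = s / s\<^sup>2 + 2 * (\<Sum>n\<in>{1..m}. s / (s\<^sup>2 + (real n)\<^sup>2))"
    by (simp add: sum_int_interval sum_distrib_left)
  ultimately show ?thesis by simp
qed

lemma weighted_cauchy_schwarz: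
  fixes a w :: "'i \<Rightarrow> real"
  assumes "\<And>i. i \<in> I \<Longrightarrow> 0 < w i"
  shows "(\<Sum>i\<in>I. a i)\<^sup>2 \<le> (\<Sum>i\<in>I. w i) * (\<Sum>i\<in>I. (a i)\<^sup>2 / w i)"
proof -
  have "(\<Sum>i\<in>I. a i)\<^sup>2 = (\<Sum>i\<in>I. sqrt (w i) * (a i / sqrt (w i)))\<^sup>2"
    using assms by (intro arg_cong[where f = "\<lambda>x. x\<^sup>2"] sum.cong) (auto dest!: assms)
  also have "\<dots> \<le> (\<Sum>i\<in>I. (sqrt (w i))\<^sup>2) * (\<Sum>i\<in>I. (a i / sqrt (w i))\<^sup>2)"
    by (rule Cauchy_Schwarz_ineq_sum)
  also have "\<dots> = (\<Sum>i\<in>I. w i) * (\<Sum>i\<in>I. (a i)\<^sup>2 / w i)"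
    using assms by (intro arg_cong2[where f = "(*)"] sum.cong) (auto simp: power_divide less_imp_le)
  finally show ?thesis .
qed

text \<open>Agmon's inequality for the l^1 norm of the coefficients: Cauchy-Schwarz with a
  Lorentzian weight of width s = T / \<kappa>, the scale at which the bounds on mass and derivative
  contribute equally. \<kappa> \<le> T gives the s \<ge> 1 of
  \<open>sum_lorentzian_le\<close>.\<close>

lemma discrete_agmon:
  fixes a :: "int \<Rightarrow> real"
  assumes "0 < \<kappa>" "\<kappa> \<le> T" and I: "I \<subseteq> {- int m..int m}"
    and 0: "(\<Sum>n\<in>I. (a n)\<^sup>2) \<le> \<kappa>\<^sup>2" and 1: "(\<Sum>n\<in>I. (real_of_int n)\<^sup>2 * (a n)\<^sup>2) \<le> T\<^sup>2"
  shows "(\<Sum>n\<in>I. a n)\<^sup>2 \<le> 10 * (\<kappa> * T)"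
proof -
  define s where "s = T / \<kappa>"
  have s: "1 \<le> s" using assms by (simp add: s_def)
  define w where "w n = s / (s\<^sup>2 + (real_of_int n)\<^sup>2)" for n
  have w: "0 < w n" for n using s by (simp add: w_def add_pos_nonneg)
  have fin: "finite I" using I by (rule finite_subset) simp
  have "(\<Sum>n\<in>I. a n)\<^sup>2 \<le> (\<Sum>n\<in>I. w n) * (\<Sum>n\<in>I. (a n)\<^sup>2 / w n)"
    by (rule weighted_cauchy_schwarz) (rule w)
  also have "(\<Sum>n\<in>I. (a n)\<^sup>2 / w n) = s * (\<Sum>n\<in>I. (a n)\<^sup>2) + 1 / s * (\<Sum>n\<in>I. (real_of_int n)\<^sup>2 * (a n)\<^sup>2)"
    unfolding sum_distrib_left sum.distrib[symmetric] w_def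
    using s by (intro sum.cong refl) (simp add: field_simps power2_eq_square)
  also have "(\<Sum>n\<in>I. w n) * (s * (\<Sum>n\<in>I. (a n)\<^sup>2) + 1 / s * (\<Sum>n\<in>I. (real_of_int n)\<^sup>2 * (a n)\<^sup>2))
      \<le> 5 * (s * \<kappa>\<^sup>2 + 1 / s * T\<^sup>2)"
  proof (intro mult_mono add_mono mult_left_mono)
    have "(\<Sum>n\<in>I. w n) \<le> (\<Sum>n\<in>{- int m..int m}. w n)"
      using I w by (intro sum_mono2) (auto intro: less_imp_le)
    then show "(\<Sum>n\<in>I. w n) \<le> 5" using sum_lorentzian_le[OF s, of m] by (simp add: w_def)
  qed (use s 0 1 in \<open>auto intro!: add_nonneg_nonneg mult_nonneg_nonneg divide_nonneg_nonneg sum_nonneg\<close>)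
  also have "\<dots> = 10 * (\<kappa> * T)" using assms by (simp add: s_def field_simps power2_eq_square)
  finally show ?thesis .
qed

text \<open>In both factors of \<open>f_coeff_le\<close> the low modes are interpolated between the
  mass and the H^1 norm, giving multiples of \<kappa> T. The high modes enter through \<tau>, and
  \<Lambda> is the price of passing from the l^1 norm to the weighted l^2 norm.\<close>

lemma f_coeff_split_le:
  assumes \<kappa>: "0 < \<kappa>" "\<kappa> \<le> T" and mass: "mass N c \<le> \<kappa>\<^sup>2"
    and low: "(\<Sum>n\<in>{n\<in>{- int N..int N}. \<bar>n\<bar> \<le> int j}. (real_of_int n)\<^sup>2 * (cmod (c n))\<^sup>2) \<le> T\<^sup>2"
    and high: "(\<Sum>n\<in>{n\<in>{- int N..int N}. int j < \<bar>n\<bar>}. \<bar>real_of_int n\<bar> * (cmod (c n))\<^sup>2) \<le> \<tau>"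
    and \<Lambda>: "(\<Sum>n\<in>{n\<in>{- int N..int N}. int j < \<bar>n\<bar>}. 1 / \<bar>real_of_int n\<bar>) \<le> \<Lambda>"
  shows "f_coeff N c \<le> 8 * (\<kappa> * T + \<tau>) * (10 * (\<kappa> * T) + \<Lambda> * \<tau>)"
proof -
  let ?J = "{- int N..int N}"
  define Jl where "Jl = {n\<in>?J. \<bar>n\<bar> \<le> int j}"
  define Jh where "Jh = {n\<in>?J. int j < \<bar>n\<bar>}"
  have J: "?J = Jl \<union> Jh" "Jl \<inter> Jh = {}" "finite Jl" "finite Jh" "Jl \<subseteq> ?J" "Jh \<subseteq> ?J"
    by (auto simp: Jl_def Jh_def intro: finite_subset[of _ ?J])
  note low = low[folded Jl_def] and high = high[folded Jh_def] and \<Lambda> = \<Lambda>[folded Jh_def]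
  have split: "(\<Sum>n\<in>?J. F n) = (\<Sum>n\<in>Jl. F n) + (\<Sum>n\<in>Jh. F n)" for F :: "int \<Rightarrow> real"
    unfolding J(1) using J by (intro sum.union_disjoint) auto
  have massl: "(\<Sum>n\<in>Jl. (cmod (c n))\<^sup>2) \<le> \<kappa>\<^sup>2"
  proof -
    have "(\<Sum>n\<in>Jl. (cmod (c n))\<^sup>2) \<le> mass N c"
      unfolding mass_def using J by (intro sum_mono2) auto
    then show ?thesis using mass by simp
  qed
  have T: "0 \<le> T" using \<kappa> by simp
  have \<tau>: "0 \<le> \<tau>" using high by (rule order.trans[rotated]) (auto intro!: sum_nonneg)
  have \<Lambda>0: "0 \<le> \<Lambda>" using \<Lambda> by (rule order.trans[rotated]) (auto intro!: sum_nonneg)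
  have "(\<Sum>n\<in>Jl. \<bar>real_of_int n\<bar> * (cmod (c n))\<^sup>2)\<^sup>2 = (\<Sum>n\<in>Jl. (\<bar>real_of_int n\<bar> * cmod (c n)) * cmod (c n))\<^sup>2"
    by (simp add: power2_eq_square mult.assoc)
  also have "\<dots> \<le> (\<Sum>n\<in>Jl. (\<bar>real_of_int n\<bar> * cmod (c n))\<^sup>2) * (\<Sum>n\<in>Jl. (cmod (c n))\<^sup>2)"
    by (rule Cauchy_Schwarz_ineq_sum)
  also have "\<dots> \<le> T\<^sup>2 * \<kappa>\<^sup>2"
    using low massl by (intro mult_mono) (auto simp: power_mult_distrib intro!: sum_nonneg)
  finally have "(\<Sum>n\<in>Jl. \<bar>real_of_int n\<bar> * (cmod (c n))\<^sup>2)\<^sup>2 \<le> (\<kappa> * T)\<^sup>2"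
    by (simp add: power_mult_distrib mult.commute)
  then have hl: "(\<Sum>n\<in>Jl. \<bar>real_of_int n\<bar> * (cmod (c n))\<^sup>2) \<le> \<kappa> * T"
    by (rule power2_le_imp_le) (use \<kappa> T in simp)
  have al: "(\<Sum>n\<in>Jl. cmod (c n))\<^sup>2 \<le> 10 * (\<kappa> * T)"
    using \<kappa> J massl low by (intro discrete_agmon[of _ _ _ N]) auto
  have ah: "(\<Sum>n\<in>Jh. cmod (c n))\<^sup>2 \<le> \<Lambda> * \<tau>"
  proof -
    have pos: "0 < \<bar>real_of_int n\<bar>" if "n \<in> Jh" for n using that by (auto simp: Jh_def)
    have "(\<Sum>n\<in>Jh. cmod (c n))\<^sup>2 \<le> (\<Sum>n\<in>Jh. 1 / \<bar>real_of_int n\<bar>) * (\<Sum>n\<in>Jh. (cmod (c n))\<^sup>2 / (1 / \<bar>real_of_int n\<bar>))"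
      using pos by (intro weighted_cauchy_schwarz) auto
    also have "\<dots> \<le> \<Lambda> * \<tau>"
      using \<Lambda> high \<Lambda>0 by (intro mult_mono) (auto simp: mult.commute intro!: sum_nonneg)
    finally show ?thesis .
  qed
  have "(\<Sum>n\<in>?J. cmod (c n))\<^sup>2 \<le> 2 * ((\<Sum>n\<in>Jl. cmod (c n))\<^sup>2 + (\<Sum>n\<in>Jh. cmod (c n))\<^sup>2)"
  proof -
    have "(x + y)\<^sup>2 \<le> 2 * (x\<^sup>2 + y\<^sup>2)" for x y :: real
    proof -
      have "0 \<le> (x - y)\<^sup>2" by simp
      then show ?thesis by (simp add: power2_eq_square algebra_simps)
    qed
    then show ?thesis unfolding split .
  qed
  also have "\<dots> \<le> 2 * (10 * (\<kappa> * T) + \<Lambda> * \<tau>)" using al ah by simp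
  finally have A: "(\<Sum>n\<in>?J. cmod (c n))\<^sup>2 \<le> 2 * (10 * (\<kappa> * T) + \<Lambda> * \<tau>)" .
  have "f_coeff N c \<le> 4 * (\<Sum>n\<in>?J. \<bar>real_of_int n\<bar> * (cmod (c n))\<^sup>2) * (\<Sum>n\<in>?J. cmod (c n))\<^sup>2"
    by (rule f_coeff_le)
  also have "\<dots> \<le> 4 * (\<kappa> * T + \<tau>) * (2 * (10 * (\<kappa> * T) + \<Lambda> * \<tau>))"
  proof (rule mult_mono[OF _ A])
    show "4 * (\<Sum>n\<in>?J. \<bar>real_of_int n\<bar> * (cmod (c n))\<^sup>2) \<le> 4 * (\<kappa> * T + \<tau>)"
      unfolding split by (intro mult_left_mono add_mono hl high) simp
  qed (use \<kappa> T \<tau> in simp_all)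
  also have "4 * x * (2 * y) = 8 * x * y" for x y :: real by simp
  finally show ?thesis .
qed

text \<open>The harmonic bound 2 (1 + ln N) stays logarithmic in j because N is at most a fixed
  power of j; 144 = 2 \<cdot> 72.\<close>

lemma sum_inverse_le:
  assumes "N \<le> j ^ 72" "1 \<le> j"
  shows "(\<Sum>n\<in>{n\<in>{- int N..int N}. int j < \<bar>n\<bar>}. 1 / \<bar>real_of_int n\<bar>) \<le> 2 + 144 * ln (real j)"
proof (cases "N = 0")
  case True
  then have "{n\<in>{- int N..int N}. int j < \<bar>n\<bar>} = {}" by auto
  then show ?thesis using assms by (simp only: sum.empty) simp
next
  case False
  \<comment> \<open>The term n = 0, which the larger range includes, is 1 / 0 = 0.\<close>
  have "(\<Sum>n\<in>{n\<in>{- int N..int N}. int j < \<bar>n\<bar>}. 1 / \<bar>real_of_int n\<bar>) \<le> (\<Sum>n\<in>{- int N..int N}. 1 / \<bar>real_of_int n\<bar>)"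
    by (intro sum_mono2) auto
  also have "\<dots> = 2 * harm N"
    by (simp add: sum_int_interval harm_def sum_distrib_left inverse_eq_divide)
  also have "harm N \<le> ln (real N) + (1 :: real)"
    using decseqD[OF decseq_harm_diff_ln, of 0 "N - 1"] False by (simp add: harm_def)
  also have "ln (real N) \<le> ln (real (j ^ 72))" using assms False by (subst ln_le_cancel_iff) auto
  also have "ln (real (j ^ 72)) = 72 * ln (real j)" using assms by (simp add: ln_realpow)
  finally show ?thesis by simp
qed

section \<open>Tails and exponential moments of the quartic form on the small-mass event\<close>

context gauss_coeffs
begin

lemma measurable_f_coeff_X [measurable]: "(\<lambda>\<omega>. f_coeff N (X \<omega>)) \<in> borel_measurable P"
  by (rule increment_bounds.measurable_comp[OF increment_bounds_f_coeff]) simp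

lemma measurable_mass_X [measurable]: "(\<lambda>\<omega>. mass N (X \<omega>)) \<in> borel_measurable P"
  by (rule increment_bounds.measurable_comp[OF increment_bounds_mass]) simp

definition large_f_set :: "real \<Rightarrow> nat \<Rightarrow> real \<Rightarrow> 'o set" where
  "large_f_set \<kappa> N t = {\<omega> \<in> space P. t < f_coeff N (X \<omega>) \<and> mass N (X \<omega>) \<le> \<kappa>\<^sup>2}"

lemma large_f_set_sets [measurable]: "large_f_set \<kappa> N t \<in> sets P"
  unfolding large_f_set_def by measurable

text \<open>Outside two events of probability at most exp (- K j) the deterministic bound
  \<open>f_coeff_split_le\<close> applies. The level is j - 1 rather than j to leave room for the
  increment beyond the frequency j^72.\<close>

lemma low_frequency_tail:
  assumes K: "0 < K"
  obtains \<kappa> j0 where "0 < \<kappa>" "\<And>j N. j0 \<le> j \<Longrightarrow> N \<le> j ^ 72 \<Longrightarrow>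
    prob (large_f_set \<kappa> N (real j - 1)) \<le> 2 * exp (- (K * real j))"
proof -
  \<comment> \<open>There are at most 2 j + 1 \<le> 3 j low modes, so the Chernoff exponent 3 j - B
    j / 2 equals - K j.\<close>
  define B where "B = 2 * (K + 3)"
  \<comment> \<open>chosen so that the low frequencies contribute at most \<open>80 \<kappa>\<^sup>2 B j < j / 2\<close> to \<open>f_coeff\<close>\<close>
  define \<kappa> where "\<kappa> = 1 / (16 * sqrt B)"
  have B: "6 \<le> B" using K by (simp add: B_def)
  then have sB: "1 \<le> sqrt B" by simp
  have \<kappa>: "0 < \<kappa>" using B by (simp add: \<kappa>_def)
  \<comment> \<open>A small positive power of j: it outgrows \<Lambda> = O(log j), as the tail of
    the high modes requires, while \<tau> and \<Lambda> \<tau> stay negligible against \<kappa> T =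
    sqrt j / 16.\<close>
  define \<tau> where "\<tau> j = real j powr (1 / 8)" for j :: nat
  define \<Lambda> where "\<Lambda> j = 2 + 144 * ln (real j)" for j :: nat
  have "eventually (\<lambda>j. 8 * (sqrt (real j) / 16 + \<tau> j) * (10 * (sqrt (real j) / 16) + \<Lambda> j * \<tau> j) \<le> real j - 1) sequentially"
    unfolding \<tau>_def \<Lambda>_def by real_asymp
  moreover have "eventually (\<lambda>j. \<Lambda> j + K \<le> \<tau> j / 2) sequentially"
    unfolding \<tau>_def \<Lambda>_def by real_asymp
  ultimately have "eventually (\<lambda>j. 8 * (sqrt (real j) / 16 + \<tau> j) * (10 * (sqrt (real j) / 16) + \<Lambda> j * \<tau> j) \<le> real j - 1
      \<and> \<Lambda> j + K \<le> \<tau> j / 2 \<and> 1 \<le> j) sequentially"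
    using eventually_ge_at_top[of 1] by eventually_elim auto
  then obtain j0 where j0: "\<And>j. j0 \<le> j \<Longrightarrow> 8 * (sqrt (real j) / 16 + \<tau> j) * (10 * (sqrt (real j) / 16) + \<Lambda> j * \<tau> j) \<le> real j - 1
      \<and> \<Lambda> j + K \<le> \<tau> j / 2 \<and> 1 \<le> j"
    unfolding eventually_sequentially by blast
  show ?thesis
  proof (rule that)
    show "0 < \<kappa>" by (rule \<kappa>)
    fix j N assume j: "j0 \<le> j" and N: "N \<le> j ^ 72"
    note j0 = j0[OF j]
    then have j1: "1 \<le> real j" by simp
    define T where "T = sqrt (B * real j)"
    have \<kappa>T: "\<kappa> * T = sqrt (real j) / 16"
      using B by (simp add: \<kappa>_def T_def real_sqrt_mult)
    have "\<kappa> \<le> 1"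
    proof -
      have "1 / (16 * sqrt B) \<le> 1 / 1" using sB by (intro divide_left_mono) linarith+
      then show ?thesis by (simp add: \<kappa>_def)
    qed
    moreover have "1 \<le> B * real j" using mult_mono[of 1 B 1 "real j"] B j1 by simp
    then have "1 \<le> T" by (simp add: T_def)
    ultimately have \<kappa>_le: "\<kappa> \<le> T" by simp
    have T2: "T\<^sup>2 = B * real j" using B by (simp add: T_def)
    let ?Jl = "{n\<in>{- int N..int N}. \<bar>n\<bar> \<le> int j}" and ?Jh = "{n\<in>{- int N..int N}. int j < \<bar>n\<bar>}"
    have fin: "finite ?Jl" "finite ?Jh" by (auto intro: finite_subset[of _ "{- int N..int N}"])
    let ?A = "{\<omega> \<in> space P. (\<Sum>n\<in>?Jl. 1 * (cmod (g n \<omega>))\<^sup>2) > B * real j}"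
    \<comment> \<open>On |n| > j the weight j / <n> is at most 1, as
      \<open>weighted_sum_tail\<close> demands. Scaling by j gives the exponent j (\<Lambda> -
      \<tau> / 2) \<le> - K j.\<close>
    let ?C = "{\<omega> \<in> space P. (\<Sum>n\<in>?Jh. (real j / jbracket n) * (cmod (g n \<omega>))\<^sup>2) > real j * \<tau> j}"
    have "large_f_set \<kappa> N (real j - 1) \<subseteq> ?A \<union> ?C"
    proof (rule ccontr)
      assume "\<not> ?thesis"
      then obtain \<omega> where \<omega>1: "\<omega> \<in> space P" "real j - 1 < f_coeff N (X \<omega>)" "mass N (X \<omega>) \<le> \<kappa>\<^sup>2"
        "\<omega> \<notin> ?A" "\<omega> \<notin> ?C" unfolding large_f_set_def by blast
      have "\<not> (\<Sum>n\<in>?Jl. 1 * (cmod (g n \<omega>))\<^sup>2) > B * real j"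
        "\<not> (\<Sum>n\<in>?Jh. (real j / jbracket n) * (cmod (g n \<omega>))\<^sup>2) > real j * \<tau> j"
        using \<omega>1 by blast+
      note \<omega> = \<omega>1(1-3) this[unfolded not_less]
      have Xg: "(cmod (X \<omega> n))\<^sup>2 = (cmod (g n \<omega>))\<^sup>2 / (jbracket n)\<^sup>2" for n
        by (simp add: X_def norm_divide power_divide)
      have jb: "0 < jbracket n" for n by (rule jbracket_pos)
      have "(\<Sum>n\<in>?Jl. (real_of_int n)\<^sup>2 * (cmod (X \<omega> n))\<^sup>2) \<le> (\<Sum>n\<in>?Jl. 1 * (cmod (g n \<omega>))\<^sup>2)"
      proof (rule sum_mono)
        fix n
        have "(real_of_int n)\<^sup>2 / (jbracket n)\<^sup>2 \<le> 1" by (simp add: jbracket_def add_nonneg_pos)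
        then have "(real_of_int n)\<^sup>2 / (jbracket n)\<^sup>2 * (cmod (g n \<omega>))\<^sup>2 \<le> 1 * (cmod (g n \<omega>))\<^sup>2"
          by (intro mult_right_mono) auto
        then show "(real_of_int n)\<^sup>2 * (cmod (X \<omega> n))\<^sup>2 \<le> 1 * (cmod (g n \<omega>))\<^sup>2" by (simp add: Xg)
      qed
      then have low: "(\<Sum>n\<in>?Jl. (real_of_int n)\<^sup>2 * (cmod (X \<omega> n))\<^sup>2) \<le> T\<^sup>2" using \<omega> T2 by simp
      have "real j * (\<Sum>n\<in>?Jh. \<bar>real_of_int n\<bar> * (cmod (X \<omega> n))\<^sup>2) \<le> (\<Sum>n\<in>?Jh. (real j / jbracket n) * (cmod (g n \<omega>))\<^sup>2)"
        unfolding sum_distrib_left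
      proof (rule sum_mono)
        fix n
        have "\<bar>real_of_int n\<bar> / (jbracket n)\<^sup>2 \<le> 1 / jbracket n"
          using jb[of n] jbracket_ge_abs[of n] by (simp add: field_simps power2_eq_square)
        then have "\<bar>real_of_int n\<bar> / (jbracket n)\<^sup>2 * (cmod (g n \<omega>))\<^sup>2 \<le> 1 / jbracket n * (cmod (g n \<omega>))\<^sup>2"
          by (intro mult_right_mono) auto
        then have "real j * (\<bar>real_of_int n\<bar> / (jbracket n)\<^sup>2 * (cmod (g n \<omega>))\<^sup>2) \<le> real j * (1 / jbracket n * (cmod (g n \<omega>))\<^sup>2)"
          by (intro mult_left_mono) auto
        then show "real j * (\<bar>real_of_int n\<bar> * (cmod (X \<omega> n))\<^sup>2) \<le> (real j / jbracket n) * (cmod (g n \<omega>))\<^sup>2"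
          by (simp add: Xg)
      qed
      then have "real j * (\<Sum>n\<in>?Jh. \<bar>real_of_int n\<bar> * (cmod (X \<omega> n))\<^sup>2) \<le> real j * \<tau> j" using \<omega> by simp
      then have high: "(\<Sum>n\<in>?Jh. \<bar>real_of_int n\<bar> * (cmod (X \<omega> n))\<^sup>2) \<le> \<tau> j"
        by (rule mult_left_le_imp_le) (use j1 in simp)
      have "(\<Sum>n\<in>?Jh. 1 / \<bar>real_of_int n\<bar>) \<le> \<Lambda> j"
        unfolding \<Lambda>_def using N j1 by (intro sum_inverse_le) auto
      then have "f_coeff N (X \<omega>) \<le> 8 * (\<kappa> * T + \<tau> j) * (10 * (\<kappa> * T) + \<Lambda> j * \<tau> j)"
        by (rule f_coeff_split_le[OF \<kappa> \<kappa>_le \<omega>(3) low high])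
      then show False using j0 \<omega>(2) unfolding \<kappa>T by linarith
    qed
    then have "prob (large_f_set \<kappa> N (real j - 1)) \<le> prob (?A \<union> ?C)"
      by (intro finite_measure_mono) auto
    also have "\<dots> \<le> prob ?A + prob ?C" by (intro measure_Un_le) auto
    also have "prob ?A \<le> exp (- (K * real j))"
    proof -
      have "prob ?A \<le> exp ((\<Sum>n\<in>?Jl. 1) - B * real j / 2)"
        by (rule weighted_sum_tail[OF fin(1)]) auto
      also have "(\<Sum>n\<in>?Jl. 1) - B * real j / 2 \<le> - (K * real j)"
      proof -
        have "card ?Jl \<le> card {- int j..int j}" by (intro card_mono) auto
        then have "real (card ?Jl) \<le> 2 * real j + 1" by simp
        then have "(\<Sum>n\<in>?Jl. 1 :: real) \<le> 3 * real j" using j1 by simp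
        then show ?thesis by (simp add: B_def algebra_simps)
      qed
      finally show ?thesis by simp
    qed
    also have "prob ?C \<le> exp (- (K * real j))"
    proof -
      have w: "0 \<le> real j / jbracket n \<and> real j / jbracket n \<le> 1" "real j / jbracket n \<le> real j * (1 / \<bar>real_of_int n\<bar>)"
        if "n \<in> ?Jh" for n
      proof -
        have "real_of_int (int j) < real_of_int \<bar>n\<bar>" using that by (subst of_int_less_iff) auto
        then have "real j < \<bar>real_of_int n\<bar>" by simp
        then show "0 \<le> real j / jbracket n \<and> real j / jbracket n \<le> 1" "real j / jbracket n \<le> real j * (1 / \<bar>real_of_int n\<bar>)"
          using jbracket_ge_abs[of n] jbracket_pos[of n] by (auto intro!: divide_left_mono)
      qed
      have "prob ?C \<le> exp ((\<Sum>n\<in>?Jh. real j / jbracket n) - real j * \<tau> j / 2)"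
        by (rule weighted_sum_tail[OF fin(2)]) (rule w)
      also have "(\<Sum>n\<in>?Jh. real j / jbracket n) - real j * \<tau> j / 2 \<le> - (K * real j)"
      proof -
        have "(\<Sum>n\<in>?Jh. real j / jbracket n) \<le> (\<Sum>n\<in>?Jh. real j * (1 / \<bar>real_of_int n\<bar>))"
          by (intro sum_mono w)
        also have "\<dots> \<le> real j * \<Lambda> j"
          unfolding sum_distrib_left[symmetric] \<Lambda>_def using N j1 by (intro mult_left_mono sum_inverse_le) auto
        also have "\<dots> \<le> real j * (\<tau> j / 2 - K)" using j0 by (intro mult_left_mono) auto
        finally show ?thesis by (simp add: algebra_simps)
      qed
      finally show ?thesis by simp
    qed
    finally show "prob (large_f_set \<kappa> N (real j - 1)) \<le> 2 * exp (- (K * real j))"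
      by simp
  qed
qed

end

lemma mass_mono: "M \<le> N \<Longrightarrow> mass M c \<le> mass N c"
  unfolding mass_def by (intro sum_mono2) auto

context gauss_coeffs
begin

text \<open>Compare N with M = min N (j^72). The mass constraint passes to M because the mass grows
  with the cut-off frequency, and an increment of at most 1 / j^2 \<le> 1 lowers the level from j to
  j - 1 at worst.\<close>

lemma f_coeff_tail:
  assumes K: "0 < K"
  obtains \<kappa> C j0 where "0 < \<kappa>" "0 \<le> C" "\<And>j N. j0 \<le> j \<Longrightarrow>
    prob (large_f_set \<kappa> N (real j)) \<le> C * exp (- (K * real j))"
proof -
  obtain \<kappa> j1 where \<kappa>: "0 < \<kappa>" and low: "\<And>j N. j1 \<le> j \<Longrightarrow> N \<le> j ^ 72 \<Longrightarrow>
    prob (large_f_set \<kappa> N (real j - 1)) \<le> 2 * exp (- (K * real j))"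
    by (rule low_frequency_tail[OF K]) (rule that)
  obtain c j2 where c: "0 \<le> c" "1 \<le> j2" and tail: "\<And>j M N. j2 \<le> j \<Longrightarrow> j ^ 72 \<le> M \<Longrightarrow> M \<le> N
     \<Longrightarrow> prob {\<omega> \<in> space P. \<bar>f_coeff N (X \<omega>) - f_coeff M (X \<omega>)\<bar> > 1 / (real j)\<^sup>2} \<le> c * exp (- (K * real j))"
    by (rule increment_tail[OF increment_bounds_f_coeff K]) (rule that)
  show ?thesis
  proof (rule that)
    show "0 < \<kappa>" "0 \<le> 2 + c" using \<kappa> c by auto
    fix j N assume j: "max j1 j2 \<le> j"
    define M where "M = min N (j ^ 72)"
    let ?A = "large_f_set \<kappa> M (real j - 1)"
    let ?B = "{\<omega> \<in> space P. \<bar>f_coeff N (X \<omega>) - f_coeff M (X \<omega>)\<bar> > 1 / (real j)\<^sup>2}"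
    have "1 \<le> real j" using j c by simp
    then have j1: "1 / (real j)\<^sup>2 \<le> 1" by (simp add: one_le_power)
    have "large_f_set \<kappa> N (real j) \<subseteq> ?A \<union> ?B"
    proof
      fix \<omega> assume \<omega>: "\<omega> \<in> large_f_set \<kappa> N (real j)"
      have "mass M (X \<omega>) \<le> mass N (X \<omega>)" by (rule mass_mono) (simp add: M_def)
      then show "\<omega> \<in> ?A \<union> ?B" using \<omega> j1 by (auto simp: large_f_set_def abs_if split: if_splits)
    qed
    then have "prob (large_f_set \<kappa> N (real j)) \<le> prob (?A \<union> ?B)"
      by (intro finite_measure_mono) auto
    also have "\<dots> \<le> prob ?A + prob ?B" by (intro measure_Un_le) auto
    also have "prob ?A \<le> 2 * exp (- (K * real j))"
      by (rule low) (use j in \<open>auto simp: M_def\<close>)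
    also have "prob ?B \<le> c * exp (- (K * real j))"
    proof (cases "N \<le> j ^ 72")
      case True
      then show ?thesis using c by (simp add: M_def min_absorb1 not_less)
    next
      case False
      then show ?thesis by (intro tail) (use j in \<open>auto simp: M_def\<close>)
    qed
    finally show "prob (large_f_set \<kappa> N (real j)) \<le> (2 + c) * exp (- (K * real j))"
      by (simp add: distrib_right)
  qed
qed

text \<open>Decomposition into unit layers: where f lies between j0 + i and j0 + i + 1, the
  exponential is at most exp (A (j0 + i + 1)). Tail decay at rate A + 1 leaves a geometric series of
  ratio exp (- 1).\<close>

lemma f_coeff_exp_moment:
  assumes A: "0 < A"
  obtains \<kappa> C where "0 < \<kappa>"
    "\<And>N. (\<integral>\<^sup>+\<omega>. ennreal (exp (A * f_coeff N (X \<omega>))) * indicator {\<omega>. mass N (X \<omega>) \<le> \<kappa>\<^sup>2} \<omega> \<partial>P) \<le> ennreal C"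
proof -
  have "0 < A + 1" using A by simp
  then obtain \<kappa> c j0 where \<kappa>: "0 < \<kappa>" and c: "0 \<le> c" and tail: "\<And>j N. j0 \<le> j \<Longrightarrow>
    prob (large_f_set \<kappa> N (real j)) \<le> c * exp (- ((A + 1) * real j))"
    by (rule f_coeff_tail) (rule that)
  have sm: "summable (\<lambda>i. c * exp A * exp (- 1) ^ i :: real)"
    by (intro summable_mult summable_geometric) simp
  define S where "S = (\<Sum>i. c * exp A * exp (- 1) ^ i :: real)"
  show ?thesis
  proof (rule that[OF \<kappa>])
    fix N
    define E where "E i = large_f_set \<kappa> N (real (j0 + i))" for i
    have [measurable]: "E i \<in> sets P" for i by (simp add: E_def)
    have pt: "ennreal (exp (A * f_coeff N (X \<omega>))) * indicator {\<omega>. mass N (X \<omega>) \<le> \<kappa>\<^sup>2} \<omega>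
       \<le> ennreal (exp (A * real j0)) + (\<Sum>i. ennreal (exp (A * real (j0 + i + 1))) * indicator (E i) \<omega>)"
      if "\<omega> \<in> space P" for \<omega>
    proof (cases "mass N (X \<omega>) \<le> \<kappa>\<^sup>2")
      case True
      show ?thesis
      proof (cases "f_coeff N (X \<omega>) \<le> real j0")
        case le: True
        then have "ennreal (exp (A * f_coeff N (X \<omega>))) * indicator {\<omega>. mass N (X \<omega>) \<le> \<kappa>\<^sup>2} \<omega> \<le> ennreal (exp (A * real j0))"
          using A True by (auto intro!: ennreal_leI)
        then show ?thesis by (rule order.trans) simp
      next
        case False
        define x where "x = f_coeff N (X \<omega>) - real j0"
        \<comment> \<open>Ceiling minus one, because the layers are open on the left and closed on
          the right: i < x \<le> i + 1.\<close>
        define i where "i = nat (\<lceil>x\<rceil> - 1)"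
        have x: "0 < x" using False by (simp add: x_def)
        then have "real i = of_int \<lceil>x\<rceil> - 1" by (simp add: i_def)
        then have i: "real i < x" "x \<le> real i + 1" by linarith+
        have "\<omega> \<in> E i" using True that i by (simp add: E_def large_f_set_def x_def)
        then have "ennreal (exp (A * f_coeff N (X \<omega>))) * indicator {\<omega>. mass N (X \<omega>) \<le> \<kappa>\<^sup>2} \<omega>
          \<le> ennreal (exp (A * real (j0 + i + 1))) * indicator (E i) \<omega>"
          using A True i by (auto simp: x_def intro!: ennreal_leI)
        also have "\<dots> \<le> (\<Sum>i. ennreal (exp (A * real (j0 + i + 1))) * indicator (E i) \<omega>)"
        proof -
          have "h i \<le> suminf h" for h :: "nat \<Rightarrow> ennreal"
            using sum_le_suminf[of h "{i}"] by simp
          then show ?thesis .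
        qed
        also have "\<dots> \<le> ennreal (exp (A * real j0)) + \<dots>" by simp
        finally show ?thesis .
      qed
    qed simp
    have "(\<integral>\<^sup>+\<omega>. ennreal (exp (A * f_coeff N (X \<omega>))) * indicator {\<omega>. mass N (X \<omega>) \<le> \<kappa>\<^sup>2} \<omega> \<partial>P)
       \<le> (\<integral>\<^sup>+\<omega>. ennreal (exp (A * real j0)) + (\<Sum>i. ennreal (exp (A * real (j0 + i + 1))) * indicator (E i) \<omega>) \<partial>P)"
      by (intro nn_integral_mono pt)
    also have "\<dots> = ennreal (exp (A * real j0)) + (\<Sum>i. ennreal (exp (A * real (j0 + i + 1))) * emeasure P (E i))"
      by (simp add: nn_integral_add nn_integral_suminf nn_integral_cmult emeasure_space_1)
    also have "\<dots> \<le> ennreal (exp (A * real j0)) + (\<Sum>i. ennreal (c * exp A * exp (- 1) ^ i))"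
    proof (intro add_left_mono suminf_le)
      fix i
      have "exp (A * real (j0 + i + 1)) * prob (E i) \<le> exp (A * real (j0 + i + 1)) * (c * exp (- ((A + 1) * real (j0 + i))))"
        unfolding E_def by (intro mult_left_mono tail) auto
      also have "\<dots> = c * (exp (A * real (j0 + i + 1)) * exp (- ((A + 1) * real (j0 + i))))"
        by simp
      also have "exp (A * real (j0 + i + 1)) * exp (- ((A + 1) * real (j0 + i))) = exp (A - real j0 - real i)"
        unfolding exp_add[symmetric] by (simp add: algebra_simps)
      also have "c * exp (A - real j0 - real i) \<le> c * exp (A - real i)"
        using c by (intro mult_left_mono) auto
      also have "c * exp (A - real i) = c * exp A * exp (- 1) ^ i"
        by (simp add: exp_diff exp_minus power_inverse divide_inverse exp_of_nat_mult[symmetric])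
      finally show "ennreal (exp (A * real (j0 + i + 1))) * emeasure P (E i) \<le> ennreal (c * exp A * exp (- 1) ^ i)"
        by (simp add: emeasure_eq_measure ennreal_mult[symmetric] ennreal_leI)
    qed auto
    also have "(\<Sum>i. ennreal (c * exp A * exp (- 1) ^ i)) = ennreal S"
      unfolding S_def using sm c by (intro suminf_ennreal2) auto
    also have "ennreal (exp (A * real j0)) + ennreal S = ennreal (exp (A * real j0) + S)"
    proof -
      have "0 \<le> S" unfolding S_def using sm c by (intro suminf_nonneg) auto
      then show ?thesis by simp
    qed
    finally show "(\<integral>\<^sup>+\<omega>. ennreal (exp (A * f_coeff N (X \<omega>))) * indicator {\<omega>. mass N (X \<omega>) \<le> \<kappa>\<^sup>2} \<omega> \<partial>P)
       \<le> ennreal (exp (A * real j0) + S)" .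
  qed
qed

text \<open>The sextic term can only decrease the density, and the support of \<open>chi\<close>
  confines the integral to mass \<le> \<kappa>^2. Hence one bound C serves all smaller cut-offs at
  once.\<close>

lemma G_trunc_moment:
  assumes p: "0 < p"
  obtains \<kappa> C where "0 < \<kappa>"
    "\<And>\<kappa>' chi N. 0 < \<kappa>' \<Longrightarrow> \<kappa>' \<le> \<kappa> \<Longrightarrow> cutoff \<kappa>' chi \<Longrightarrow>
       (\<integral>\<^sup>+\<omega>. ennreal (G_trunc chi N (X \<omega>) powr p) \<partial>P) \<le> ennreal C"
proof -
  have "0 < 3 / 4 * p" using p by simp
  then obtain \<kappa> C where \<kappa>: "0 < \<kappa>" and C: "\<And>N. (\<integral>\<^sup>+\<omega>. ennreal (exp (3 / 4 * p * f_coeff N (X \<omega>)))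
      * indicator {\<omega>. mass N (X \<omega>) \<le> \<kappa>\<^sup>2} \<omega> \<partial>P) \<le> ennreal C"
    by (rule f_coeff_exp_moment) (rule that)
  show ?thesis
  proof (rule that[OF \<kappa>])
    fix \<kappa>' chi N assume \<kappa>': "0 < \<kappa>'" "\<kappa>' \<le> \<kappa>" and chi: "cutoff \<kappa>' chi"
    have c01: "0 \<le> chi x" "chi x \<le> 1" for x using chi by (auto simp: cutoff_def)
    have supp: "x \<le> \<kappa>'" if "chi x \<noteq> 0" for x
      using that chi closure_subset[of "{x. chi x \<noteq> 0}"] by (auto simp: cutoff_def)
    have "G_trunc chi N c powr p \<le> exp (3 / 4 * p * f_coeff N c) * indicator {c. mass N c \<le> \<kappa>\<^sup>2} c" for c
    proof (cases "chi (sqrt (mass N c)) = 0")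
      case False
      then have le: "sqrt (mass N c) \<le> \<kappa>" using supp \<kappa>' by fastforce
      have m0: "0 \<le> mass N c" by (auto simp: mass_def intro: sum_nonneg)
      have "mass N c \<le> \<kappa>\<^sup>2" using sqrt_le_D[OF le] .
      moreover have "G_trunc chi N c powr p \<le> exp (3 / 4 * p * f_coeff N c)"
      proof -
        have "G_trunc chi N c \<le> 1 * exp (3 / 4 * f_coeff N c)"
          unfolding G_trunc_eq using c01 sextic_nonneg[of N c] by (intro mult_mono) auto
        then have "G_trunc chi N c powr p \<le> exp (3 / 4 * f_coeff N c) powr p"
          using p c01 by (intro powr_mono2) (auto simp: G_trunc_eq)
        then show ?thesis by (simp add: exp_powr_real mult_ac)
      qed
      ultimately show ?thesis by simp
    qed (simp add: G_trunc_eq)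
    then have "(\<integral>\<^sup>+\<omega>. ennreal (G_trunc chi N (X \<omega>) powr p) \<partial>P) \<le> (\<integral>\<^sup>+\<omega>. ennreal (exp (3 / 4 * p * f_coeff N (X \<omega>)))
      * indicator {\<omega>. mass N (X \<omega>) \<le> \<kappa>\<^sup>2} \<omega> \<partial>P)"
    proof (intro nn_integral_mono)
      fix \<omega>
      assume le: "\<And>c. G_trunc chi N c powr p \<le> exp (3 / 4 * p * f_coeff N c) * indicator {c. mass N c \<le> \<kappa>\<^sup>2} c"
      show "ennreal (G_trunc chi N (X \<omega>) powr p) \<le> ennreal (exp (3 / 4 * p * f_coeff N (X \<omega>)))
          * indicator {\<omega>. mass N (X \<omega>) \<le> \<kappa>\<^sup>2} \<omega>"
        using le[of "X \<omega>"] by (cases "mass N (X \<omega>) \<le> \<kappa>\<^sup>2") (auto intro!: ennreal_leI)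
    qed
    also have "\<dots> \<le> ennreal C" by (rule C)
    finally show "(\<integral>\<^sup>+\<omega>. ennreal (G_trunc chi N (X \<omega>) powr p) \<partial>P) \<le> ennreal C" .
  qed
qed

lemma AE_G_trunc_convergent:
  assumes "cutoff \<kappa> chi"
  shows "AE \<omega> in P. convergent (\<lambda>N. G_trunc chi N (X \<omega>))"
  using AE_convergent[OF increment_bounds_mass] AE_convergent[OF increment_bounds_f_coeff] AE_convergent[OF increment_bounds_sextic]
proof eventually_elim
  case (elim \<omega>)
  then obtain a b d where l: "(\<lambda>N. mass N (X \<omega>)) \<longlonglongrightarrow> a" "(\<lambda>N. f_coeff N (X \<omega>)) \<longlonglongrightarrow> b" "(\<lambda>N. sextic N (X \<omega>)) \<longlonglongrightarrow> d"
    by (auto simp: convergent_def)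
  have "isCont chi (sqrt a)"
    using assms by (auto simp: cutoff_def continuous_on_eq_continuous_at)
  then have "(\<lambda>N. chi (sqrt (mass N (X \<omega>)))) \<longlonglongrightarrow> chi (sqrt a)"
    by (rule isCont_tendsto_compose) (intro tendsto_real_sqrt l)
  then have "(\<lambda>N. G_trunc chi N (X \<omega>)) \<longlonglongrightarrow> chi (sqrt a) * exp (3 / 4 * b - 1 / 2 * d)"
    unfolding G_trunc_eq by (intro tendsto_intros l)
  then show ?case by (rule convergentI)
qed

end

section \<open>The complex normal law\<close>

definition real_normal_law :: "real measure" where
  "real_normal_law = density lborel std_normal_density"

definition complex_normal_law :: "complex measure" where
  "complex_normal_law = distr (real_normal_law \<Otimes>\<^sub>M real_normal_law) borel
     (\<lambda>(a, b). (complex_of_real a + \<i> * complex_of_real b) / complex_of_real (sqrt 2))"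

lemma sets_real_normal_law [measurable_cong, simp]: "sets real_normal_law = sets borel"
  by (simp add: real_normal_law_def)

lemma space_real_normal_law [simp]: "space real_normal_law = UNIV"
  by (simp add: real_normal_law_def)

lemma prob_space_real_normal_law: "prob_space real_normal_law"
  unfolding real_normal_law_def by (rule prob_space_normal_density) simp

lemma real_normal_law_uminus: "distr real_normal_law borel uminus = real_normal_law"
proof -
  have "real_normal_law = density (distr lborel borel uminus) std_normal_density"
    by (simp add: real_normal_law_def lborel_distr_uminus)
  also have "\<dots> = distr (density lborel (\<lambda>x. ennreal (std_normal_density (- x)))) borel uminus"
    by (rule density_distr) auto
  also have "\<dots> = distr real_normal_law borel uminus"
    by (simp add: real_normal_law_def normal_density_def)
  finally show ?thesis ..
qed

lemma complex_normal_law_uminus: "distr complex_normal_law borel uminus = complex_normal_law"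
proof -
  interpret N: prob_space real_normal_law by (rule prob_space_real_normal_law)
  let ?N = "real_normal_law" and ?F = "\<lambda>(a, b). (complex_of_real a + \<i> * complex_of_real b) / complex_of_real (sqrt 2)"
  have F [measurable]: "?F \<in> borel_measurable (borel \<Otimes>\<^sub>M borel)" by (simp add: split_beta')
  have "?N \<Otimes>\<^sub>M ?N = distr ?N borel uminus \<Otimes>\<^sub>M distr ?N borel uminus"
    by (simp only: real_normal_law_uminus)
  also have "\<dots> = distr (?N \<Otimes>\<^sub>M ?N) (borel \<Otimes>\<^sub>M borel) (\<lambda>(x, y). (- x, - y))"
    by (rule pair_measure_distr) (auto simp: real_normal_law_uminus intro: N.sigma_finite_measure_axioms)
  finally have NN: "distr (?N \<Otimes>\<^sub>M ?N) (borel \<Otimes>\<^sub>M borel) (\<lambda>(x, y). (- x, - y)) = ?N \<Otimes>\<^sub>M ?N" ..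
  have "complex_normal_law = distr (distr (?N \<Otimes>\<^sub>M ?N) (borel \<Otimes>\<^sub>M borel) (\<lambda>(x, y). (- x, - y))) borel ?F"
    by (simp only: complex_normal_law_def NN)
  also have "\<dots> = distr (?N \<Otimes>\<^sub>M ?N) borel (?F \<circ> (\<lambda>(x, y). (- x, - y)))"
    by (rule distr_distr) auto
  also have "?F \<circ> (\<lambda>(x, y). (- x, - y)) = uminus \<circ> ?F"
    by (auto simp: fun_eq_iff add_divide_distrib)
  also have "distr (?N \<Otimes>\<^sub>M ?N) borel (uminus \<circ> ?F) = distr complex_normal_law borel uminus"
    unfolding complex_normal_law_def by (rule distr_distr[symmetric]) auto
  finally show ?thesis ..
qed

text \<open>Tilting by exp (x^2 / 4) gives sqrt 2 times the centred normal density of variance 2. As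
  |z|^2 / 2 = a^2 / 4 + b^2 / 4, the complex moment is the square of this one.\<close>

lemma real_normal_law_exp_moment: "(\<integral>\<^sup>+x. ennreal (exp (x\<^sup>2 / 4)) \<partial>real_normal_law) = ennreal (sqrt 2)"
proof -
  have "std_normal_density x * exp (x\<^sup>2 / 4) = sqrt 2 * normal_density 0 (sqrt 2) x" for x
  proof -
    have "exp (- x\<^sup>2 / 2) * exp (x\<^sup>2 / 4) = exp (- x\<^sup>2 / 4)"
      unfolding exp_add[symmetric] by simp
    moreover have "1 / sqrt (2 * pi) = sqrt 2 * (1 / sqrt (4 * pi))"
      by (simp add: real_sqrt_mult field_simps)
    ultimately show ?thesis by (simp add: normal_density_def)
  qed
  then have "ennreal (std_normal_density x) * ennreal (exp (x\<^sup>2 / 4)) = ennreal (sqrt 2) * ennreal (normal_density 0 (sqrt 2) x)" for x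
    by (simp add: ennreal_mult[symmetric])
  then have "(\<integral>\<^sup>+x. ennreal (exp (x\<^sup>2 / 4)) \<partial>real_normal_law)
     = (\<integral>\<^sup>+x. ennreal (sqrt 2) * ennreal (normal_density 0 (sqrt 2) x) \<partial>lborel)"
    by (simp add: real_normal_law_def nn_integral_density)
  also have "\<dots> = ennreal (sqrt 2) * (\<integral>\<^sup>+x. ennreal (normal_density 0 (sqrt 2) x) \<partial>lborel)"
    by (rule nn_integral_cmult) simp
  also have "(\<integral>\<^sup>+x. ennreal (normal_density 0 (sqrt 2) x) \<partial>lborel) = 1"
  proof -
    interpret prob_space "density lborel (normal_density 0 (sqrt 2))"
      by (rule prob_space_normal_density) simp
    show ?thesis using emeasure_space_1 by (simp add: emeasure_density)
  qed
  finally show ?thesis by simp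
qed

lemma complex_normal_law_exp_moment: "(\<integral>\<^sup>+z. ennreal (exp ((cmod z)\<^sup>2 / 2)) \<partial>complex_normal_law) = 2"
proof -
  interpret N: prob_space real_normal_law by (rule prob_space_real_normal_law)
  let ?N = "real_normal_law" and ?F = "\<lambda>(a, b). (complex_of_real a + \<i> * complex_of_real b) / complex_of_real (sqrt 2)"
  have F [measurable]: "?F \<in> borel_measurable (borel \<Otimes>\<^sub>M borel)" by (simp add: split_beta')
  have sq: "(cmod (?F (a, b)))\<^sup>2 / 2 = a\<^sup>2 / 4 + b\<^sup>2 / 4" for a b
    by (simp add: norm_divide power_divide cmod_power2)
  have "(\<integral>\<^sup>+z. ennreal (exp ((cmod z)\<^sup>2 / 2)) \<partial>complex_normal_law)
     = (\<integral>\<^sup>+p. ennreal (exp ((cmod (?F p))\<^sup>2 / 2)) \<partial>(?N \<Otimes>\<^sub>M ?N))"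
    unfolding complex_normal_law_def by (rule nn_integral_distr) auto
  also have "\<dots> = (\<integral>\<^sup>+a. \<integral>\<^sup>+b. ennreal (exp ((cmod (?F (a, b)))\<^sup>2 / 2)) \<partial>?N \<partial>?N)"
    by (rule N.nn_integral_fst[symmetric]) simp
  also have "\<dots> = (\<integral>\<^sup>+a. \<integral>\<^sup>+b. ennreal (exp (a\<^sup>2 / 4)) * ennreal (exp (b\<^sup>2 / 4)) \<partial>?N \<partial>?N)"
    unfolding sq by (simp add: exp_add ennreal_mult)
  also have "\<dots> = (\<integral>\<^sup>+a. ennreal (exp (a\<^sup>2 / 4)) * ennreal (sqrt 2) \<partial>?N)"
    by (simp add: nn_integral_cmult real_normal_law_exp_moment)
  also have "\<dots> = ennreal (sqrt 2) * ennreal (sqrt 2)"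
    by (simp add: nn_integral_multc real_normal_law_exp_moment)
  also have "\<dots> = 2" by (simp add: ennreal_mult[symmetric])
  finally show ?thesis .
qed

lemma gauss_coeffs_cgauss:
  assumes "std_gaussian_families P h l"
  shows "gauss_coeffs P (cgauss h l) complex_normal_law"
proof -
  interpret prob_space P using assms by (simp add: std_gaussian_families_def)
  have iv: "indep_vars (\<lambda>_. borel) (case_sum h l) UNIV"
    and dist: "\<And>n. distributed P lborel (h n) std_normal_density" "\<And>n. distributed P lborel (l n) std_normal_density"
    using assms by (auto simp: std_gaussian_families_def)
  have [measurable]: "h n \<in> borel_measurable P" "l n \<in> borel_measurable P" for n
    using dist[of n] by (auto simp: distributed_def)
  have law: "distr P borel X = real_normal_law" if "distributed P lborel X std_normal_density" for X
  proof -
    have "distr P borel X = distr P lborel X" by (rule distr_cong) auto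
    then show ?thesis using that by (simp add: distributed_def real_normal_law_def)
  qed
  let ?F = "\<lambda>(a, b). (complex_of_real a + \<i> * complex_of_real b) / complex_of_real (sqrt 2)"
  have F [measurable]: "?F \<in> borel_measurable (borel \<Otimes>\<^sub>M borel)" by (simp add: split_beta')
  show ?thesis
  proof
    \<comment> \<open>Grouping the joint family into the disjoint pairs {Inl n, Inr n} gives
      independence of the g_n; splitting one pair, further below, gives the joint law of h_n and
      l_n.\<close>
    have "indep_vars (\<lambda>n. PiM {Inl n, Inr n} (\<lambda>_. borel)) (\<lambda>n \<omega>. restrict (\<lambda>i. case_sum h l i \<omega>) {Inl n, Inr n}) (UNIV :: int set)"
      by (rule indep_vars_restrict[OF iv]) (auto simp: disjoint_family_on_def)
    then have "indep_vars (\<lambda>_. borel) (\<lambda>n \<omega>. (\<lambda>f. ?F (f (Inl n), f (Inr n))) (restrict (\<lambda>i. case_sum h l i \<omega>) {Inl n, Inr n})) (UNIV :: int set)"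
      by (rule indep_vars_compose2) measurable
    then show "indep_vars (\<lambda>_. borel) (cgauss h l) UNIV"
      by (simp add: cgauss_def[abs_def])
    fix n :: int
    have "indep_var (PiM {Inl n} (\<lambda>_. borel)) (\<lambda>\<omega>. restrict (\<lambda>i. case_sum h l i \<omega>) {Inl n})
        (PiM {Inr n} (\<lambda>_. borel)) (\<lambda>\<omega>. restrict (\<lambda>i. case_sum h l i \<omega>) {Inr n})"
      by (rule indep_var_restrict[OF iv]) auto
    then have "indep_var borel ((\<lambda>f. f (Inl n)) \<circ> (\<lambda>\<omega>. restrict (\<lambda>i. case_sum h l i \<omega>) {Inl n}))
        borel ((\<lambda>f. f (Inr n)) \<circ> (\<lambda>\<omega>. restrict (\<lambda>i. case_sum h l i \<omega>) {Inr n}))"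
      by (rule indep_var_compose) auto
    then have "indep_var borel (h n) borel (l n)" by (simp add: comp_def)
    then have joint: "distr P (borel \<Otimes>\<^sub>M borel) (\<lambda>\<omega>. (h n \<omega>, l n \<omega>)) = real_normal_law \<Otimes>\<^sub>M real_normal_law"
      unfolding indep_var_distribution_eq using law dist by simp
    have "distr P borel (cgauss h l n) = distr P borel (?F \<circ> (\<lambda>\<omega>. (h n \<omega>, l n \<omega>)))"
      by (simp add: cgauss_def[abs_def] comp_def)
    also have "\<dots> = distr (distr P (borel \<Otimes>\<^sub>M borel) (\<lambda>\<omega>. (h n \<omega>, l n \<omega>))) borel ?F"
      by (rule distr_distr[symmetric]) auto
    finally show "distr P borel (cgauss h l n) = complex_normal_law"
      by (simp only: joint complex_normal_law_def)
  qed (simp_all add: complex_normal_law_uminus complex_normal_law_exp_moment)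
qed

section \<open>Convergence in measure and in mean\<close>

context prob_space
begin

lemma AE_imp_converges_in_measure:
  assumes [measurable]: "\<And>N. F N \<in> borel_measurable M" "G \<in> borel_measurable M"
    and ae: "AE x in M. (\<lambda>N. F N x) \<longlonglongrightarrow> G x"
  shows "converges_in_measure M F G"
  unfolding converges_in_measure_def
proof (intro conjI allI impI)
  fix \<epsilon> :: real assume \<epsilon>: "0 < \<epsilon>"
  let ?A = "\<lambda>N. {x \<in> space M. \<bar>F N x - G x\<bar> > \<epsilon>}"
  have "(\<lambda>N. \<integral>x. indicator (?A N) x \<partial>M) \<longlonglongrightarrow> (\<integral>x. 0 \<partial>M :: real)"
  proof (rule integral_dominated_convergence[where w = "\<lambda>_. 1"])
    show "AE x in M. (\<lambda>N. indicator (?A N) x :: real) \<longlonglongrightarrow> 0"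
      using ae
    proof eventually_elim
      case (elim x)
      then have "eventually (\<lambda>N. dist (F N x) (G x) < \<epsilon>) sequentially" using \<epsilon> by (rule tendstoD)
      then have "eventually (\<lambda>N. indicator (?A N) x = (0 :: real)) sequentially"
        by eventually_elim (auto simp: dist_real_def indicator_def)
      then show ?case by (rule tendsto_eventually)
    qed
  qed (auto simp: indicator_def)
  then have "(\<lambda>N. prob (?A N)) \<longlonglongrightarrow> 0" by simp
  then show "(\<lambda>N. emeasure M (?A N)) \<longlonglongrightarrow> 0"
    unfolding emeasure_eq_measure using tendsto_ennrealI by fastforce
qed (use assms in auto)

text \<open>The main statement speaks of every limit in measure; this identifies each of them almost
  everywhere with the pointwise limit.\<close>

lemma converges_in_measure_unique:
  assumes "converges_in_measure M F G" "converges_in_measure M F G'"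
  shows "AE x in M. G x = G' x"
proof -
  have [measurable]: "F N \<in> borel_measurable M" "G \<in> borel_measurable M" "G' \<in> borel_measurable M" for N
    using assms by (auto simp: converges_in_measure_def)
  have "AE x in M. \<bar>G x - G' x\<bar> \<le> 2 / real (Suc k)" for k
  proof -
    define \<epsilon> where "\<epsilon> = 1 / real (Suc k)"
    have \<epsilon>: "0 < \<epsilon>" by (simp add: \<epsilon>_def)
    let ?A = "\<lambda>N. {x \<in> space M. \<bar>F N x - G x\<bar> > \<epsilon>}" and ?B = "\<lambda>N. {x \<in> space M. \<bar>F N x - G' x\<bar> > \<epsilon>}"
    let ?C = "{x \<in> space M. \<bar>G x - G' x\<bar> > 2 * \<epsilon>}"
    have "emeasure M ?C \<le> emeasure M (?A N) + emeasure M (?B N)" for N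
    proof -
      have "emeasure M ?C \<le> emeasure M (?A N \<union> ?B N)" by (intro emeasure_mono) auto
      also have "\<dots> \<le> emeasure M (?A N) + emeasure M (?B N)" by (intro emeasure_subadditive) auto
      finally show ?thesis .
    qed
    moreover have "(\<lambda>N. emeasure M (?A N) + emeasure M (?B N)) \<longlonglongrightarrow> 0 + 0"
      using assms \<epsilon> by (intro tendsto_add) (auto simp: converges_in_measure_def)
    ultimately have "emeasure M ?C \<le> 0 + 0"
      by (intro tendsto_lowerbound[where F = sequentially]) auto
    then have "?C \<in> null_sets M" by (auto intro: null_setsI)
    then have "AE x in M. x \<notin> ?C" by (rule AE_not_in)
    then show ?thesis using AE_space by eventually_elim (auto simp: \<epsilon>_def)
  qed
  then have "AE x in M. \<forall>k. \<bar>G x - G' x\<bar> \<le> 2 / real (Suc k)"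
    by (simp add: AE_all_countable)
  then show ?thesis
  proof eventually_elim
    case (elim x)
    have "(\<lambda>k. 2 / real (Suc k)) \<longlonglongrightarrow> 0" by real_asymp
    then have "\<bar>G x - G' x\<bar> \<le> 0"
      using elim by (intro tendsto_lowerbound[where F = sequentially]) auto
    then show ?case by simp
  qed
qed

text \<open>A bound in L^2 gives uniform integrability: above the level R the function is at most
  Y^2 / R, and below it bounded convergence applies.\<close>

lemma integral_tendsto_0:
  fixes Y :: "nat \<Rightarrow> 'a \<Rightarrow> real"
  assumes [measurable]: "\<And>N. Y N \<in> borel_measurable M"
    and nonneg: "\<And>N x. 0 \<le> Y N x" and ae: "AE x in M. (\<lambda>N. Y N x) \<longlonglongrightarrow> 0"
    and sq: "\<And>N. integrable M (\<lambda>x. (Y N x)\<^sup>2)" "\<And>N. (\<integral>x. (Y N x)\<^sup>2 \<partial>M) \<le> C"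
  shows "(\<lambda>N. \<integral>x. Y N x \<partial>M) \<longlonglongrightarrow> 0"
proof (rule LIMSEQ_I)
  fix \<epsilon> :: real assume \<epsilon>: "0 < \<epsilon>"
  have "0 \<le> (\<integral>x. (Y 0 x)\<^sup>2 \<partial>M)" by (intro integral_nonneg_AE) auto
  then have C: "0 \<le> C" using sq(2)[of 0] by linarith
  \<comment> \<open>Gives C / R < \<epsilon> / 2; the summand 1 makes this strict and keeps R
    positive when C = 0.\<close>
  define R where "R = 2 * C / \<epsilon> + 1"
  have R: "0 < R" using C \<epsilon> by (simp add: R_def add_nonneg_pos)
  have CR: "C / R < \<epsilon> / 2"
  proof -
    have "2 * C < R * \<epsilon>" using \<epsilon> by (simp add: R_def field_simps)
    then show ?thesis using R by (simp add: field_simps)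
  qed
  have pt: "Y N x \<le> min (Y N x) R + (Y N x)\<^sup>2 / R" for N x
  proof (cases "Y N x \<le> R")
    case False
    then have "Y N x * R \<le> (Y N x)\<^sup>2" using nonneg[of N x] by (simp add: power2_eq_square mult_left_mono)
    then have "Y N x \<le> (Y N x)\<^sup>2 / R" using R by (simp add: pos_le_divide_eq)
    then show ?thesis using R False by simp
  qed (use R in simp)
  have mb: "\<bar>min (Y N x) R\<bar> \<le> R" for N x
    using nonneg[of N x] R by (simp add: min_def)
  have int_min: "integrable M (\<lambda>x. min (Y N x) R)" for N
    using mb by (intro integrable_const_bound[of _ R]) auto
  have intY: "integrable M (Y N)" for N
    by (rule Bochner_Integration.integrable_bound[OF Bochner_Integration.integrable_add[OF int_min[of N] integrable_divide[OF sq(1)[of N], of R]]])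
       (use pt nonneg R in \<open>auto intro!: AE_I2\<close>)
  have "(\<lambda>N. \<integral>x. min (Y N x) R \<partial>M) \<longlonglongrightarrow> (\<integral>x. 0 \<partial>M)"
  proof (rule integral_dominated_convergence[where w = "\<lambda>_. R"])
    show "AE x in M. (\<lambda>N. min (Y N x) R) \<longlonglongrightarrow> 0"
      using ae
    proof eventually_elim
      case (elim x)
      have "(\<lambda>N. min (Y N x) R) \<longlonglongrightarrow> min 0 R" by (intro tendsto_min elim tendsto_const)
      then show ?case using R by simp
    qed
  qed (use mb in auto)
  then have "eventually (\<lambda>N. (\<integral>x. min (Y N x) R \<partial>M) < \<epsilon> / 2) sequentially"
    using \<epsilon> by (intro order_tendstoD) auto
  then obtain N0 where N0: "\<And>N. N0 \<le> N \<Longrightarrow> (\<integral>x. min (Y N x) R \<partial>M) < \<epsilon> / 2"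
    by (auto simp: eventually_sequentially)
  show "\<exists>no. \<forall>N\<ge>no. norm ((\<integral>x. Y N x \<partial>M) - 0) < \<epsilon>"
  proof (intro exI allI impI)
    fix N assume N: "N0 \<le> N"
    have "(\<integral>x. Y N x \<partial>M) \<le> (\<integral>x. min (Y N x) R + (Y N x)\<^sup>2 / R \<partial>M)"
      using intY int_min sq pt by (intro integral_mono) auto
    also have "\<dots> = (\<integral>x. min (Y N x) R \<partial>M) + (\<integral>x. (Y N x)\<^sup>2 \<partial>M) / R"
      using int_min sq by simp
    also have "\<dots> \<le> (\<integral>x. min (Y N x) R \<partial>M) + C / R"
      using sq(2)[of N] R by (intro add_left_mono divide_right_mono) auto
    also have "\<dots> < \<epsilon>" using N0[OF N] CR by linarith
    finally show "norm ((\<integral>x. Y N x \<partial>M) - 0) < \<epsilon>"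
      using nonneg by (simp add: integral_nonneg_AE)
  qed
qed

text \<open>Moments of order 2 p bound |F_N - G|^p in L^2, which is what
  \<open>integral_tendsto_0\<close> needs. Fatou's lemma passes the moment bound on to G.\<close>

lemma converges_in_LpI:
  fixes F :: "nat \<Rightarrow> 'a \<Rightarrow> real"
  assumes p: "1 \<le> p" and [measurable]: "\<And>N. F N \<in> borel_measurable M" "G \<in> borel_measurable M"
    and ae: "AE x in M. (\<lambda>N. F N x) \<longlonglongrightarrow> G x"
    and bound: "\<And>N. (\<integral>\<^sup>+x. ennreal (\<bar>F N x\<bar> powr (2 * p)) \<partial>M) \<le> ennreal C"
  shows "in_Lp p M G" "converges_in_Lp p M F G"
proof -
  have Gbound: "(\<integral>\<^sup>+x. ennreal (\<bar>G x\<bar> powr (2 * p)) \<partial>M) \<le> ennreal C"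
  proof -
    have "(\<integral>\<^sup>+x. ennreal (\<bar>G x\<bar> powr (2 * p)) \<partial>M) = (\<integral>\<^sup>+x. liminf (\<lambda>N. ennreal (\<bar>F N x\<bar> powr (2 * p))) \<partial>M)"
    proof (rule nn_integral_cong_AE, use ae in eventually_elim)
      case (elim x)
      have "(\<lambda>N. ennreal (\<bar>F N x\<bar> powr (2 * p))) \<longlonglongrightarrow> ennreal (\<bar>G x\<bar> powr (2 * p))"
        using p by (intro tendsto_ennrealI tendsto_powr' tendsto_rabs elim tendsto_const) auto
      from lim_imp_Liminf[OF sequentially_bot this] show ?case by (rule sym)
    qed
    also have "\<dots> \<le> liminf (\<lambda>N. \<integral>\<^sup>+x. ennreal (\<bar>F N x\<bar> powr (2 * p)) \<partial>M)"
      by (rule nn_integral_liminf) auto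
    also have "\<dots> \<le> limsup (\<lambda>N. \<integral>\<^sup>+x. ennreal (\<bar>F N x\<bar> powr (2 * p)) \<partial>M)"
      by (rule Liminf_le_Limsup) simp
    also have "\<dots> \<le> ennreal C" using bound by (intro Limsup_bounded) auto
    finally show ?thesis .
  qed
  have Lp: "in_Lp p M f" if [measurable]: "f \<in> borel_measurable M"
    and b: "(\<integral>\<^sup>+x. ennreal (\<bar>f x\<bar> powr (2 * p)) \<partial>M) \<le> ennreal C" for f
  proof -
    have i2: "integrable M (\<lambda>x. \<bar>f x\<bar> powr (2 * p))"
      using b by (intro integrableI_bounded) (auto simp: order.strict_trans1)
    have "integrable M (\<lambda>x. \<bar>f x\<bar> powr p)"
    proof (rule Bochner_Integration.integrable_bound)
      show "integrable M (\<lambda>x. 1 + \<bar>f x\<bar> powr (2 * p))" using i2 by auto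
      have "\<bar>f x\<bar> powr p \<le> 1 + \<bar>f x\<bar> powr (2 * p)" for x
      proof (cases "\<bar>f x\<bar> \<le> 1")
        case True
        then have "\<bar>f x\<bar> powr p \<le> 1" using p by (simp add: powr_le1)
        then show ?thesis by (simp add: add_increasing2)
      next
        case False
        then have "\<bar>f x\<bar> powr p \<le> \<bar>f x\<bar> powr (2 * p)" using p by (intro powr_mono) auto
        then show ?thesis by simp
      qed
      then show "AE x in M. norm (\<bar>f x\<bar> powr p) \<le> norm (1 + \<bar>f x\<bar> powr (2 * p))"
        by (auto simp: abs_of_nonneg)
    qed simp
    then show ?thesis by (simp add: in_Lp_def)
  qed
  show G: "in_Lp p M G" by (rule Lp[OF _ Gbound]) simp
  define Y where "Y N x = \<bar>F N x - G x\<bar> powr p" for N x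
  have [measurable]: "Y N \<in> borel_measurable M" for N unfolding Y_def by measurable
  have "(\<lambda>N. \<integral>x. Y N x \<partial>M) \<longlonglongrightarrow> 0"
  proof (rule integral_tendsto_0)
    show "0 \<le> Y N x" for N x by (simp add: Y_def)
    show "AE x in M. (\<lambda>N. Y N x) \<longlonglongrightarrow> 0"
      using ae
    proof eventually_elim
      case (elim x)
      have "(\<lambda>N. \<bar>F N x - G x\<bar>) \<longlonglongrightarrow> 0"
        using elim by (simp add: LIM_zero tendsto_rabs_zero)
      then show ?case unfolding Y_def using p by (intro tendsto_zero_powrI[OF _ tendsto_const]) auto
    qed
    have sq: "(Y N x)\<^sup>2 = \<bar>F N x - G x\<bar> powr (2 * p)" for N x
      by (simp add: Y_def power2_eq_square powr_add[symmetric])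
    have pt: "(Y N x)\<^sup>2 \<le> 2 powr (2 * p) * (\<bar>F N x\<bar> powr (2 * p) + \<bar>G x\<bar> powr (2 * p))" for N x
    proof -
      define m where "m = max \<bar>F N x\<bar> \<bar>G x\<bar>"
      have "\<bar>F N x - G x\<bar> powr (2 * p) \<le> (2 * m) powr (2 * p)"
        using p by (intro powr_mono2) (auto simp: m_def)
      also have "\<dots> = 2 powr (2 * p) * m powr (2 * p)" by (simp add: powr_mult m_def)
      also have "m powr (2 * p) \<le> \<bar>F N x\<bar> powr (2 * p) + \<bar>G x\<bar> powr (2 * p)"
        by (auto simp: m_def max_def)
      finally show ?thesis by (simp add: sq)
    qed
    \<comment> \<open>The sign of C is unknown and \<open>ennreal\<close> sends negative numbers to
      0, so the real bound is stated with \<open>\<bar>C\<bar>\<close>.\<close>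
    have nn: "(\<integral>\<^sup>+x. ennreal ((Y N x)\<^sup>2) \<partial>M) \<le> ennreal (2 powr (2 * p) * (2 * \<bar>C\<bar>))" for N
    proof -
      have "(\<integral>\<^sup>+x. ennreal ((Y N x)\<^sup>2) \<partial>M)
          \<le> (\<integral>\<^sup>+x. ennreal (2 powr (2 * p)) * (ennreal (\<bar>F N x\<bar> powr (2 * p)) + ennreal (\<bar>G x\<bar> powr (2 * p))) \<partial>M)"
      proof (rule nn_integral_mono)
        fix x
        have "ennreal ((Y N x)\<^sup>2) \<le> ennreal (2 powr (2 * p) * (\<bar>F N x\<bar> powr (2 * p) + \<bar>G x\<bar> powr (2 * p)))"
          by (rule ennreal_leI[OF pt])
        then show "ennreal ((Y N x)\<^sup>2) \<le> ennreal (2 powr (2 * p)) * (ennreal (\<bar>F N x\<bar> powr (2 * p)) + ennreal (\<bar>G x\<bar> powr (2 * p)))"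
          by (simp add: ennreal_mult)
      qed
      also have "\<dots> = ennreal (2 powr (2 * p)) * ((\<integral>\<^sup>+x. ennreal (\<bar>F N x\<bar> powr (2 * p)) \<partial>M) + (\<integral>\<^sup>+x. ennreal (\<bar>G x\<bar> powr (2 * p)) \<partial>M))"
        by (simp add: nn_integral_cmult nn_integral_add)
      also have "\<dots> \<le> ennreal (2 powr (2 * p)) * (ennreal \<bar>C\<bar> + ennreal \<bar>C\<bar>)"
        using bound[of N] Gbound by (intro mult_left_mono add_mono) (auto elim: order.trans intro!: ennreal_leI)
      also have "\<dots> = ennreal (2 powr (2 * p) * (2 * \<bar>C\<bar>))"
        by (simp add: ennreal_mult ennreal_plus[symmetric] del: ennreal_plus)
      finally show ?thesis .
    qed
    show i: "integrable M (\<lambda>x. (Y N x)\<^sup>2)" for N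
      using nn[of N] by (intro integrableI_bounded) (auto simp: order.strict_trans1)
    show "(\<integral>x. (Y N x)\<^sup>2 \<partial>M) \<le> 2 powr (2 * p) * (2 * \<bar>C\<bar>)" for N
    proof -
      have "ennreal (\<integral>x. (Y N x)\<^sup>2 \<partial>M) \<le> ennreal (2 powr (2 * p) * (2 * \<bar>C\<bar>))"
        using nn[of N] nn_integral_eq_integral[OF i[of N]] by simp
      then show ?thesis by (subst (asm) ennreal_le_iff) auto
    qed
  qed simp
  then have "(\<lambda>N. (\<integral>x. Y N x \<partial>M) powr (1 / p)) \<longlonglongrightarrow> 0"
    using p by (intro tendsto_zero_powrI[OF _ tendsto_const]) (auto simp: Y_def intro!: always_eventually integral_nonneg_AE)
  then show "converges_in_Lp p M F G"
    unfolding converges_in_Lp_def Y_def using G Lp bound by auto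
qed

end

section \<open>The Gaussian measure on the Sobolev space\<close>

lemma sobolev_open_subset:
  "{U. openin (Metric_space.mtopology (sobolev \<sigma>) (sobolev_dist \<sigma>)) U} \<subseteq> Pow (sobolev \<sigma>)"
proof -
  interpret Metric_space "sobolev \<sigma>" "sobolev_dist \<sigma>" by (rule Metric_space_sobolev)
  show ?thesis using openin_subset[of mtopology] by auto
qed

lemma space_sobolev_borel: "space (sobolev_borel \<sigma>) = sobolev \<sigma>"
  using sobolev_open_subset by (simp add: sobolev_borel_def)

lemma sets_sobolev_borel: "sets (sobolev_borel \<sigma>) =
    sigma_sets (sobolev \<sigma>) {U. openin (Metric_space.mtopology (sobolev \<sigma>) (sobolev_dist \<sigma>)) U}"
  using sobolev_open_subset by (simp add: sobolev_borel_def)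

lemma cmod_le_sobolev_dist:
  assumes "c \<in> sobolev \<sigma>" "d \<in> sobolev \<sigma>"
  shows "jbracket n powr \<sigma> * cmod (c n - d n) \<le> sobolev_dist \<sigma> c d"
  using L2_set_le_sobolev_norm[OF sobolev_diff[OF assms], of "{n}"]
  by (simp add: sobolev_dist_def)

text \<open>Each coordinate is Lipschitz for the Sobolev distance, with constant <n>^(-\<sigma>), so
  preimages of open sets are open.\<close>

lemma measurable_coefficient [measurable]: "(\<lambda>u. u n) \<in> borel_measurable (sobolev_borel \<sigma>)"
proof (rule borel_measurableI)
  interpret Metric_space "sobolev \<sigma>" "sobolev_dist \<sigma>" by (rule Metric_space_sobolev)
  fix S :: "complex set" assume S: "open S"
  let ?U = "(\<lambda>u. u n) -` S \<inter> sobolev \<sigma>"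
  have "openin mtopology ?U"
    unfolding openin_mtopology
  proof (intro conjI allI impI)
    fix u assume u: "u \<in> ?U"
    then obtain e where e: "0 < e" "ball (u n) e \<subseteq> S" using S by (auto simp: open_contains_ball)
    have j: "0 < jbracket n powr \<sigma>" using jbracket_pos[of n] by simp
    show "\<exists>r>0. mball u r \<subseteq> ?U"
    proof (intro exI conjI subsetI)
      show "0 < jbracket n powr \<sigma> * e" using e j by simp
      fix v assume v: "v \<in> mball u (jbracket n powr \<sigma> * e)"
      then have "jbracket n powr \<sigma> * cmod (u n - v n) < jbracket n powr \<sigma> * e"
        using cmod_le_sobolev_dist[of u \<sigma> v n] by auto
      then have "cmod (u n - v n) < e" using j by simp
      then show "v \<in> ?U" using v e by (auto simp: dist_norm)
    qed
  qed auto
  then show "(\<lambda>u. u n) -` S \<inter> space (sobolev_borel \<sigma>) \<in> sets (sobolev_borel \<sigma>)"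
    unfolding space_sobolev_borel sets_sobolev_borel by (auto intro: sigma_sets.Basic)
qed

lemma measurable_G_trunc:
  assumes "cutoff \<kappa> chi" "\<And>n. (\<lambda>x. u x n) \<in> borel_measurable M"
  shows "(\<lambda>x. G_trunc chi N (u x)) \<in> borel_measurable M"
proof -
  interpret m: increment_bounds mass 2 by (rule increment_bounds_mass)
  interpret f: increment_bounds f_coeff 200000 by (rule increment_bounds_f_coeff)
  interpret s: increment_bounds sextic "10 ^ 12" by (rule increment_bounds_sextic)
  have [measurable]: "(\<lambda>x. mass N (u x)) \<in> borel_measurable M" "(\<lambda>x. f_coeff N (u x)) \<in> borel_measurable M"
    "(\<lambda>x. sextic N (u x)) \<in> borel_measurable M"
    by (rule m.measurable_comp f.measurable_comp s.measurable_comp; rule assms)+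
  have [measurable]: "chi \<in> borel_measurable borel"
    using assms(1) by (intro borel_measurable_continuous_onI) (simp add: cutoff_def)
  show ?thesis unfolding G_trunc_eq by measurable
qed

lemma G_trunc_nonneg: "cutoff \<kappa> chi \<Longrightarrow> 0 \<le> G_trunc chi N u"
  by (simp add: G_trunc_eq cutoff_def)

lemma trunc_in_sobolev: "trunc N c \<in> sobolev \<sigma>"
proof -
  have "finite {n\<in>UNIV. jbracket n powr (2 * \<sigma>) * (cmod (trunc N c n))\<^sup>2 \<noteq> 0}"
    by (rule finite_subset[of _ "{- int N..int N}"]) (auto simp: trunc_def split: if_splits)
  then show ?thesis
    unfolding sobolev_def by (simp add: finite_nonzero_values_imp_summable_on)
qed

text \<open>The Sobolev distance controls each coordinate, and truncation at N \<ge> |n| leaves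
  coordinate n alone. A fixed integral is thus bounded by a null sequence. This reduces statements
  about \<mu> to statements about X, in which \<sigma> no longer appears.\<close>

lemma (in gauss_coeffs) AE_series_coefficients:
  assumes "gaussian_series \<sigma> P g \<phi>"
  shows "AE \<omega> in P. \<phi> \<omega> = X \<omega>"
proof -
  have [measurable]: "\<phi> \<in> measurable P (sobolev_borel \<sigma>)"
    and lim: "(\<lambda>N. \<integral>\<^sup>+\<omega>. ennreal ((sobolev_dist \<sigma> (trunc N (X \<omega>)) (\<phi> \<omega>))\<^sup>2) \<partial>P) \<longlonglongrightarrow> 0"
    using assms by (auto simp: gaussian_series_def X_def[abs_def])
  have \<phi>: "\<phi> \<omega> \<in> sobolev \<sigma>" if "\<omega> \<in> space P" for \<omega>
    using measurable_space[of \<phi> P "sobolev_borel \<sigma>"] that by (simp add: space_sobolev_borel)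
  have "AE \<omega> in P. \<phi> \<omega> n = X \<omega> n" for n
  proof -
    have [measurable]: "(\<lambda>\<omega>. \<phi> \<omega> n) \<in> borel_measurable P"
      by (rule measurable_compose[OF \<open>\<phi> \<in> measurable P (sobolev_borel \<sigma>)\<close> measurable_coefficient])
    define D where "D \<omega> = ennreal ((jbracket n powr \<sigma> * cmod (X \<omega> n - \<phi> \<omega> n))\<^sup>2)" for \<omega>
    have [measurable]: "D \<in> borel_measurable P" unfolding D_def by measurable
    have "(\<integral>\<^sup>+\<omega>. D \<omega> \<partial>P) \<le> (\<integral>\<^sup>+\<omega>. ennreal ((sobolev_dist \<sigma> (trunc N (X \<omega>)) (\<phi> \<omega>))\<^sup>2) \<partial>P)"
      if "nat \<bar>n\<bar> \<le> N" for N
    proof (rule nn_integral_mono)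
      fix \<omega> assume "\<omega> \<in> space P"
      then have "jbracket n powr \<sigma> * cmod (trunc N (X \<omega>) n - \<phi> \<omega> n) \<le> sobolev_dist \<sigma> (trunc N (X \<omega>)) (\<phi> \<omega>)"
        by (intro cmod_le_sobolev_dist trunc_in_sobolev \<phi>)
      moreover have "trunc N (X \<omega>) n = X \<omega> n" using that by (simp add: trunc_def)
      ultimately show "D \<omega> \<le> ennreal ((sobolev_dist \<sigma> (trunc N (X \<omega>)) (\<phi> \<omega>))\<^sup>2)"
        unfolding D_def by (intro ennreal_leI power_mono) auto
    qed
    then have "eventually (\<lambda>N. (\<integral>\<^sup>+\<omega>. D \<omega> \<partial>P) \<le> (\<integral>\<^sup>+\<omega>. ennreal ((sobolev_dist \<sigma> (trunc N (X \<omega>)) (\<phi> \<omega>))\<^sup>2) \<partial>P)) sequentially"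
      unfolding eventually_sequentially by blast
    then have "(\<integral>\<^sup>+\<omega>. D \<omega> \<partial>P) \<le> 0"
      by (rule tendsto_lowerbound[OF lim]) simp
    then have "AE \<omega> in P. D \<omega> = 0" by (simp add: nn_integral_0_iff_AE)
    then show ?thesis
    proof eventually_elim
      case (elim \<omega>)
      then have "jbracket n powr \<sigma> * cmod (X \<omega> n - \<phi> \<omega> n) = 0"
        by (simp add: D_def ennreal_eq_0_iff)
      then show ?case using jbracket_pos[of n] by simp
    qed
  qed
  then have "AE \<omega> in P. \<forall>n. \<phi> \<omega> n = X \<omega> n" by (simp add: AE_all_countable)
  then show ?thesis by (simp add: fun_eq_iff)
qed

theorem theorem1p1:
  fixes \<sigma> :: real
    and P :: "'o measure"
    and h l :: "int \<Rightarrow> 'o \<Rightarrow> real"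
    and \<phi> :: "'o \<Rightarrow> int \<Rightarrow> complex"
    and \<mu> :: "(int \<Rightarrow> complex) measure"
  assumes "\<sigma> < 1 / 2"
    and "std_gaussian_families P h l"
    and "gaussian_series \<sigma> P (cgauss h l) \<phi>"
    and "\<mu> = distr P (sobolev_borel \<sigma>) \<phi>"
  shows "(\<forall>\<kappa> chi. \<kappa> > 0 \<and> cutoff \<kappa> chi \<longrightarrow>
            (\<exists>G. converges_in_measure \<mu> (G_trunc chi) G) \<and>
            (\<exists>\<rho>. \<forall>G. converges_in_measure \<mu> (G_trunc chi) G \<longrightarrow>
                    (AE u in \<mu>. 0 \<le> G u) \<and> \<rho> = density \<mu> (\<lambda>u. ennreal (G u)))) \<and>
         (\<forall>p\<ge>1. \<exists>\<kappa>\<^sub>p>0. \<forall>\<kappa> chi. 0 < \<kappa> \<and> \<kappa> \<le> \<kappa>\<^sub>p \<and> cutoff \<kappa> chi \<longrightarrow>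
            (\<forall>G. converges_in_measure \<mu> (G_trunc chi) G \<longrightarrow>
                   in_Lp p \<mu> G \<and> converges_in_Lp p \<mu> (G_trunc chi) G))"
proof -
  interpret gauss_coeffs P "cgauss h l" complex_normal_law
    using assms(2) by (rule gauss_coeffs_cgauss)
  have \<phi>[measurable]: "\<phi> \<in> measurable P (sobolev_borel \<sigma>)"
    using assms(3) by (simp add: gaussian_series_def)
  have \<phi>X: "AE \<omega> in P. \<phi> \<omega> = X \<omega>" using assms(3) by (rule AE_series_coefficients)
  interpret \<mu>: prob_space \<mu>
    unfolding assms(4) by (rule prob_space_distr) simp
  have sets_\<mu>[measurable_cong]: "sets \<mu> = sets (sobolev_borel \<sigma>)" by (simp add: assms(4))
  have meas: "G_trunc chi N \<in> borel_measurable \<mu>" if "cutoff \<kappa> chi" for \<kappa> chi N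
    using measurable_G_trunc[OF that, of "\<lambda>u. u" \<mu>] by simp
  \<comment> \<open>Where the sequence diverges, \<open>lim\<close> is an unspecified value; the
    fact \<open>Glim\<close> below confines this to a null set.\<close>
  define Glim where "Glim chi u = lim (\<lambda>N. G_trunc chi N u)" for chi u
  have Glim_meas: "Glim chi \<in> borel_measurable \<mu>" if "cutoff \<kappa> chi" for \<kappa> chi
    unfolding Glim_def by (intro borel_measurable_lim_metric meas[OF that])
  have Glim: "AE u in \<mu>. (\<lambda>N. G_trunc chi N u) \<longlonglongrightarrow> Glim chi u" if "cutoff \<kappa> chi" for \<kappa> chi
  proof -
    have [measurable]: "G_trunc chi N \<in> borel_measurable (sobolev_borel \<sigma>)" for N
      using measurable_G_trunc[OF that, of "\<lambda>u. u" "sobolev_borel \<sigma>"] by simp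
    \<comment> \<open>The Cauchy property defines a measurable set, as \<open>AE_distr_iff\<close>
      requires for the transfer from P to \<mu>.\<close>
    have "AE \<omega> in P. Cauchy (\<lambda>N. G_trunc chi N (\<phi> \<omega>))"
      using AE_G_trunc_convergent[OF that] \<phi>X
      by eventually_elim (simp add: Cauchy_convergent_iff)
    then have "AE u in \<mu>. Cauchy (\<lambda>N. G_trunc chi N u)"
      unfolding assms(4) by (subst AE_distr_iff) auto
    then show ?thesis
      by eventually_elim (simp add: Glim_def Cauchy_convergent_iff convergent_LIMSEQ_iff)
  qed
  have conv: "converges_in_measure \<mu> (G_trunc chi) (Glim chi)" if "cutoff \<kappa> chi" for \<kappa> chi
    using meas[OF that] Glim_meas[OF that] Glim[OF that] by (rule \<mu>.AE_imp_converges_in_measure)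
  \<comment> \<open>The statement fixes \<rho> before G, so every limit G must give the same measure
    as the pointwise limit. Nonnegativity ensures that \<open>ennreal\<close> cuts nothing
    off.\<close>
  have part1: "(AE u in \<mu>. 0 \<le> G u) \<and> density \<mu> (\<lambda>u. ennreal (Glim chi u)) = density \<mu> (\<lambda>u. ennreal (G u))"
    if chi: "cutoff \<kappa> chi" and G: "converges_in_measure \<mu> (G_trunc chi) G" for \<kappa> chi G
  proof -
    have eq: "AE u in \<mu>. Glim chi u = G u"
      using conv[OF chi] G by (rule \<mu>.converges_in_measure_unique)
    have [measurable]: "G \<in> borel_measurable \<mu>" "Glim chi \<in> borel_measurable \<mu>"
      using G Glim_meas[OF chi] by (auto simp: converges_in_measure_def)
    have "AE u in \<mu>. 0 \<le> G u"
      using eq Glim[OF chi]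
    proof eventually_elim
      case (elim u)
      have "0 \<le> Glim chi u"
        by (rule tendsto_lowerbound[OF elim(2)]) (use G_trunc_nonneg[OF chi] in auto)
      then show ?case using elim by simp
    qed
    moreover have "density \<mu> (\<lambda>u. ennreal (Glim chi u)) = density \<mu> (\<lambda>u. ennreal (G u))"
      using eq by (intro density_cong) (auto elim: eventually_mono)
    ultimately show ?thesis by simp
  qed
  have part2: "\<exists>\<kappa>\<^sub>p>0. \<forall>\<kappa> chi. 0 < \<kappa> \<and> \<kappa> \<le> \<kappa>\<^sub>p \<and> cutoff \<kappa> chi \<longrightarrow>
            (\<forall>G. converges_in_measure \<mu> (G_trunc chi) G \<longrightarrow>
                   in_Lp p \<mu> G \<and> converges_in_Lp p \<mu> (G_trunc chi) G)" if p: "1 \<le> p" for p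
  proof -
    \<comment> \<open>The moment bound is taken at order 2 p, as \<open>converges_in_LpI\<close>
      requires; this determines the threshold \<open>\<kappa>\<^sub>p\<close> from p alone.\<close>
    have "0 < 2 * p" using p by simp
    then obtain \<kappa>\<^sub>p C where \<kappa>\<^sub>p: "0 < \<kappa>\<^sub>p" and C: "\<And>\<kappa> chi N. 0 < \<kappa> \<Longrightarrow> \<kappa> \<le> \<kappa>\<^sub>p \<Longrightarrow> cutoff \<kappa> chi \<Longrightarrow>
       (\<integral>\<^sup>+\<omega>. ennreal (G_trunc chi N (X \<omega>) powr (2 * p)) \<partial>P) \<le> ennreal C"
      by (rule G_trunc_moment) (rule that)
    show ?thesis
    proof (intro exI[of _ \<kappa>\<^sub>p] conjI allI impI \<kappa>\<^sub>p)
      fix \<kappa> chi G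
      assume a: "0 < \<kappa> \<and> \<kappa> \<le> \<kappa>\<^sub>p \<and> cutoff \<kappa> chi" and G: "converges_in_measure \<mu> (G_trunc chi) G"
      then have chi: "cutoff \<kappa> chi" by simp
      have Gm: "G \<in> borel_measurable \<mu>" using G by (simp add: converges_in_measure_def)
      have "AE u in \<mu>. Glim chi u = G u"
        using conv[OF chi] G by (rule \<mu>.converges_in_measure_unique)
      then have ae: "AE u in \<mu>. (\<lambda>N. G_trunc chi N u) \<longlonglongrightarrow> G u"
        using Glim[OF chi] by eventually_elim simp
      have bound: "(\<integral>\<^sup>+u. ennreal (\<bar>G_trunc chi N u\<bar> powr (2 * p)) \<partial>\<mu>) \<le> ennreal C" for N
      proof -
        have [measurable]: "G_trunc chi N \<in> borel_measurable (sobolev_borel \<sigma>)" for N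
          using measurable_G_trunc[OF chi, of "\<lambda>u. u" "sobolev_borel \<sigma>"] by simp
        have "(\<integral>\<^sup>+u. ennreal (\<bar>G_trunc chi N u\<bar> powr (2 * p)) \<partial>\<mu>)
           = (\<integral>\<^sup>+\<omega>. ennreal (\<bar>G_trunc chi N (\<phi> \<omega>)\<bar> powr (2 * p)) \<partial>P)"
          unfolding assms(4) by (rule nn_integral_distr) auto
        also have "\<dots> = (\<integral>\<^sup>+\<omega>. ennreal (G_trunc chi N (X \<omega>) powr (2 * p)) \<partial>P)"
          using \<phi>X by (intro nn_integral_cong_AE) (auto elim!: eventually_mono simp: G_trunc_nonneg[OF chi])
        also have "\<dots> \<le> ennreal C" by (rule C) (use a in auto)
        finally show ?thesis .
      qed
      show "in_Lp p \<mu> G" "converges_in_Lp p \<mu> (G_trunc chi) G"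
        using \<mu>.converges_in_LpI[OF p meas[OF chi] Gm ae bound] by auto
    qed
  qed
  show ?thesis
  proof (intro conjI allI impI)
    fix \<kappa> chi assume a: "\<kappa> > 0 \<and> cutoff \<kappa> chi"
    then show "\<exists>G. converges_in_measure \<mu> (G_trunc chi) G" using conv by blast
    show "\<exists>\<rho>. \<forall>G. converges_in_measure \<mu> (G_trunc chi) G \<longrightarrow>
        (AE u in \<mu>. 0 \<le> G u) \<and> \<rho> = density \<mu> (\<lambda>u. ennreal (G u))"
      using part1 a by blast
  qed (rule part2)
qed

end
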